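(* Let $(T_1,T_2)$ be a pair of commuting pure contractions on a Hilbert space $H$, both with finite defect. Let $\Psi\in H^\infty(\mathbb{D};B(\mathbb{C}^d))$ be a rational matrix-valued pure inner function associated to $(T_1,T_2)$ as described in the context, let $V_\Psi$ be the corresponding variety, and let $(S^\Psi_1,S^\Psi_2)$ be the constrained isometric co-extension of $(T_1,T_2)$ corresponding to $\Psi$. Then $$\sigma(S^\Psi_1,S^\Psi_2)\subset \operatorname{supp}(\operatorname{Ann}(T_1,T_2))\subset \overline{V_\Psi}$$ and $$\sigma(S^\Psi_1,S^\Psi_2)\cap \mathbb{D}^2=\operatorname{supp}(\operatorname{Ann}(T_1,T_2))\cap \mathbb{D}^2=Z(\operatorname{Ann}(T_1,T_2)).$$
   Context: $\sigma(\cdot,\cdot)$ denotes the Taylor spectrum of a commuting pair. $\mathbb{D}$ is the open unit disc, $H^2$ the Hardy space on $\mathbb{D}$, and $H^\infty(\mathbb{D})$, $H^\infty(\mathbb{D}^2)$, $H^\infty(\mathbb{D};B(E',E))$ are the spaces of bounded holomorphic functions (scalar, scalar, operator-valued). $H^2\otimes E$ is identified with the $E$-valued Hardy space; $M_z$ is multiplication by $z$ on $H^2$; for $\Phi\in H^\infty(\mathbb{D};B(E',E))$, $M_\Phi:H^2\otimes E'\to H^2\otimes E$ is $(M_\Phi f)(z)=\Phi(z)f(z)$, and $\Phi$ is inner if $M_\Phi$ is an isometry. A contraction $T$ is pure if $\|T^{*n}h\|\to0$ for all $h$, and has finite defect if $\operatorname{ran}(I-TT^* )$ is finite-dimensional.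 A rational matrix-valued pure inner function is an inner $\Psi\in H^\infty(\mathbb{D};B(\mathbb{C}^d))$ with rational entries such that $\sigma(\Psi(\lambda))\subset\mathbb{D}$ for all $\lambda\in\mathbb{D}$. Setting: $d=\dim\operatorname{ran}(I-T_1T_1^* )$; $J:H\to H^2\otimes\mathbb{C}^d$ is an isometry with $JT_1^*=(M_z\otimes I)^*J$ (the usual minimal isometric co-extension of $T_1$); $\Psi\in H^\infty(\mathbb{D};B(\mathbb{C}^d))$ is a rational matrix-valued pure inner function with $JT_2^*=M_\Psi^*J$ (such $J$ and $\Psi$ are known to exist). Put $V_\Psi=\{(z,w)\in\mathbb{D}^2:\det(\Psi(z)-wI)=0\}$. Functional calculus: for $f\in H^\infty(\mathbb{D}^2)$, let $f(M_z\otimes I,M_\Psi)$ be the multiplication operator by the bounded function $z\mapsto f(z,\Psi(z))$, where $f(z,\Psi(z))$ is the holomorphic function $f(z,\cdot)$ of the matrix $\Psi(z)$. Put $f(T_1,T_2)=J^*f(M_z\otimes I,M_\Psi)J$, which extends the polynomial calculus. Then $\operatorname{Ann}(T_1,T_2)=\{f\in H^\infty(\mathbb{D}^2):f(T_1,T_2)=0\}$. Constrained isometric co-extension: $K_\Psi=\bigcap_{f\in\operatorname{Ann}(T_1,T_2)}\ker f(M_z\otimes I,M_\Psi)^*$, a closed subspace co-invariant for $M_z\otimes I$ and $M_\Psi$, and $S_1^\Psi=P_{K_\Psi}(M_z\otimes I)|_{K_\Psi}$, $S_2^\Psi=P_{K_\Psi}M_\Psi|_{K_\Psi}$, which are commuting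 contractions. For $F\subset H^\infty(\mathbb{D}^2)$, $Z(F)=\{(z,w)\in\mathbb{D}^2: f(z,w)=0\ \forall f\in F\}$. For an ideal $F\subset H^\infty(\mathbb{D}^2)$, $\operatorname{supp}(F)$ is the set of $(\lambda,\mu)\in\mathbb{C}^2$ such that $1\notin F+(z-\lambda)H^\infty(\mathbb{D}^2)+(w-\mu)H^\infty(\mathbb{D}^2)$. *)

theory Defs
  imports
    "HOL-Complex_Analysis.Complex_Analysis"
    "HOL-Library.Function_Algebras"
    "Jordan_Normal_Form.Spectral_Radius"
begin

section \<open>Complex Hilbert spaces and their operators\<close>

text \<open>
  A complex Hilbert space is given by a carrier set inside an additive group with a complex
  scalar multiplication, together with an inner product that is linear in the first argument.
  Working with carriers lets abstract spaces, Hardy spaces of \<open>\<complex>\<^sup>d\<close>-valued functions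
  (with a variable natural number \<open>d\<close>, possibly \<open>0\<close>) and closed subspaces be treated uniformly.
  Operators are functions whose values off the carrier are irrelevant.
\<close>

record 'a inner_product_space = "'a partial_object" +
  cscale :: "complex \<Rightarrow> 'a \<Rightarrow> 'a"
  cinner :: "'a \<Rightarrow> 'a \<Rightarrow> complex"

definition hnorm :: "('a, 'm) inner_product_space_scheme \<Rightarrow> 'a \<Rightarrow> real" where
  "hnorm H x = sqrt (Re (cinner H x x))"

locale complex_hilbert_space =
  vector_space "cscale H" for H :: "'a::ab_group_add inner_product_space" +
  assumes subspace_carrier: "subspace (carrier H)"
    and cinner_add_left: "\<lbrakk>x \<in> carrier H; y \<in> carrier H; z \<in> carrier H\<rbrakk>
          \<Longrightarrow> cinner H (x + y) z = cinner H x z + cinner H y z"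
    and cinner_scale_left: "\<lbrakk>x \<in> carrier H; y \<in> carrier H\<rbrakk>
          \<Longrightarrow> cinner H (cscale H c x) y = c * cinner H x y"
    and cinner_commute: "\<lbrakk>x \<in> carrier H; y \<in> carrier H\<rbrakk>
          \<Longrightarrow> cinner H y x = cnj (cinner H x y)"
    and cinner_nonneg: "x \<in> carrier H \<Longrightarrow> Re (cinner H x x) \<ge> 0"
    and cinner_definite: "\<lbrakk>x \<in> carrier H; cinner H x x = 0\<rbrakk> \<Longrightarrow> x = 0"
    and complete: "\<lbrakk>\<And>n. X n \<in> carrier H;
           \<And>e. e > 0 \<Longrightarrow> \<exists>N. \<forall>m\<ge>N. \<forall>n\<ge>N. hnorm H (X m - X n) < e\<rbrakk>
          \<Longrightarrow> \<exists>x\<in>carrier H. (\<lambda>n. hnorm H (X n - x)) \<longlonglongrightarrow> 0"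

definition linear_op ::
  "'a::ab_group_add inner_product_space \<Rightarrow> 'b::ab_group_add inner_product_space \<Rightarrow> ('a \<Rightarrow> 'b) \<Rightarrow> bool" where
  "linear_op H L A \<longleftrightarrow>
     (\<forall>x\<in>carrier H. A x \<in> carrier L) \<and>
     (\<forall>x\<in>carrier H. \<forall>y\<in>carrier H. A (x + y) = A x + A y) \<and>
     (\<forall>c. \<forall>x\<in>carrier H. A (cscale H c x) = cscale L c (A x))"

definition contraction_op :: "'a::ab_group_add inner_product_space \<Rightarrow> ('a \<Rightarrow> 'a) \<Rightarrow> bool" where
  "contraction_op H T \<longleftrightarrow> linear_op H H T \<and> (\<forall>x\<in>carrier H. hnorm H (T x) \<le> hnorm H x)"

definition isometry_op ::
  "'a::ab_group_add inner_product_space \<Rightarrow> 'b::ab_group_add inner_product_space \<Rightarrow> ('a \<Rightarrow> 'b) \<Rightarrow> bool" where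
  "isometry_op H L A \<longleftrightarrow> linear_op H L A \<and> (\<forall>x\<in>carrier H. hnorm L (A x) = hnorm H x)"

definition adjoint_op ::
  "'a inner_product_space \<Rightarrow> 'b inner_product_space \<Rightarrow> ('a \<Rightarrow> 'b) \<Rightarrow> 'b \<Rightarrow> 'a" where
  "adjoint_op H L A y =
     (THE x. x \<in> carrier H \<and> (\<forall>u\<in>carrier H. cinner L (A u) y = cinner H u x))"

definition pure_op :: "'a inner_product_space \<Rightarrow> ('a \<Rightarrow> 'a) \<Rightarrow> bool" where
  "pure_op H T \<longleftrightarrow> (\<forall>h\<in>carrier H. (\<lambda>n. hnorm H ((adjoint_op H H T ^^ n) h)) \<longlonglongrightarrow> 0)"

definition defect_range :: "'a::ab_group_add inner_product_space \<Rightarrow> ('a \<Rightarrow> 'a) \<Rightarrow> 'a set" where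
  "defect_range H T = (\<lambda>h. h - T (adjoint_op H H T h)) ` carrier H"

definition finite_defect :: "'a::ab_group_add inner_product_space \<Rightarrow> ('a \<Rightarrow> 'a) \<Rightarrow> bool" where
  "finite_defect H T \<longleftrightarrow> (\<exists>B. finite B \<and> defect_range H T \<subseteq> Modules.module.span (cscale H) B)"

definition defect_dim :: "'a::ab_group_add inner_product_space \<Rightarrow> ('a \<Rightarrow> 'a) \<Rightarrow> nat" where
  "defect_dim H T = Vector_Spaces.vector_space.dim (cscale H) (defect_range H T)"

definition orth_proj :: "'a::ab_group_add inner_product_space \<Rightarrow> 'a set \<Rightarrow> 'a \<Rightarrow> 'a" where
  "orth_proj H K x = (THE y. y \<in> K \<and> (\<forall>k\<in>K. cinner H (x - y) k = 0))"

text \<open>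
  The Taylor spectrum of a commuting pair \<open>(A, B)\<close>: the points \<open>(\<lambda>, \<mu>)\<close> for which the Koszul
  complex \<open>0 \<rightarrow> H \<rightarrow> H \<oplus> H \<rightarrow> H \<rightarrow> 0\<close> of \<open>(A - \<lambda>, B - \<mu>)\<close> fails to be exact.
\<close>

definition koszul0 ::
  "'a::ab_group_add inner_product_space \<Rightarrow> ('a \<Rightarrow> 'a) \<Rightarrow> ('a \<Rightarrow> 'a) \<Rightarrow> complex \<Rightarrow> complex \<Rightarrow> 'a \<Rightarrow> 'a \<times> 'a" where
  "koszul0 H A B l m x = (A x - cscale H l x, B x - cscale H m x)"

definition koszul1 ::
  "'a::ab_group_add inner_product_space \<Rightarrow> ('a \<Rightarrow> 'a) \<Rightarrow> ('a \<Rightarrow> 'a) \<Rightarrow> complex \<Rightarrow> complex \<Rightarrow> 'a \<times> 'a \<Rightarrow> 'a" where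
  "koszul1 H A B l m = (\<lambda>(x, y). (A y - cscale H l y) - (B x - cscale H m x))"

definition koszul_exact ::
  "'a::ab_group_add inner_product_space \<Rightarrow> ('a \<Rightarrow> 'a) \<Rightarrow> ('a \<Rightarrow> 'a) \<Rightarrow> complex \<Rightarrow> complex \<Rightarrow> bool" where
  "koszul_exact H A B l m \<longleftrightarrow>
     {x \<in> carrier H. koszul0 H A B l m x = (0, 0)} = {0} \<and>
     koszul0 H A B l m ` carrier H = {p \<in> carrier H \<times> carrier H. koszul1 H A B l m p = 0} \<and>
     koszul1 H A B l m ` (carrier H \<times> carrier H) = carrier H"

definition taylor_spectrum ::
  "'a::ab_group_add inner_product_space \<Rightarrow> ('a \<Rightarrow> 'a) \<Rightarrow> ('a \<Rightarrow> 'a) \<Rightarrow> (complex \<times> complex) set" where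
  "taylor_spectrum H A B = {(l, m). \<not> koszul_exact H A B l m}"


section \<open>The Hardy space and multiplication operators\<close>

abbreviation unit_disc :: "complex set" (\<open>\<DD>\<close>) where
  "\<DD> \<equiv> ball 0 1"

definition taylor_coeff :: "(complex \<Rightarrow> complex) \<Rightarrow> nat \<Rightarrow> complex" where
  "taylor_coeff f n = (deriv ^^ n) f 0 / fact n"

text \<open>
  \<open>H\<^sup>2 \<otimes> \<complex>\<^sup>d\<close> as the space of \<open>\<complex>\<^sup>d\<close>-valued holomorphic functions on the disc with square
  summable Taylor coefficients.  The \<open>i\<close>-th component of \<open>h(z)\<close> is \<open>h z i\<close>; elements are
  normalised to vanish for \<open>i \<ge> d\<close> and off the disc, so that equality of functions is equality
  in the space.
\<close>

definition hardy :: "nat \<Rightarrow> (complex \<Rightarrow> nat \<Rightarrow> complex) inner_product_space" where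
  "hardy d = \<lparr>
     carrier = {h. (\<forall>z i. z \<notin> \<DD> \<or> i \<ge> d \<longrightarrow> h z i = 0) \<and>
                   (\<forall>i<d. (\<lambda>z. h z i) holomorphic_on \<DD> \<and>
                          summable (\<lambda>n. (cmod (taylor_coeff (\<lambda>z. h z i) n))\<^sup>2))},
     cscale = (\<lambda>c h z i. c * h z i),
     cinner = (\<lambda>h g. \<Sum>n. \<Sum>i<d.
        taylor_coeff (\<lambda>z. h z i) n * cnj (taylor_coeff (\<lambda>z. g z i) n)) \<rparr>"

definition mult_op ::
  "nat \<Rightarrow> (complex \<Rightarrow> complex mat) \<Rightarrow> (complex \<Rightarrow> nat \<Rightarrow> complex) \<Rightarrow> complex \<Rightarrow> nat \<Rightarrow> complex" where
  "mult_op d \<Phi> h = (\<lambda>z i. if z \<in> \<DD> \<and> i < d then \<Sum>j<d. \<Phi> z $$ (i, j) * h z j else 0)"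

definition shift_op :: "nat \<Rightarrow> (complex \<Rightarrow> nat \<Rightarrow> complex) \<Rightarrow> complex \<Rightarrow> nat \<Rightarrow> complex" where
  "shift_op d = mult_op d (\<lambda>z. z \<cdot>\<^sub>m 1\<^sub>m d)"

text \<open>\<open>H\<^sup>\<infinity>(\<DD>; B(\<complex>\<^sup>d))\<close>; boundedness of all entries is boundedness in operator norm.\<close>

definition Hinf_mat :: "nat \<Rightarrow> (complex \<Rightarrow> complex mat) set" where
  "Hinf_mat d = {\<Phi>. (\<forall>z\<in>\<DD>. \<Phi> z \<in> carrier_mat d d) \<and>
     (\<forall>i<d. \<forall>j<d. (\<lambda>z. \<Phi> z $$ (i, j)) holomorphic_on \<DD>) \<and>
     (\<exists>C. \<forall>z\<in>\<DD>. \<forall>i<d. \<forall>j<d. cmod (\<Phi> z $$ (i, j)) \<le> C)}"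

definition inner_fun :: "nat \<Rightarrow> (complex \<Rightarrow> complex mat) \<Rightarrow> bool" where
  "inner_fun d \<Phi> \<longleftrightarrow> \<Phi> \<in> Hinf_mat d \<and> isometry_op (hardy d) (hardy d) (mult_op d \<Phi>)"

definition rational_entries :: "nat \<Rightarrow> (complex \<Rightarrow> complex mat) \<Rightarrow> bool" where
  "rational_entries d \<Phi> \<longleftrightarrow> (\<forall>i<d. \<forall>j<d. \<exists>p q :: complex poly.
     \<forall>z\<in>\<DD>. poly q z \<noteq> 0 \<and> \<Phi> z $$ (i, j) = poly p z / poly q z)"

definition rational_pure_inner :: "nat \<Rightarrow> (complex \<Rightarrow> complex mat) \<Rightarrow> bool" where
  "rational_pure_inner d \<Phi> \<longleftrightarrow>
     inner_fun d \<Phi> \<and> rational_entries d \<Phi> \<and> (\<forall>z\<in>\<DD>. spectrum (\<Phi> z) \<subseteq> \<DD>)"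

definition V_set :: "nat \<Rightarrow> (complex \<Rightarrow> complex mat) \<Rightarrow> (complex \<times> complex) set" where
  "V_set d \<Psi> = {(z, w). z \<in> \<DD> \<and> w \<in> \<DD> \<and> Determinant.det (\<Psi> z - w \<cdot>\<^sub>m 1\<^sub>m d) = 0}"


section \<open>Bounded holomorphic functions on the bidisc\<close>

text \<open>
  Only the values on the bidisc of functions in \<open>H\<^sup>\<infinity>(\<DD>\<^sup>2)\<close> matter.
  Holomorphy means complex differentiability in both variables jointly.
\<close>

definition Hinf2 :: "(complex \<times> complex \<Rightarrow> complex) set" where
  "Hinf2 = {f. (\<forall>p\<in>\<DD> \<times> \<DD>. \<exists>a b. (f has_derivative (\<lambda>(u, v). a * u + b * v)) (at p)) \<and>
     (\<exists>C. \<forall>p\<in>\<DD> \<times> \<DD>. cmod (f p) \<le> C)}"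

definition zero_set :: "(complex \<times> complex \<Rightarrow> complex) set \<Rightarrow> (complex \<times> complex) set" where
  "zero_set F = {p \<in> \<DD> \<times> \<DD>. \<forall>f\<in>F. f p = 0}"

definition supp :: "(complex \<times> complex \<Rightarrow> complex) set \<Rightarrow> (complex \<times> complex) set" where
  "supp F = {(l, m). \<not> (\<exists>f\<in>F. \<exists>g\<in>Hinf2. \<exists>h\<in>Hinf2. \<forall>(z, w)\<in>\<DD> \<times> \<DD>.
     1 = f (z, w) + (z - l) * g (z, w) + (w - m) * h (z, w))}"

text \<open>
  For \<open>f\<close> holomorphic on the disc and a \<open>d \<times> d\<close> matrix \<open>A\<close> with spectrum in the disc, \<open>f(A)\<close> is
  given by the Taylor series of \<open>f\<close> at \<open>0\<close>, summed entrywise.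
\<close>

definition fun_of_mat :: "nat \<Rightarrow> (complex \<Rightarrow> complex) \<Rightarrow> complex mat \<Rightarrow> complex mat" where
  "fun_of_mat d f A = Matrix.mat d d (\<lambda>(i, j). \<Sum>n. taylor_coeff f n * (A ^\<^sub>m n) $$ (i, j))"

definition model_calc ::
  "nat \<Rightarrow> (complex \<Rightarrow> complex mat) \<Rightarrow> (complex \<times> complex \<Rightarrow> complex)
    \<Rightarrow> (complex \<Rightarrow> nat \<Rightarrow> complex) \<Rightarrow> complex \<Rightarrow> nat \<Rightarrow> complex" where
  "model_calc d \<Psi> f = mult_op d (\<lambda>z. fun_of_mat d (\<lambda>w. f (z, w)) (\<Psi> z))"


section \<open>The annihilator and the constrained isometric co-extension\<close>

text \<open>
  \<open>J\<close> is the isometry of \<open>H\<close> into \<open>H\<^sup>2 \<otimes> \<complex>\<^sup>d\<close> which intertwines the adjoints of \<open>T\<^sub>1\<close>, \<open>T\<^sub>2\<close>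
  with those of \<open>M\<^sub>z \<otimes> I\<close>, \<open>M\<^sub>\<Psi>\<close>; the pair \<open>(T\<^sub>1, T\<^sub>2)\<close> enters its functional calculus,
  and hence its annihilator, through \<open>J\<close> and \<open>\<Psi>\<close>.
\<close>

definition pair_calc ::
  "'h inner_product_space \<Rightarrow> nat \<Rightarrow> ('h \<Rightarrow> complex \<Rightarrow> nat \<Rightarrow> complex) \<Rightarrow> (complex \<Rightarrow> complex mat)
    \<Rightarrow> (complex \<times> complex \<Rightarrow> complex) \<Rightarrow> 'h \<Rightarrow> 'h" where
  "pair_calc H d J \<Psi> f h = adjoint_op H (hardy d) J (model_calc d \<Psi> f (J h))"

definition Ann ::
  "'h::ab_group_add inner_product_space \<Rightarrow> nat \<Rightarrow> ('h \<Rightarrow> complex \<Rightarrow> nat \<Rightarrow> complex)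
    \<Rightarrow> (complex \<Rightarrow> complex mat) \<Rightarrow> (complex \<times> complex \<Rightarrow> complex) set" where
  "Ann H d J \<Psi> = {f \<in> Hinf2. \<forall>h\<in>carrier H. pair_calc H d J \<Psi> f h = 0}"

definition coext_space ::
  "'h::ab_group_add inner_product_space \<Rightarrow> nat \<Rightarrow> ('h \<Rightarrow> complex \<Rightarrow> nat \<Rightarrow> complex)
    \<Rightarrow> (complex \<Rightarrow> complex mat) \<Rightarrow> (complex \<Rightarrow> nat \<Rightarrow> complex) inner_product_space" where
  "coext_space H d J \<Psi> = (hardy d)\<lparr>carrier := {k \<in> carrier (hardy d).
     \<forall>f\<in>Ann H d J \<Psi>. adjoint_op (hardy d) (hardy d) (model_calc d \<Psi> f) k = 0}\<rparr>"

definition coext_op1 ::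
  "'h::ab_group_add inner_product_space \<Rightarrow> nat \<Rightarrow> ('h \<Rightarrow> complex \<Rightarrow> nat \<Rightarrow> complex)
    \<Rightarrow> (complex \<Rightarrow> complex mat)
    \<Rightarrow> (complex \<Rightarrow> nat \<Rightarrow> complex) \<Rightarrow> complex \<Rightarrow> nat \<Rightarrow> complex" where
  "coext_op1 H d J \<Psi> k = orth_proj (hardy d) (carrier (coext_space H d J \<Psi>)) (shift_op d k)"

definition coext_op2 ::
  "'h::ab_group_add inner_product_space \<Rightarrow> nat \<Rightarrow> ('h \<Rightarrow> complex \<Rightarrow> nat \<Rightarrow> complex)
    \<Rightarrow> (complex \<Rightarrow> complex mat)
    \<Rightarrow> (complex \<Rightarrow> nat \<Rightarrow> complex) \<Rightarrow> complex \<Rightarrow> nat \<Rightarrow> complex" where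
  "coext_op2 H d J \<Psi> k = orth_proj (hardy d) (carrier (coext_space H d J \<Psi>)) (mult_op d \<Psi> k)"

end

theory Submission
  imports Defs
begin

text \<open>
  Let \<open>M\<^sub>z\<close> and \<open>M\<^sub>\<Psi>\<close> be the model operators on \<open>H\<^sup>2 \<otimes> \<complex>\<^sup>d\<close>, let \<open>A\<close> be the annihilator, and let \<open>K\<close> be the
  constrained space, which is the orthogonal complement of the ranges of all \<open>f(M\<^sub>z, M\<^sub>\<Psi>)\<close> with
  \<open>f \<in> A\<close>.  The geometry of the variety enters through the characteristic function
  \<open>\<chi>(z, w) = det(w - \<Psi>(z))\<close>: by the Cayley-Hamilton theorem \<open>\<chi>(M\<^sub>z, M\<^sub>\<Psi>) = 0\<close>, so \<open>\<chi>\<close> and all its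
  multiples by constants lie in \<open>A\<close>.

  The spectrum lies in the support (\<open>exact_off_supp\<close>).  If \<open>1 = f + (z - l) g + (w - m) h\<close> with
  \<open>f \<in> A\<close>, apply the functional calculus and compress to \<open>K\<close>.  The term with \<open>f\<close> disappears, and
  the compressions of \<open>g(M\<^sub>z, M\<^sub>\<Psi>)\<close> and \<open>h(M\<^sub>z, M\<^sub>\<Psi>)\<close> commute with \<open>S\<^sub>1\<close> and \<open>S\<^sub>2\<close>.  Such a relation
  splits the Koszul complex of \<open>(S\<^sub>1 - l, S\<^sub>2 - m)\<close>.

  The support lies in the closure of the variety (\<open>supp_subset_closure\<close>).  The entries of \<open>\<Psi>\<close> are
  rational and bounded, hence have no poles on the closed disc.  Therefore \<open>\<chi>\<close> is congruent to a
  constant \<open>c\<close> modulo the ideal generated by \<open>z - l\<close> and \<open>w - m\<close>, whenever \<open>l\<close> is in the closed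
  disc, and \<open>c\<close> is the value at \<open>(l, m)\<close> of the continuous extension of \<open>\<chi>\<close>.  If \<open>c \<noteq> 0\<close>, then \<open>(l, m)\<close> is not in
  the support.  If \<open>c = 0\<close>, then some eigenvalue of \<open>\<Psi>(z)\<close> comes close to \<open>m\<close> as \<open>z\<close> tends to \<open>l\<close>,
  and this gives points of the variety near \<open>(l, m)\<close>.

  In the open bidisc (\<open>supp_inter_bidisc\<close>, \<open>not_exact_on_zero_set\<close>), \<open>f - f(l, m)\<close> always belongs
  to the ideal generated by \<open>z - l\<close> and \<open>w - m\<close>, so the support is the common zero set.  At a common
  zero, \<open>\<chi>\<close> vanishes, so \<open>\<Psi>(l)\<close> has a left eigenvector for \<open>m\<close>; the Szego kernel at \<open>l\<close> in its
  direction is a joint eigenvector of all the adjoints \<open>f(M\<^sub>z, M\<^sub>\<Psi>)\<^sup>*\<close>.  It lies in \<open>K\<close> and is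
  orthogonal to the ranges of \<open>S\<^sub>1 - l\<close> and \<open>S\<^sub>2 - m\<close>, so the last Koszul map is not onto.

  The analytic work is to show that \<open>f(M\<^sub>z, M\<^sub>\<Psi>)\<close> is a bounded operator with an adjoint.  Adjoints
  and projections come from the Riesz representation theorem.  Boundedness needs that bounded
  functions multiply \<open>H\<^sup>2\<close> into itself, and that \<open>f(z, \<Psi>(z))\<close> is a bounded function of \<open>z\<close>, which is
  von Neumann's inequality for the contractive matrix \<open>\<Psi>(z)\<close>.  Both follow from one estimate for
  finite Toeplitz sums (\<open>Toeplitz_bound\<close>), proved by the finite Fourier transform.
\<close>


section \<open>Riesz representation in spaces given by carriers\<close>

definition bounded_op ::
  "'a::ab_group_add inner_product_space \<Rightarrow> 'b::ab_group_add inner_product_space \<Rightarrow> ('a \<Rightarrow> 'b) \<Rightarrow> bool" where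
  "bounded_op H L A \<longleftrightarrow> linear_op H L A \<and> (\<exists>C\<ge>0. \<forall>x\<in>carrier H. hnorm L (A x) \<le> C * hnorm H x)"

context complex_hilbert_space
begin

lemma zero_in [simp]: "0 \<in> carrier H"
  and add_in: "x \<in> carrier H \<Longrightarrow> y \<in> carrier H \<Longrightarrow> x + y \<in> carrier H"
  and diff_in: "x \<in> carrier H \<Longrightarrow> y \<in> carrier H \<Longrightarrow> x - y \<in> carrier H"
  and scale_in: "x \<in> carrier H \<Longrightarrow> cscale H c x \<in> carrier H"
  using subspace_carrier subspace_0 subspace_add subspace_diff subspace_scale by blast+

lemma cinner_add_right:
  assumes "x \<in> carrier H" "y \<in> carrier H" "z \<in> carrier H"
  shows "cinner H z (x + y) = cinner H z x + cinner H z y"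
  using assms cinner_commute[of _ z] cinner_commute[of z] cinner_add_left[of x y z]
  by (metis add_in complex_cnj_add complex_cnj_cnj)

lemma cinner_scale_right:
  assumes "x \<in> carrier H" "y \<in> carrier H"
  shows "cinner H x (cscale H c y) = cnj c * cinner H x y"
  using assms cinner_commute[of y x] cinner_commute[of "cscale H c y" x] cinner_scale_left[of y x c] scale_in
  by simp

lemma cinner_zero_left [simp]: "x \<in> carrier H \<Longrightarrow> cinner H 0 x = 0"
  using cinner_add_left[of 0 0 x] by simp

lemma cinner_zero_right [simp]: "x \<in> carrier H \<Longrightarrow> cinner H x 0 = 0"
  using cinner_add_right[of 0 0 x] by simp

lemma cinner_diff_left:
  assumes "x \<in> carrier H" "y \<in> carrier H" "z \<in> carrier H"
  shows "cinner H (x - y) z = cinner H x z - cinner H y z"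
  using assms cinner_add_left[of "x - y" y z] diff_in by (simp add: algebra_simps)

lemma cinner_diff_right:
  assumes "x \<in> carrier H" "y \<in> carrier H" "z \<in> carrier H"
  shows "cinner H z (x - y) = cinner H z x - cinner H z y"
  using assms cinner_add_right[of "x - y" y z] diff_in by (simp add: algebra_simps)

lemma cinner_self: "x \<in> carrier H \<Longrightarrow> cinner H x x = of_real ((hnorm H x)\<^sup>2)"
  using cinner_nonneg[of x] cinner_commute[of x x]
  by (auto simp: hnorm_def complex_eq_iff)

lemma hnorm_sq: "x \<in> carrier H \<Longrightarrow> (hnorm H x)\<^sup>2 = Re (cinner H x x)"
  by (simp add: hnorm_def cinner_nonneg)

lemma hnorm_ge_0 [simp]: "x \<in> carrier H \<Longrightarrow> 0 \<le> hnorm H x"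
  by (simp add: hnorm_def cinner_nonneg)

lemma hnorm_eq_0: "x \<in> carrier H \<Longrightarrow> hnorm H x = 0 \<Longrightarrow> x = 0"
  using cinner_self cinner_definite by simp

lemma hnorm_add_sq:
  assumes "x \<in> carrier H" "y \<in> carrier H"
  shows "(hnorm H (x + y))\<^sup>2 = (hnorm H x)\<^sup>2 + 2 * Re (cinner H x y) + (hnorm H y)\<^sup>2"
  using assms cinner_commute[of x y]
  by (simp add: hnorm_sq add_in cinner_add_left cinner_add_right)

lemma hnorm_diff_sq:
  assumes "x \<in> carrier H" "y \<in> carrier H"
  shows "(hnorm H (x - y))\<^sup>2 = (hnorm H x)\<^sup>2 - 2 * Re (cinner H x y) + (hnorm H y)\<^sup>2"
  using assms cinner_commute[of x y]
  by (simp add: hnorm_sq diff_in cinner_diff_left cinner_diff_right)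

lemma hnorm_scale: "x \<in> carrier H \<Longrightarrow> hnorm H (cscale H c x) = cmod c * hnorm H x"
proof -
  assume x: "x \<in> carrier H"
  have "cinner H (cscale H c x) (cscale H c x) = of_real ((cmod c)\<^sup>2 * (hnorm H x)\<^sup>2)"
  proof -
    have "cinner H (cscale H c x) (cscale H c x) = (c * cnj c) * cinner H x x"
      using x by (simp add: cinner_scale_left cinner_scale_right scale_in)
    then show ?thesis using x cinner_self[of x] by (simp flip: complex_norm_square)
  qed
  then show ?thesis
    unfolding hnorm_def[of H "cscale H c x"] using x
    by (simp add: real_sqrt_mult flip: power_mult_distrib of_real_power of_real_mult)
qed

lemma Cauchy_Schwarz:
  assumes x: "x \<in> carrier H" and y: "y \<in> carrier H"
  shows "cmod (cinner H x y) \<le> hnorm H x * hnorm H y"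
proof (cases "y = 0")
  case True
  then show ?thesis using x by simp
next
  case False
  define c where "c = cinner H x y / of_real ((hnorm H y)\<^sup>2)"
  have ny: "hnorm H y > 0"
    using False hnorm_eq_0[OF y] hnorm_ge_0[OF y] by linarith
  have nc: "cmod c = cmod (cinner H x y) / (hnorm H y)\<^sup>2"
    unfolding c_def by (simp add: norm_divide norm_power)
  have ccy: "Re (cinner H x (cscale H c y)) = (cmod (cinner H x y))\<^sup>2 / (hnorm H y)\<^sup>2"
  proof -
    have "cinner H x (cscale H c y) = of_real ((cmod (cinner H x y))\<^sup>2 / (hnorm H y)\<^sup>2)"
      using x y complex_norm_square[of "cinner H x y"]
      by (simp add: cinner_scale_right c_def mult.commute)
    then show ?thesis by simp
  qed
  have sq: "(hnorm H (cscale H c y))\<^sup>2 = (cmod (cinner H x y))\<^sup>2 / (hnorm H y)\<^sup>2"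
    using ny y by (simp add: hnorm_scale nc power2_eq_square)
  have "0 \<le> (hnorm H (x - cscale H c y))\<^sup>2" by simp
  also have "\<dots> = (hnorm H x)\<^sup>2 - (cmod (cinner H x y))\<^sup>2 / (hnorm H y)\<^sup>2"
    unfolding hnorm_diff_sq[OF x scale_in[OF y]] ccy sq by simp
  finally have "(cmod (cinner H x y))\<^sup>2 / (hnorm H y)\<^sup>2 \<le> (hnorm H x)\<^sup>2" by simp
  then have "(cmod (cinner H x y))\<^sup>2 \<le> (hnorm H x * hnorm H y)\<^sup>2"
    using ny by (simp add: pos_divide_le_eq power_mult_distrib)
  then show ?thesis
    by (rule power2_le_imp_le) (use x y in simp)
qed

lemma eq_if_cinner_eq:
  assumes x: "x \<in> carrier H" and y: "y \<in> carrier H"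
    and eq: "\<And>u. u \<in> carrier H \<Longrightarrow> cinner H u x = cinner H u y"
  shows "x = y"
  using cinner_definite[OF diff_in[OF x y]] eq[OF diff_in[OF x y]] x y
  by (simp add: cinner_diff_right diff_in)

text \<open>
  The representing vector is the minimiser of \<open>q y = \<parallel>y\<parallel>\<^sup>2 - 2 Re (\<phi> y)\<close>: the parallelogram identity
  makes minimising sequences Cauchy, and the first variation of \<open>q\<close> at the minimum is the
  representation formula.
\<close>

lemma Riesz:
  fixes \<phi> :: "'a \<Rightarrow> complex"
  assumes add: "\<And>x y. x \<in> carrier H \<Longrightarrow> y \<in> carrier H \<Longrightarrow> \<phi> (x + y) = \<phi> x + \<phi> y"
    and scale: "\<And>c x. x \<in> carrier H \<Longrightarrow> \<phi> (cscale H c x) = c * \<phi> x"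
    and bound: "\<And>x. x \<in> carrier H \<Longrightarrow> cmod (\<phi> x) \<le> C * hnorm H x"
  obtains y where "y \<in> carrier H" "\<And>x. x \<in> carrier H \<Longrightarrow> \<phi> x = cinner H x y"
proof -
  define q where "q y = (hnorm H y)\<^sup>2 - 2 * Re (\<phi> y)" for y
  have q_ge: "q y \<ge> - C\<^sup>2" if y: "y \<in> carrier H" for y
  proof -
    have "Re (\<phi> y) \<le> C * hnorm H y"
      using bound[OF y] complex_Re_le_cmod[of "\<phi> y"] by linarith
    moreover have "(hnorm H y - C)\<^sup>2 \<ge> 0" by simp
    ultimately show ?thesis
      by (simp add: q_def power2_eq_square algebra_simps)
  qed
  define m where "m = Inf (q ` carrier H)"
  have bdd: "bdd_below (q ` carrier H)"
    by (rule bdd_belowI2[where m = "- C\<^sup>2"]) (rule q_ge)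
  have m_le: "m \<le> q y" if "y \<in> carrier H" for y
    unfolding m_def using bdd that by (simp add: cInf_lower)
  have "\<exists>y\<in>carrier H. q y < m + 1 / real (Suc n)" for n
  proof -
    have "Inf (q ` carrier H) < m + 1 / real (Suc n)" unfolding m_def by simp
    then show ?thesis
      using cInf_less_iff[OF _ bdd, of "m + 1 / real (Suc n)"] zero_in by blast
  qed
  then obtain Y where Y: "\<And>n. Y n \<in> carrier H" and qY: "\<And>n. q (Y n) < m + 1 / real (Suc n)"
    by metis
  (* the parallelogram identity for q: a near-minimiser is close to every other one *)
  have par: "(hnorm H (x - y))\<^sup>2 \<le> 2 * (q x - m) + 2 * (q y - m)"
    if x: "x \<in> carrier H" and y: "y \<in> carrier H" for x y
  proof -
    let ?a = "cscale H (1/2) (x + y)"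
    have a: "?a \<in> carrier H" using x y by (simp add: add_in scale_in)
    have "4 * q ?a = (hnorm H (x + y))\<^sup>2 - 4 * Re (\<phi> (x + y))"
      using x y by (simp add: q_def scale hnorm_scale add_in power_mult_distrib power_divide)
    then have "4 * m \<le> (hnorm H (x + y))\<^sup>2 - 4 * Re (\<phi> (x + y))"
      using m_le[OF a] by simp
    then show ?thesis
      using x y by (simp add: q_def add hnorm_diff_sq hnorm_add_sq)
  qed
  obtain y where y: "y \<in> carrier H" and lim: "(\<lambda>n. hnorm H (Y n - y)) \<longlonglongrightarrow> 0"
  proof -
    have "\<exists>N. \<forall>m\<ge>N. \<forall>n\<ge>N. hnorm H (Y m - Y n) < e" if e: "e > 0" for e
    proof -
      obtain N where N: "1 / real (Suc N) < e\<^sup>2 / 4"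
        using e nat_approx_posE[of "e\<^sup>2 / 4"] by auto
      have "hnorm H (Y i - Y j) < e" if "i \<ge> N" "j \<ge> N" for i j
      proof -
        have "1 / real (Suc i) \<le> 1 / real (Suc N)" "1 / real (Suc j) \<le> 1 / real (Suc N)"
          using that by (simp_all add: field_simps)
        then have "(hnorm H (Y i - Y j))\<^sup>2 < e\<^sup>2"
          using par[OF Y[of i] Y[of j]] qY[of i] qY[of j] N by argo
        then show ?thesis by (rule power2_less_imp_less) (use e in simp)
      qed
      then show ?thesis by blast
    qed
    from complete[OF Y this] that show ?thesis by blast
  qed
  have qy: "q y = m"
  proof (rule antisym)
    have cont: "(\<lambda>n. q (Y n)) \<longlonglongrightarrow> q y"
    proof -
      have d: "Y n - y \<in> carrier H" for n using Y y by (simp add: diff_in)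
      have dec: "q (Y n) - q y = (hnorm H (Y n - y))\<^sup>2 + 2 * Re (cinner H (Y n - y) y) - 2 * Re (\<phi> (Y n - y))" for n
        using hnorm_add_sq[OF d y] add[OF d y] by (simp add: q_def)
      have b1: "(\<lambda>n. cinner H (Y n - y) y) \<longlonglongrightarrow> 0"
        by (rule Lim_null_comparison[OF _ tendsto_mult_left_zero[OF lim, of "hnorm H y"]])
          (use Cauchy_Schwarz[OF d y] in simp)
      have b2: "(\<lambda>n. \<phi> (Y n - y)) \<longlonglongrightarrow> 0"
        by (rule Lim_null_comparison[OF _ tendsto_mult_right_zero[OF lim, of C]])
          (use bound[OF d] in simp)
      have "(\<lambda>n. q (Y n) - q y) \<longlonglongrightarrow> 0\<^sup>2 + 2 * Re 0 - 2 * Re 0"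
        unfolding dec by (intro tendsto_intros lim b1 b2)
      then show ?thesis by (simp add: LIM_zero_iff)
    qed
    have "(\<lambda>n. m + 1 / real (Suc n)) \<longlonglongrightarrow> m + 0"
      by (intro tendsto_intros) (rule LIMSEQ_Suc, rule lim_inverse_n')
    from LIMSEQ_le[OF cont this] show "q y \<le> m"
      using less_imp_le[OF qY] by auto
  qed (use m_le[OF y] in simp)
  have var: "Re (cinner H x y - \<phi> x) = 0" if x: "x \<in> carrier H" for x
  proof (rule ccontr)
    define b where "b = Re (cinner H x y - \<phi> x)"
    assume "Re (cinner H x y - \<phi> x) \<noteq> 0"
    then have b0: "b \<noteq> 0" by (simp add: b_def)
    have ineq: "0 \<le> t\<^sup>2 * (hnorm H x)\<^sup>2 + 2 * t * b" for t :: real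
    proof -
      have "m \<le> q (y + cscale H (of_real t) x)"
        using m_le x y add_in scale_in by blast
      also have "\<dots> = m + t\<^sup>2 * (hnorm H x)\<^sup>2 + 2 * t * b"
        using x y cinner_commute[of x y]
        by (simp add: qy[symmetric] q_def hnorm_add_sq scale_in add scale hnorm_scale
            cinner_scale_right power_mult_distrib b_def algebra_simps)
      finally show ?thesis by simp
    qed
    (* a step of length b / s against the gradient decreases q; the summand 1 keeps s positive *)
    define s where "s = (hnorm H x)\<^sup>2 + 1"
    have s: "s > 0" unfolding s_def by (smt (verit) zero_le_power2)
    have "0 \<le> (b / s)\<^sup>2 * (hnorm H x)\<^sup>2 + 2 * (- b / s) * b"
      using ineq[of "- b / s"] by simp
    also have "\<dots> = (b\<^sup>2 / s) * ((hnorm H x)\<^sup>2 / s - 2)"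
      using s by (simp add: field_simps power2_eq_square)
    also have "\<dots> < 0"
    proof (rule mult_pos_neg)
      show "0 < b\<^sup>2 / s" using b0 s by simp
      have "(hnorm H x)\<^sup>2 / s \<le> 1" using s by (simp add: s_def)
      then show "(hnorm H x)\<^sup>2 / s - 2 < 0" by linarith
    qed
    finally show False by simp
  qed
  have "\<phi> x = cinner H x y" if x: "x \<in> carrier H" for x
    using var[OF x] var[OF scale_in[OF x, of \<i>]] x y
    by (simp add: complex_eq_iff cinner_scale_left scale)
  with y that show ?thesis by blast
qed

end

lemma linear_opD:
  assumes "linear_op H L A"
  shows "x \<in> carrier H \<Longrightarrow> A x \<in> carrier L"
    and "x \<in> carrier H \<Longrightarrow> y \<in> carrier H \<Longrightarrow> A (x + y) = A x + A y"
    and "x \<in> carrier H \<Longrightarrow> A (cscale H c x) = cscale L c (A x)"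
  using assms unfolding linear_op_def by blast+

lemma adjoint_op_exists:
  assumes "complex_hilbert_space H" "complex_hilbert_space L" "bounded_op H L A" and y: "y \<in> carrier L"
  shows "adjoint_op H L A y \<in> carrier H \<and> (\<forall>u\<in>carrier H. cinner L (A u) y = cinner H u (adjoint_op H L A y))"
proof -
  interpret H: complex_hilbert_space H by fact
  interpret L: complex_hilbert_space L by fact
  have lin: "linear_op H L A" using assms(3) by (simp add: bounded_op_def)
  obtain C where C: "C \<ge> 0" "\<And>x. x \<in> carrier H \<Longrightarrow> hnorm L (A x) \<le> C * hnorm H x"
    using assms(3) by (auto simp: bounded_op_def)
  obtain x where x: "x \<in> carrier H" "\<And>u. u \<in> carrier H \<Longrightarrow> cinner L (A u) y = cinner H u x"
  proof (rule H.Riesz[of "\<lambda>u. cinner L (A u) y" "C * hnorm L y"])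
    show "cmod (cinner L (A u) y) \<le> C * hnorm L y * hnorm H u" if u: "u \<in> carrier H" for u
    proof -
      have "cmod (cinner L (A u) y) \<le> hnorm L (A u) * hnorm L y"
        using L.Cauchy_Schwarz[OF linear_opD(1)[OF lin u] y] .
      also have "\<dots> \<le> (C * hnorm H u) * hnorm L y"
        using C(2)[OF u] y by (simp add: mult_right_mono)
      finally show ?thesis by (simp add: mult_ac)
    qed
  qed (use y in \<open>simp_all add: linear_opD[OF lin] L.cinner_add_left L.cinner_scale_left\<close>)
  show ?thesis
    unfolding adjoint_op_def
    by (rule theI2[of _ x]) (use x H.eq_if_cinner_eq in auto)
qed

lemma adjoint_op_eq_0_iff:
  assumes "complex_hilbert_space H" "complex_hilbert_space L" "bounded_op H L A" "y \<in> carrier L"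
  shows "adjoint_op H L A y = 0 \<longleftrightarrow> (\<forall>u\<in>carrier H. cinner L (A u) y = 0)"
proof -
  interpret H: complex_hilbert_space H by fact
  show ?thesis
    using adjoint_op_exists[OF assms] H.eq_if_cinner_eq[of "adjoint_op H L A y" 0] by auto
qed

text \<open>
  The orthogonal complement of a set is a Hilbert space in its own right, so Riesz representation
  applies to it and yields the orthogonal projection.
\<close>

lemma closed_subspace_hilbert:
  assumes hs: "complex_hilbert_space H"
    and K: "K = {k \<in> carrier H. \<forall>y\<in>R. cinner H y k = 0}" and R: "R \<subseteq> carrier H"
  shows "complex_hilbert_space (H\<lparr>carrier := K\<rparr>)"
proof -
  interpret H: complex_hilbert_space H by fact
  have hn: "hnorm (H\<lparr>carrier := K\<rparr>) = hnorm H" by (rule ext) (simp add: hnorm_def)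
  have KH: "k \<in> carrier H" if "k \<in> K" for k using that K by simp
  show ?thesis
  proof (unfold_locales, unfold hn, goal_cases)
    case 5
    show ?case
      using subsetD[OF R]
      by (simp add: K H.subspace_def H.add_in H.scale_in H.cinner_add_right H.cinner_scale_right)
  next
    case (8 x y)
    then show ?case using H.cinner_commute[of x y] KH by simp
  next
    case (11 X)
    obtain x where x: "x \<in> carrier H" and lim: "(\<lambda>n. hnorm H (X n - x)) \<longlonglongrightarrow> 0"
      using H.complete[of X] 11 KH by auto
    have "cinner H y x = 0" if y: "y \<in> R" for y
    proof -
      have yH: "y \<in> carrier H" using y R by auto
      have "cmod (cinner H y x) \<le> hnorm H y * hnorm H (X n - x)" for n
      proof -
        have Xn: "X n \<in> carrier H" "cinner H y (X n) = 0" using 11(1)[of n] y K by auto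
        have "cinner H y (X n - x) = - cinner H y x"
          using Xn x yH by (simp add: H.cinner_diff_right)
        then show ?thesis
          using H.Cauchy_Schwarz[OF yH H.diff_in[OF Xn(1) x]] by simp
      qed
      moreover have "(\<lambda>n. hnorm H y * hnorm H (X n - x)) \<longlonglongrightarrow> 0"
        using tendsto_mult_right_zero[OF lim] .
      ultimately have "cmod (cinner H y x) \<le> 0"
        by (meson LIMSEQ_le_const)
      then show ?thesis by simp
    qed
    then show ?case using x lim K by auto
  qed (use KH in \<open>simp_all add: H.cinner_add_left H.cinner_scale_left
        H.cinner_nonneg H.cinner_definite H.scale_right_distrib H.scale_left_distrib\<close>)
qed

lemma orth_proj_exists:
  assumes hs: "complex_hilbert_space H" and hsK: "complex_hilbert_space (H\<lparr>carrier := K\<rparr>)"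
    and KH: "K \<subseteq> carrier H" and x: "x \<in> carrier H"
  shows "orth_proj H K x \<in> K \<and> (\<forall>k\<in>K. cinner H (x - orth_proj H K x) k = 0)"
proof -
  interpret H: complex_hilbert_space H by fact
  interpret K: complex_hilbert_space "H\<lparr>carrier := K\<rparr>" by fact
  have hn: "hnorm (H\<lparr>carrier := K\<rparr>) = hnorm H" by (rule ext) (simp add: hnorm_def)
  obtain y where y: "y \<in> K" "\<And>k. k \<in> K \<Longrightarrow> cinner H k x = cinner H k y"
  proof (rule K.Riesz[of "\<lambda>k. cinner H k x" "hnorm H x"])
    show "cmod (cinner H k x) \<le> hnorm H x * hnorm (H\<lparr>carrier := K\<rparr>) k" 
      if "k \<in> carrier (H\<lparr>carrier := K\<rparr>)" for k
      using that KH x H.Cauchy_Schwarz[of k x] by (auto simp: hn mult.commute)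
  qed (use x subsetD[OF KH] in \<open>simp_all add: H.cinner_add_left H.cinner_scale_left\<close>)
  have ex: "y \<in> K \<and> (\<forall>k\<in>K. cinner H (x - y) k = 0)"
  proof (intro conjI ballI y(1))
    fix k assume k: "k \<in> K"
    have "cinner H k (x - y) = 0"
      using y(2)[OF k] subsetD[OF KH] k y(1) x by (simp add: H.cinner_diff_right)
    then show "cinner H (x - y) k = 0"
      using H.cinner_commute[of k "x - y"] subsetD[OF KH] k y(1) x by (simp add: H.diff_in)
  qed
  show ?thesis
    unfolding orth_proj_def
  proof (rule theI2[where a = y])
    show "y \<in> K \<and> (\<forall>k\<in>K. cinner H (x - y) k = 0)" by (rule ex)
    fix z assume z: "z \<in> K \<and> (\<forall>k\<in>K. cinner H (x - z) k = 0)"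
    show "z = y"
    proof (rule K.eq_if_cinner_eq)
      fix k assume "k \<in> carrier (H\<lparr>carrier := K\<rparr>)"
      then have k: "k \<in> K" by simp
      have "cinner H (x - z) k = 0" "cinner H (x - y) k = 0" using z ex k by auto
      then have "cinner H z k = cinner H y k"
        using subsetD[OF KH] k z y(1) x by (simp add: H.cinner_diff_left)
      then show "cinner (H\<lparr>carrier := K\<rparr>) k z = cinner (H\<lparr>carrier := K\<rparr>) k y"
        using H.cinner_commute[of z k] H.cinner_commute[of y k] subsetD[OF KH] k z y(1) by simp
    qed (use z y in auto)
  qed
qed

section \<open>The finite Fourier transform and the Toeplitz estimate\<close>

definition sqnorm :: "nat \<Rightarrow> (nat \<Rightarrow> complex) \<Rightarrow> real" where
  "sqnorm d x = (\<Sum>i<d. (cmod (x i))\<^sup>2)"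

definition matvec :: "nat \<Rightarrow> complex mat \<Rightarrow> (nat \<Rightarrow> complex) \<Rightarrow> nat \<Rightarrow> complex" where
  "matvec d A x = (\<lambda>i. \<Sum>j<d. A $$ (i, j) * x j)"

definition unity_root :: "nat \<Rightarrow> nat \<Rightarrow> complex" where
  "unity_root N k = cis (2 * pi * real k / real N)"

lemma norm_unity_root [simp]: "cmod (unity_root N k) = 1"
  by (simp add: unity_root_def)

lemma unity_root_cnj: "unity_root N k * cnj (unity_root N k) = 1"
  using complex_norm_square[of "unity_root N k"] by simp

lemma unity_root_power_swap: "unity_root N k ^ j = unity_root N j ^ k"
  unfolding unity_root_def by (simp add: Complex.DeMoivre mult_ac)

lemma unity_root_orthogonal:
  assumes "k < N" "l < N"
  shows "(\<Sum>n<N. unity_root N n ^ k * cnj (unity_root N n ^ l)) = (if k = l then of_nat N else 0)"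
proof -
  define x where "x = unity_root N k * cnj (unity_root N l)"
  have N: "N > 0" using assms by simp
  have bij: "bij_betw (unity_root N) {..<N} {z. z ^ N = 1}"
    using Complex.bij_betw_roots_unity[OF N] by (simp add: unity_root_def [abs_def])
  have "(\<Sum>n<N. unity_root N n ^ k * cnj (unity_root N n ^ l)) = (\<Sum>n<N. x ^ n)"
    unfolding unity_root_power_swap[of N _ k] unity_root_power_swap[of N _ l]
    by (simp add: x_def power_mult_distrib)
  also have "\<dots> = (if k = l then of_nat N else 0)"
  proof (cases "k = l")
    case True
    then have "x = 1" by (simp add: x_def unity_root_cnj)
    then show ?thesis using True by simp
  next
    case False
    have "x \<noteq> 1"
    proof
      assume "x = 1"
      then have "unity_root N k = unity_root N l"
        using unity_root_cnj[of N l] unfolding x_def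
        by (metis mult.assoc mult.commute mult.right_neutral)
      then show False
        using False bij assms by (auto simp: bij_betw_def inj_on_def)
    qed
    moreover have "x ^ N = 1"
    proof -
      have "unity_root N k ^ N = 1" "unity_root N l ^ N = 1"
        using bij assms by (auto simp: bij_betw_def)
      then show ?thesis by (simp add: x_def power_mult_distrib flip: complex_cnj_power)
    qed
    ultimately have "(\<Sum>n<N. x ^ n) = 0" by (simp add: geometric_sum)
    then show ?thesis using False by simp
  qed
  finally show ?thesis .
qed

lemma finite_Parseval:
  "(\<Sum>n<N. (cmod (\<Sum>j<N. F j * unity_root N n ^ j))\<^sup>2) = real N * (\<Sum>j<N. (cmod (F j))\<^sup>2)"
proof -
  let ?e = "unity_root N"
  have "complex_of_real (\<Sum>n<N. (cmod (\<Sum>j<N. F j * ?e n ^ j))\<^sup>2)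
      = (\<Sum>n<N. (\<Sum>j<N. F j * ?e n ^ j) * cnj (\<Sum>l<N. F l * ?e n ^ l))"
    by (simp only: of_real_sum complex_norm_square)
  also have "\<dots> = (\<Sum>n<N. \<Sum>j<N. \<Sum>l<N. F j * cnj (F l) * (?e n ^ j * cnj (?e n ^ l)))"
    by (simp add: sum_product mult_ac)
  also have "\<dots> = (\<Sum>j<N. \<Sum>l<N. \<Sum>n<N. F j * cnj (F l) * (?e n ^ j * cnj (?e n ^ l)))"
    by (subst sum.swap, rule sum.cong[OF refl], subst sum.swap, rule refl)
  also have "\<dots> = (\<Sum>j<N. \<Sum>l<N. F j * cnj (F l) * (if j = l then of_nat N else 0))"
    by (intro sum.cong refl) (simp only: flip: sum_distrib_left, simp only: unity_root_orthogonal lessThan_iff)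
  also have "\<dots> = (\<Sum>j<N. F j * cnj (F j) * of_nat N)"
    by (intro sum.cong refl) (simp add: if_distrib cong: if_cong)
  also have "\<dots> = complex_of_real (real N * (\<Sum>j<N. (cmod (F j))\<^sup>2))"
    by (simp add: complex_norm_square sum_distrib_left mult_ac del: of_real_power)
  finally show ?thesis by (simp only: of_real_eq_iff)
qed

lemma finite_Parseval_cnj:
  "(\<Sum>n<N. (cmod (\<Sum>j<N. F j * cnj (unity_root N n) ^ j))\<^sup>2) = real N * (\<Sum>j<N. (cmod (F j))\<^sup>2)"
proof -
  have "cmod (\<Sum>j<N. F j * cnj (unity_root N n) ^ j) = cmod (\<Sum>j<N. cnj (F j) * unity_root N n ^ j)" for n
    by (subst complex_mod_cnj[symmetric]) simp
  then show ?thesis using finite_Parseval[where F = "\<lambda>j. cnj (F j)" and N = N] by simp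
qed

lemma sqnorm_cong: "(\<And>i. i < d \<Longrightarrow> x i = y i) \<Longrightarrow> sqnorm d x = sqnorm d y"
  by (simp add: sqnorm_def)

lemma sqnorm_nonneg [simp]: "0 \<le> sqnorm d x"
  by (simp add: sqnorm_def sum_nonneg)

lemma sqnorm_scale: "sqnorm d (\<lambda>i. c * x i) = (cmod c)\<^sup>2 * sqnorm d x"
  by (simp add: sqnorm_def norm_mult power_mult_distrib sum_distrib_left)

lemma matvec_scale: "matvec d A (\<lambda>i. c * x i) = (\<lambda>i. c * matvec d A x i)"
  by (rule ext) (simp add: matvec_def sum_distrib_left mult_ac)

lemma matvec_sum: "matvec d A (\<lambda>i. \<Sum>k\<in>K. x k i * c k) = (\<lambda>i. \<Sum>k\<in>K. matvec d A (x k) i * c k)"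
  by (rule ext) (simp add: matvec_def sum_distrib_left sum_distrib_right mult_ac, subst sum.swap, simp)

text \<open>
  The form \<open>\<langle>(1 - A\<^sup>*A) x, x\<rangle>\<close>.  It is nonnegative if \<open>A\<close> is a contraction, and its sum along an orbit
  of \<open>A\<close> telescopes.  For \<open>A = 0\<close> it is the squared norm.
\<close>

definition defect_form :: "nat \<Rightarrow> complex mat \<Rightarrow> (nat \<Rightarrow> complex) \<Rightarrow> real" where
  "defect_form d A x = sqnorm d x - sqnorm d (matvec d A x)"

lemma sqnorm_Parseval:
  "(\<Sum>n<N. sqnorm d (\<lambda>i. \<Sum>j<N. F j i * unity_root N n ^ j)) = real N * (\<Sum>j<N. sqnorm d (F j))"
  "(\<Sum>n<N. sqnorm d (\<lambda>i. \<Sum>j<N. F j i * cnj (unity_root N n) ^ j)) = real N * (\<Sum>j<N. sqnorm d (F j))"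
proof -
  have "(\<Sum>n<N. sqnorm d (\<lambda>i. \<Sum>j<N. F j i * unity_root N n ^ j))
      = (\<Sum>i<d. real N * (\<Sum>j<N. (cmod (F j i))\<^sup>2))"
    unfolding sqnorm_def by (subst sum.swap) (simp only: finite_Parseval)
  then show "(\<Sum>n<N. sqnorm d (\<lambda>i. \<Sum>j<N. F j i * unity_root N n ^ j)) = real N * (\<Sum>j<N. sqnorm d (F j))"
    unfolding sqnorm_def by (subst (2) sum.swap) (simp only: sum_distrib_left)
  have "(\<Sum>n<N. sqnorm d (\<lambda>i. \<Sum>j<N. F j i * cnj (unity_root N n) ^ j))
      = (\<Sum>i<d. real N * (\<Sum>j<N. (cmod (F j i))\<^sup>2))"
    unfolding sqnorm_def by (subst sum.swap) (simp only: finite_Parseval_cnj)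
  then show "(\<Sum>n<N. sqnorm d (\<lambda>i. \<Sum>j<N. F j i * cnj (unity_root N n) ^ j)) = real N * (\<Sum>j<N. sqnorm d (F j))"
    unfolding sqnorm_def by (subst (2) sum.swap) (simp only: sum_distrib_left)
qed

lemma defect_form_Parseval:
  "(\<Sum>n<N. defect_form d A (\<lambda>i. \<Sum>j<N. F j i * unity_root N n ^ j)) = real N * (\<Sum>j<N. defect_form d A (F j))"
  "(\<Sum>n<N. defect_form d A (\<lambda>i. \<Sum>j<N. F j i * cnj (unity_root N n) ^ j)) = real N * (\<Sum>j<N. defect_form d A (F j))"
  unfolding defect_form_def matvec_sum sum_subtractf sqnorm_Parseval by (simp_all add: algebra_simps)

lemma defect_form_scale: "defect_form d A (\<lambda>i. c * x i) = (cmod c)\<^sup>2 * defect_form d A x"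
  by (simp add: defect_form_def matvec_scale sqnorm_scale algebra_simps)

text \<open>
  Let \<open>p\<close> be the polynomial with coefficients \<open>a\<close>.  The sums \<open>\<Sum>m. a\<^sub>m v\<^sub>n\<^sub>+\<^sub>m\<close> are Fourier coefficients
  of the pointwise product of the Fourier transform of \<open>v\<close> with values of \<open>p\<close> on the unit circle.
  The product costs a factor \<open>S\<^sup>2\<close>, and the Parseval identity holds for the defect form because it is a
  difference of squared norms of linear images.
\<close>

lemma Toeplitz_bound:
  fixes v :: "nat \<Rightarrow> nat \<Rightarrow> complex"
  assumes sup: "\<And>\<zeta>. cmod \<zeta> = 1 \<Longrightarrow> cmod (\<Sum>m<L. a m * \<zeta> ^ m) \<le> S"
    and pos: "\<And>x. 0 \<le> defect_form d A x"
  shows "(\<Sum>n<M. defect_form d A (\<lambda>i. \<Sum>m<L. a m * v (n + m) i))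
      \<le> S\<^sup>2 * (\<Sum>n<M + L. defect_form d A (v n))"
proof (cases "M = 0")
  case True
  have "0 \<le> S\<^sup>2 * (\<Sum>n<M + L. defect_form d A (v n))"
    using pos by (intro mult_nonneg_nonneg sum_nonneg) auto
  then show ?thesis using True by simp
next
  case False
  (* with M + L roots of unity the indices n + m do not wrap around *)
  define N where "N = M + L"
  let ?e = "unity_root N" and ?q = "defect_form d A"
  have N: "N > 0" using False by (simp add: N_def)
  define V where "V j = (\<lambda>i. \<Sum>k<N. v k i * ?e j ^ k)" for j
  define P where "P j = (\<Sum>m<L. a m * cnj (?e j) ^ m)" for j
  define F where "F j = (\<lambda>i. P j * V j i)" for j
  have S: "S \<ge> 0" using sup[of 1] norm_ge_zero by (metis norm_one order_trans)
  have coeff: "(\<Sum>j<N. F j i * cnj (?e n) ^ j) = of_nat N * (\<Sum>m<L. a m * v (n + m) i)"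
    if n: "n < M" for n i
  proof -
    have "F j i * cnj (?e n) ^ j
        = (\<Sum>m<L. \<Sum>k<N. a m * v k i * (?e j ^ k * cnj (?e j ^ (n + m))))" for j
    proof -
      have sw: "cnj (?e n) ^ j = cnj (?e j) ^ n"
        using arg_cong[OF unity_root_power_swap[of N n j], of cnj] by simp
      have "F j i = (\<Sum>m<L. \<Sum>k<N. a m * cnj (?e j) ^ m * (v k i * ?e j ^ k))"
        unfolding F_def P_def V_def by (rule sum_product)
      then have "F j i * cnj (?e n) ^ j
          = (\<Sum>m<L. \<Sum>k<N. a m * cnj (?e j) ^ m * (v k i * ?e j ^ k) * cnj (?e j) ^ n)"
        unfolding sw by (simp only: sum_distrib_right)
      then show ?thesis by (simp add: power_add mult_ac)
    qed
    then have "(\<Sum>j<N. F j i * cnj (?e n) ^ j)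
        = (\<Sum>j<N. \<Sum>m<L. \<Sum>k<N. a m * v k i * (?e j ^ k * cnj (?e j ^ (n + m))))"
      by simp
    also have "\<dots> = (\<Sum>m<L. \<Sum>k<N. \<Sum>j<N. a m * v k i * (?e j ^ k * cnj (?e j ^ (n + m))))"
      by (subst sum.swap, rule sum.cong[OF refl], subst sum.swap, rule refl)
    also have "\<dots> = (\<Sum>m<L. \<Sum>k<N. a m * v k i * (if k = n + m then of_nat N else 0))"
      using n by (intro sum.cong refl)
        (simp only: flip: sum_distrib_left, subst unity_root_orthogonal, auto simp: N_def)
    also have "\<dots> = (\<Sum>m<L. a m * v (n + m) i * of_nat N)"
      using n by (intro sum.cong refl) (simp add: if_distrib N_def cong: if_cong)
    finally show ?thesis by (simp add: sum_distrib_left mult_ac)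
  qed
  have "(real N)\<^sup>2 * (\<Sum>n<M. ?q (\<lambda>i. \<Sum>m<L. a m * v (n + m) i))
      = (\<Sum>n<M. ?q (\<lambda>i. \<Sum>j<N. F j i * cnj (?e n) ^ j))"
    unfolding sum_distrib_left
    by (rule sum.cong[OF refl]) (simp only: coeff lessThan_iff defect_form_scale norm_of_nat)
  also have "\<dots> \<le> (\<Sum>n<N. ?q (\<lambda>i. \<Sum>j<N. F j i * cnj (?e n) ^ j))"
    by (rule sum_mono2) (auto simp: N_def pos)
  also have "\<dots> = real N * (\<Sum>j<N. ?q (F j))" by (rule defect_form_Parseval)
  also have "\<dots> \<le> real N * (\<Sum>j<N. S\<^sup>2 * ?q (V j))"
  proof (intro mult_left_mono sum_mono)
    fix j
    have "cmod (P j) \<le> S" unfolding P_def by (rule sup) simp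
    then have "(cmod (P j))\<^sup>2 \<le> S\<^sup>2" by (intro power_mono) auto
    then show "?q (F j) \<le> S\<^sup>2 * ?q (V j)"
      using pos by (simp add: F_def defect_form_scale mult_right_mono)
  qed simp
  also have "\<dots> = real N * S\<^sup>2 * (\<Sum>j<N. ?q (V j))"
    by (simp add: sum_distrib_left mult_ac)
  also have "(\<Sum>j<N. ?q (V j)) = real N * (\<Sum>k<N. ?q (v k))"
    unfolding V_def by (rule defect_form_Parseval)
  finally have "(real N)\<^sup>2 * (\<Sum>n<M. ?q (\<lambda>i. \<Sum>m<L. a m * v (n + m) i))
      \<le> (real N)\<^sup>2 * (S\<^sup>2 * (\<Sum>k<N. ?q (v k)))"
    by (simp add: power2_eq_square mult_ac)
  moreover have "0 < (real N)\<^sup>2" using N by simp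
  ultimately show ?thesis unfolding N_def by (simp only: mult_le_cancel_left_pos)
qed

section \<open>Multipliers and von Neumann's inequality\<close>

lemma taylor_sums:
  assumes "f holomorphic_on \<DD>" "z \<in> \<DD>"
  shows "(\<lambda>n. taylor_coeff f n * z ^ n) sums f z"
  using holomorphic_power_series[OF assms] by (simp add: taylor_coeff_def)

lemma taylor_abs_summable:
  assumes f: "f holomorphic_on \<DD>" and s: "0 \<le> s" "s < 1"
  shows "summable (\<lambda>n. cmod (taylor_coeff f n) * s ^ n)"
proof -
  have "complex_of_real ((s + 1) / 2) \<in> \<DD>" using s by (simp add: norm_divide flip: of_real_add)
  from sums_summable[OF taylor_sums[OF f this]]
  have "summable (\<lambda>n. norm (taylor_coeff f n * complex_of_real s ^ n))"
    by (rule powser_insidea) (use s in \<open>simp add: norm_divide flip: of_real_add\<close>)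
  then show ?thesis using s by (simp add: norm_mult norm_power)
qed

text \<open>
  Partial sums of the Taylor series may exceed the supremum of \<open>f\<close> on the circle.  For the dilated
  function \<open>f(s z)\<close> they converge uniformly there, so in the limit they do not.
\<close>

lemma taylor_partial_sum_bound:
  assumes f: "f holomorphic_on \<DD>" and C: "\<And>z. z \<in> \<DD> \<Longrightarrow> cmod (f z) \<le> C"
    and s: "0 \<le> s" "s < 1" and e: "e > 0"
  obtains L0 where "\<And>L \<zeta>. L \<ge> L0 \<Longrightarrow> cmod \<zeta> = 1
      \<Longrightarrow> cmod (\<Sum>m<L. taylor_coeff f m * of_real s ^ m * \<zeta> ^ m) \<le> C + e"
proof -
  note sm = taylor_abs_summable[OF f s]
  obtain L0 where L0: "\<And>L. L \<ge> L0 \<Longrightarrow> cmod (\<Sum>n. complex_of_real (cmod (taylor_coeff f (n + L)) * s ^ (n + L))) < e"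
  proof -
    have "summable (\<lambda>n. complex_of_real (cmod (taylor_coeff f n) * s ^ n))"
      using summable_of_real[OF sm] by simp
    from suminf_exist_split[OF e this] that show ?thesis by blast
  qed
  have "cmod (\<Sum>m<L. taylor_coeff f m * of_real s ^ m * \<zeta> ^ m) \<le> C + e" if L: "L \<ge> L0" and z: "cmod \<zeta> = 1" for L \<zeta>
  proof -
    let ?t = "\<lambda>m. taylor_coeff f m * (of_real s * \<zeta>) ^ m"
    have D: "of_real s * \<zeta> \<in> \<DD>" using s z by (simp add: norm_mult)
    have sums: "?t sums f (of_real s * \<zeta>)" by (rule taylor_sums[OF f D])
    have ns: "summable (\<lambda>n. norm (?t n))"
      using sm s z by (simp add: norm_mult norm_power)
    have ns': "summable (\<lambda>n. norm (?t (n + L)))"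
      by (rule summable_ignore_initial_segment[OF ns])
    have "f (of_real s * \<zeta>) = (\<Sum>n. ?t (n + L)) + (\<Sum>m<L. ?t m)"
      using suminf_split_initial_segment[OF sums_summable[OF sums], of L] sums_unique[OF sums] by simp
    then have "(\<Sum>m<L. ?t m) = f (of_real s * \<zeta>) - (\<Sum>n. ?t (n + L))" by simp
    also have "cmod \<dots> \<le> C + cmod (\<Sum>n. ?t (n + L))"
      using C[OF D] norm_triangle_ineq4[of "f (of_real s * \<zeta>)" "\<Sum>n. ?t (n + L)"] by linarith
    also have "cmod (\<Sum>n. ?t (n + L)) \<le> (\<Sum>n. norm (?t (n + L)))"
      by (rule summable_norm[OF ns'])
    also have "(\<Sum>n. norm (?t (n + L))) = (\<Sum>n. cmod (taylor_coeff f (n + L)) * s ^ (n + L))"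
      using s z by (simp add: norm_mult norm_power)
    also have "\<dots> \<le> e"
    proof -
      have "summable (\<lambda>n. cmod (taylor_coeff f (n + L)) * s ^ (n + L))"
        by (rule summable_ignore_initial_segment[OF sm])
      then have "(\<Sum>n. complex_of_real (cmod (taylor_coeff f (n + L)) * s ^ (n + L)))
          = of_real (\<Sum>n. cmod (taylor_coeff f (n + L)) * s ^ (n + L))"
        by (simp only: suminf_of_real)
      then show ?thesis using L0[OF L] abs_ge_self by (simp del: of_real_mult of_real_power)
    qed
    finally show ?thesis by (simp add: power_mult_distrib mult.assoc)
  qed
  with that show ?thesis by blast
qed

lemma le_sq_epsilon:
  fixes C X Y :: real
  assumes "\<And>e. e > 0 \<Longrightarrow> Y \<le> (C + e)\<^sup>2 * X"
  shows "Y \<le> C\<^sup>2 * X"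
proof (rule tendsto_lowerbound)
  have "((\<lambda>e. (C + e)\<^sup>2 * X) \<longlongrightarrow> (C + 0)\<^sup>2 * X) (at_right 0)" by (intro tendsto_intros)
  then show "((\<lambda>e. (C + e)\<^sup>2 * X) \<longlongrightarrow> C\<^sup>2 * X) (at_right 0)" by simp
  show "\<forall>\<^sub>F e in at_right 0. Y \<le> (C + e)\<^sup>2 * X"
    using assms by (auto simp: eventually_at_right_less intro: eventually_mono[OF eventually_at_right_less])
qed simp

text \<open>
  The sum over \<open>m\<close> is the \<open>n\<close>-th coefficient of the product of \<open>f\<close> with \<open>\<Sum>n. c\<^sub>n z\<^sup>n\<close>, so bounded functions
  multiply \<open>H\<^sup>2\<close> into itself.  Reversing the order of the coefficients \<open>c\<close> turns the convolution into
  a Toeplitz sum.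
\<close>

lemma multiplier_coeff_bound:
  assumes f: "f holomorphic_on \<DD>" and C: "\<And>z. z \<in> \<DD> \<Longrightarrow> cmod (f z) \<le> C"
  shows "(\<Sum>n<M. (cmod (\<Sum>m\<le>n. taylor_coeff f m * c (n - m)))\<^sup>2) \<le> C\<^sup>2 * (\<Sum>n<M. (cmod (c n))\<^sup>2)"
proof -
  let ?a = "taylor_coeff f"
  have q: "defect_form 1 (0\<^sub>m 1 1) x = (cmod (x 0))\<^sup>2" for x
    by (simp add: defect_form_def sqnorm_def matvec_def)
  have bound: "(\<Sum>n<M. (cmod (\<Sum>m\<le>n. ?a m * of_real s ^ m * c (n - m)))\<^sup>2) \<le> C\<^sup>2 * (\<Sum>n<M. (cmod (c n))\<^sup>2)"
    if s: "0 \<le> s" "s < 1" for s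
  proof (rule le_sq_epsilon)
    fix e :: real assume e: "e > 0"
    obtain L0 where L0: "\<And>L \<zeta>. L \<ge> L0 \<Longrightarrow> cmod \<zeta> = 1
      \<Longrightarrow> cmod (\<Sum>m<L. ?a m * of_real s ^ m * \<zeta> ^ m) \<le> C + e"
      using taylor_partial_sum_bound[OF f C s e] by blast
    define L where "L = max L0 M"
    define v :: "nat \<Rightarrow> nat \<Rightarrow> complex" where "v k i = (if k < M then c (M - 1 - k) else 0)" for k i
    have "(\<Sum>n<M. (cmod (\<Sum>m<L. ?a m * of_real s ^ m * v (n + m) 0))\<^sup>2)
        \<le> (C + e)\<^sup>2 * (\<Sum>n<M + L. (cmod (v n 0))\<^sup>2)"
      using Toeplitz_bound[where L = L and a = "\<lambda>m. ?a m * of_real s ^ m" and S = "C + e"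
          and d = 1 and A = "0\<^sub>m 1 1" and M = M and v = v] L0[of L]
      unfolding q by (simp add: L_def)
    also have "(\<Sum>n<M + L. (cmod (v n 0))\<^sup>2) = (\<Sum>n<M. (cmod (v n 0))\<^sup>2)"
      by (rule sum.mono_neutral_right) (auto simp: v_def)
    also have "\<dots> = (\<Sum>n<M. (cmod (c (M - Suc n)))\<^sup>2)"
      by (simp add: v_def)
    also have "\<dots> = (\<Sum>n<M. (cmod (c n))\<^sup>2)"
      by (rule sum.nat_diff_reindex)
    also have "(\<Sum>n<M. (cmod (\<Sum>m<L. ?a m * of_real s ^ m * v (n + m) 0))\<^sup>2)
        = (\<Sum>n<M. (cmod (\<Sum>m\<le>M - Suc n. ?a m * of_real s ^ m * c (M - Suc n - m)))\<^sup>2)"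
    proof (rule sum.cong[OF refl], rule arg_cong[where f = "\<lambda>x. (cmod x)\<^sup>2"])
      fix n assume n: "n \<in> {..<M}"
      have "(\<Sum>m<L. ?a m * of_real s ^ m * v (n + m) 0) = (\<Sum>m\<le>M - Suc n. ?a m * of_real s ^ m * v (n + m) 0)"
        using n by (intro sum.mono_neutral_right) (auto simp: v_def L_def)
      also have "\<dots> = (\<Sum>m\<le>M - Suc n. ?a m * of_real s ^ m * c (M - Suc n - m))"
        using n by (intro sum.cong refl) (auto simp: v_def)
      finally show "(\<Sum>m<L. ?a m * of_real s ^ m * v (n + m) 0) = \<dots>" .
    qed
    also have "\<dots> = (\<Sum>n<M. (cmod (\<Sum>m\<le>n. ?a m * of_real s ^ m * c (n - m)))\<^sup>2)"
      by (rule sum.nat_diff_reindex[of "\<lambda>n. (cmod (\<Sum>m\<le>n. ?a m * of_real s ^ m * c (n - m)))\<^sup>2" M])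
    finally show "(\<Sum>n<M. (cmod (\<Sum>m\<le>n. ?a m * of_real s ^ m * c (n - m)))\<^sup>2)
        \<le> (C + e)\<^sup>2 * (\<Sum>n<M. (cmod (c n))\<^sup>2)" .
  qed
  show ?thesis
  proof (rule tendsto_upperbound)
    have "((\<lambda>s. \<Sum>n<M. (cmod (\<Sum>m\<le>n. ?a m * of_real s ^ m * c (n - m)))\<^sup>2)
        \<longlongrightarrow> (\<Sum>n<M. (cmod (\<Sum>m\<le>n. ?a m * of_real 1 ^ m * c (n - m)))\<^sup>2)) (at_left 1)"
      by (intro tendsto_intros)
    then show "((\<lambda>s. \<Sum>n<M. (cmod (\<Sum>m\<le>n. ?a m * of_real s ^ m * c (n - m)))\<^sup>2)
        \<longlongrightarrow> (\<Sum>n<M. (cmod (\<Sum>m\<le>n. ?a m * c (n - m)))\<^sup>2)) (at_left 1)" by simp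
    show "\<forall>\<^sub>F s in at_left 1. (\<Sum>n<M. (cmod (\<Sum>m\<le>n. ?a m * of_real s ^ m * c (n - m)))\<^sup>2)
        \<le> C\<^sup>2 * (\<Sum>n<M. (cmod (c n))\<^sup>2)"
      using eventually_at_left_real[of 0 1] by (rule eventually_mono) (use bound in auto)
  qed simp
qed

lemma matvec_mult:
  assumes "A \<in> carrier_mat d d" "B \<in> carrier_mat d d" "i < d"
  shows "matvec d (A * B) x i = matvec d A (matvec d B x) i"
proof -
  have "matvec d (A * B) x i = (\<Sum>j<d. \<Sum>k<d. A $$ (i, k) * B $$ (k, j) * x j)"
    unfolding matvec_def using assms
    by (intro sum.cong refl) (simp add: scalar_prod_def atLeast0LessThan sum_distrib_right)
  also have "\<dots> = (\<Sum>k<d. \<Sum>j<d. A $$ (i, k) * B $$ (k, j) * x j)" by (rule sum.swap)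
  finally show ?thesis by (simp add: matvec_def sum_distrib_left mult.assoc)
qed

lemma pow_mat_Suc_left:
  "A \<in> carrier_mat d d \<Longrightarrow> A ^\<^sub>m Suc n = A * A ^\<^sub>m n"
proof (induction n)
  case (Suc n)
  then have "A ^\<^sub>m Suc (Suc n) = A * A ^\<^sub>m n * A" by simp
  also have "\<dots> = A * (A ^\<^sub>m n * A)" using Suc.prems by (intro assoc_mult_mat) (auto intro: pow_carrier_mat)
  finally show ?case by simp
qed simp

lemma contraction_power:
  assumes A: "A \<in> carrier_mat d d" and contr: "\<And>x. sqnorm d (matvec d A x) \<le> sqnorm d x"
  shows "sqnorm d (matvec d (A ^\<^sub>m n) x) \<le> sqnorm d x"
proof (induction n)
  case 0
  have "sqnorm d (matvec d (A ^\<^sub>m 0) x) = sqnorm d x"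
  proof (rule sqnorm_cong)
    fix i assume i: "i < d"
    have "matvec d (A ^\<^sub>m 0) x i = (\<Sum>j<d. if j = i then x j else 0)"
      unfolding matvec_def using A i by (intro sum.cong refl) simp
    then show "matvec d (A ^\<^sub>m 0) x i = x i" using i by simp
  qed
  then show ?case by simp
next
  case (Suc n)
  have "sqnorm d (matvec d (A ^\<^sub>m Suc n) x) = sqnorm d (matvec d A (matvec d (A ^\<^sub>m n) x))"
    unfolding pow_mat_Suc_left[OF A] by (intro sqnorm_cong matvec_mult A pow_carrier_mat)
  then show ?case using contr[of "matvec d (A ^\<^sub>m n) x"] Suc by linarith
qed

text \<open>
  For the orbit \<open>v\<^sub>n = B\<^sup>n x\<close> of a strict contraction, both sides of the Toeplitz estimate telescope and
  leave \<open>\<parallel>p(B) x\<parallel> \<le> S \<parallel>x\<parallel>\<close>.  The factor \<open>r = s s\<close> is split evenly: one \<open>s\<close> makes \<open>B = s A\<close> a strict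
  contraction, the other dilates \<open>f\<close> so that its partial sums are controlled.
\<close>

lemma von_Neumann:
  assumes A: "A \<in> carrier_mat d d" and contr: "\<And>x. sqnorm d (matvec d A x) \<le> sqnorm d x"
    and f: "f holomorphic_on \<DD>" and C: "\<And>z. z \<in> \<DD> \<Longrightarrow> cmod (f z) \<le> C"
    and r: "0 \<le> r" "r < 1"
  shows "sqnorm d (\<lambda>i. \<Sum>n. taylor_coeff f n * of_real r ^ n * matvec d (A ^\<^sub>m n) x i) \<le> C\<^sup>2 * sqnorm d x"
proof -
  let ?a = "taylor_coeff f"
  define s where "s = sqrt r"
  have s: "0 \<le> s" "s < 1" "s * s = r" using r by (auto simp: s_def)
  define B where "B = of_real s \<cdot>\<^sub>m A"
  have mvB: "matvec d B y i = of_real s * matvec d A y i" if "i < d" for y i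
    using A that by (simp add: B_def matvec_def sum_distrib_left mult_ac)
  have B_contr: "sqnorm d (matvec d B y) \<le> r * sqnorm d y" for y
  proof -
    have "sqnorm d (matvec d B y) = (cmod (of_real s))\<^sup>2 * sqnorm d (matvec d A y)"
      unfolding sqnorm_scale[symmetric] by (intro sqnorm_cong mvB)
    also have "\<dots> = r * sqnorm d (matvec d A y)" using s by (simp add: power2_eq_square)
    finally show ?thesis using contr[of y] r by (simp add: mult_left_mono)
  qed
  have pos: "0 \<le> defect_form d B y" for y
    using B_contr[of y] mult_right_mono[of r 1 "sqnorm d y"] r by (simp add: defect_form_def)
  define v where "v n = (\<lambda>i. of_real s ^ n * matvec d (A ^\<^sub>m n) x i)" for n
  have v_Suc: "matvec d B (v n) i = v (Suc n) i" if "i < d" for n i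
    unfolding mvB[OF that] v_def pow_mat_Suc_left[OF A]
    using matvec_mult[OF A pow_carrier_mat[OF A] that] by (simp add: matvec_scale)
  have v0: "sqnorm d (v 0) \<le> sqnorm d x"
    unfolding v_def using contraction_power[OF A contr, of 0 x] by simp
  have partial: "sqnorm d (\<lambda>i. \<Sum>m<L. ?a m * of_real r ^ m * matvec d (A ^\<^sub>m m) x i) \<le> S\<^sup>2 * sqnorm d x"
    if S: "\<And>\<zeta>. cmod \<zeta> = 1 \<Longrightarrow> cmod (\<Sum>m<L. ?a m * of_real s ^ m * \<zeta> ^ m) \<le> S" for L S
  proof -
    define u where "u n = (\<lambda>i. \<Sum>m<L. (?a m * of_real s ^ m) * v (n + m) i)" for n
    have u_Suc: "matvec d B (u n) i = u (Suc n) i" if "i < d" for n i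
    proof -
      have "u n = (\<lambda>i. \<Sum>m<L. v (n + m) i * (?a m * of_real s ^ m))"
        by (rule ext) (simp add: u_def mult_ac)
      then have "matvec d B (u n) i = (\<Sum>m<L. matvec d B (v (n + m)) i * (?a m * of_real s ^ m))"
        by (simp only: matvec_sum)
      also have "\<dots> = u (Suc n) i"
        unfolding u_def by (intro sum.cong refl) (simp add: v_Suc[OF that])
      finally show ?thesis .
    qed
    have tel: "(\<Sum>n<M. defect_form d B (w n)) = sqnorm d (w 0) - sqnorm d (w M)"
      if "\<And>n i. i < d \<Longrightarrow> matvec d B (w n) i = w (Suc n) i" for w M
    proof -
      have "defect_form d B (w n) = sqnorm d (w n) - sqnorm d (w (Suc n))" for n
        unfolding defect_form_def using sqnorm_cong[of d "matvec d B (w n)" "w (Suc n)"] that by simp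
      then show ?thesis by (simp add: sum_lessThan_telescope'[of "\<lambda>n. sqnorm d (w n)"])
    qed
    have uM: "sqnorm d (u M) \<le> r ^ M * sqnorm d (u 0)" for M
    proof (induction M)
      case (Suc M)
      have "sqnorm d (u (Suc M)) = sqnorm d (matvec d B (u M))"
        by (intro sqnorm_cong) (simp add: u_Suc)
      also have "\<dots> \<le> r * sqnorm d (u M)" by (rule B_contr)
      also have "\<dots> \<le> r * (r ^ M * sqnorm d (u 0))" using Suc r by (intro mult_left_mono)
      finally show ?case by (simp add: mult_ac)
    qed simp
    have telv: "(\<Sum>n<M. defect_form d B (v n)) = sqnorm d (v 0) - sqnorm d (v M)" for M
      by (rule tel) (rule v_Suc)
    have telu: "(\<Sum>n<M. defect_form d B (u n)) = sqnorm d (u 0) - sqnorm d (u M)" for M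
      by (rule tel) (rule u_Suc)
    have "sqnorm d (u 0) \<le> S\<^sup>2 * sqnorm d x + r ^ M * sqnorm d (u 0)" for M
    proof -
      have "(\<Sum>n<M. defect_form d B (u n)) \<le> S\<^sup>2 * (\<Sum>n<M + L. defect_form d B (v n))"
        unfolding u_def by (rule Toeplitz_bound[OF S pos])
      also have "(\<Sum>n<M + L. defect_form d B (v n)) \<le> sqnorm d x"
        unfolding telv using v0 sqnorm_nonneg[of d "v (M + L)"] by linarith
      finally show ?thesis
        unfolding telu using uM[of M] by (simp add: mult_left_mono)
    qed
    moreover have "(\<lambda>M. S\<^sup>2 * sqnorm d x + r ^ M * sqnorm d (u 0)) \<longlonglongrightarrow> S\<^sup>2 * sqnorm d x + 0 * sqnorm d (u 0)"
      using r by (intro tendsto_intros LIMSEQ_realpow_zero)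
    ultimately have "sqnorm d (u 0) \<le> S\<^sup>2 * sqnorm d x + 0 * sqnorm d (u 0)"
      by (intro LIMSEQ_le_const) auto
    moreover have "u 0 = (\<lambda>i. \<Sum>m<L. ?a m * of_real r ^ m * matvec d (A ^\<^sub>m m) x i)"
      unfolding u_def v_def by (rule ext, rule sum.cong) (simp_all add: power_mult_distrib flip: s(3))
    ultimately show ?thesis by simp
  qed
  have lim: "(\<lambda>L. sqnorm d (\<lambda>i. \<Sum>m<L. ?a m * of_real r ^ m * matvec d (A ^\<^sub>m m) x i))
      \<longlonglongrightarrow> sqnorm d (\<lambda>i. \<Sum>n. ?a n * of_real r ^ n * matvec d (A ^\<^sub>m n) x i)"
    unfolding sqnorm_def
  proof (intro tendsto_intros)
    fix i assume i: "i \<in> {..<d}"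
    have "cmod (matvec d (A ^\<^sub>m n) x i) \<le> sqrt (sqnorm d x)" for n
    proof -
      have "(cmod (matvec d (A ^\<^sub>m n) x i))\<^sup>2 \<le> sqnorm d (matvec d (A ^\<^sub>m n) x)"
        unfolding sqnorm_def using i by (intro member_le_sum) auto
      also have "\<dots> \<le> sqnorm d x" by (rule contraction_power[OF A contr])
      finally show ?thesis by (rule real_le_rsqrt)
    qed
    then have "norm (?a n * of_real r ^ n * matvec d (A ^\<^sub>m n) x i) \<le> (cmod (?a n) * r ^ n) * sqrt (sqnorm d x)" for n
      unfolding norm_mult norm_power using r by (intro mult_mono) auto
    then have "summable (\<lambda>n. ?a n * of_real r ^ n * matvec d (A ^\<^sub>m n) x i)"
      by (rule summable_comparison_test'[OF summable_mult2[OF taylor_abs_summable[OF f r]]])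
    then show "(\<lambda>L. \<Sum>m<L. ?a m * of_real r ^ m * matvec d (A ^\<^sub>m m) x i)
        \<longlonglongrightarrow> (\<Sum>n. ?a n * of_real r ^ n * matvec d (A ^\<^sub>m n) x i)"
      by (rule summable_LIMSEQ)
  qed
  show ?thesis
  proof (rule le_sq_epsilon)
    fix e :: real assume e: "e > 0"
    obtain L0 where L0: "\<And>L \<zeta>. L \<ge> L0 \<Longrightarrow> cmod \<zeta> = 1
      \<Longrightarrow> cmod (\<Sum>m<L. ?a m * of_real s ^ m * \<zeta> ^ m) \<le> C + e"
      using taylor_partial_sum_bound[OF f C s(1,2) e] by blast
    show "sqnorm d (\<lambda>i. \<Sum>n. ?a n * of_real r ^ n * matvec d (A ^\<^sub>m n) x i) \<le> (C + e)\<^sup>2 * sqnorm d x"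
      by (rule LIMSEQ_le_const2[OF lim]) (use partial L0 in blast)
  qed
qed

section \<open>Taylor coefficients\<close>

lemma taylor_coeff_unique:
  assumes "\<And>z. z \<in> \<DD> \<Longrightarrow> (\<lambda>n. c n * z ^ n) sums f z"
  shows "taylor_coeff f n = c n"
proof -
  have "f has_fps_expansion Abs_fps c"
  proof (rule has_fps_expansionI)
    have "\<forall>\<^sub>F z in nhds 0. z \<in> \<DD>" by (rule eventually_nhds_in_open) auto
    then show "\<forall>\<^sub>F z in nhds 0. (\<lambda>n. fps_nth (Abs_fps c) n * z ^ n) sums f z"
      by (rule eventually_mono) (use assms in simp)
  qed
  from fps_nth_fps_expansion[OF this, of n] show ?thesis by (simp add: taylor_coeff_def)
qed

lemma taylor_coeff_cong:
  assumes "f holomorphic_on \<DD>" "\<And>z. z \<in> \<DD> \<Longrightarrow> f z = g z"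
  shows "taylor_coeff g n = taylor_coeff f n"
  using taylor_sums[OF assms(1)] assms(2) by (intro taylor_coeff_unique) simp

lemma taylor_coeff_add:
  assumes "f holomorphic_on \<DD>" "g holomorphic_on \<DD>"
  shows "taylor_coeff (\<lambda>z. f z + g z) n = taylor_coeff f n + taylor_coeff g n"
  by (rule taylor_coeff_unique) (simp add: distrib_right sums_add taylor_sums assms)

lemma taylor_coeff_cmult:
  assumes "f holomorphic_on \<DD>"
  shows "taylor_coeff (\<lambda>z. c * f z) n = c * taylor_coeff f n"
  by (rule taylor_coeff_unique) (simp add: mult.assoc sums_mult taylor_sums assms)

lemma taylor_coeff_0: "taylor_coeff (\<lambda>z. 0) n = 0"
  by (rule taylor_coeff_unique) simp

lemma taylor_coeff_mult:
  assumes f: "f holomorphic_on \<DD>" and g: "g holomorphic_on \<DD>"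
  shows "taylor_coeff (\<lambda>z. f z * g z) n = (\<Sum>i\<le>n. taylor_coeff f i * taylor_coeff g (n - i))"
proof (rule taylor_coeff_unique)
  fix z :: complex assume z: "z \<in> \<DD>"
  have abs: "summable (\<lambda>n. norm (taylor_coeff h n * z ^ n))" if "h holomorphic_on \<DD>" for h
    using taylor_abs_summable[OF that, of "cmod z"] z by (simp add: norm_mult norm_power)
  have "(\<lambda>k. \<Sum>i\<le>k. (taylor_coeff f i * z ^ i) * (taylor_coeff g (k - i) * z ^ (k - i))) sums (f z * g z)"
    using Cauchy_product_sums[OF abs[OF f] abs[OF g]] taylor_sums[OF f z] taylor_sums[OF g z]
    by (simp add: sums_iff)
  moreover have "(\<Sum>i\<le>k. (taylor_coeff f i * z ^ i) * (taylor_coeff g (k - i) * z ^ (k - i)))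
      = (\<Sum>i\<le>k. taylor_coeff f i * taylor_coeff g (k - i)) * z ^ k" for k
    unfolding sum_distrib_right
    by (intro sum.cong refl) (simp add: mult_ac flip: power_add)
  ultimately show "(\<lambda>n. (\<Sum>i\<le>n. taylor_coeff f i * taylor_coeff g (n - i)) * z ^ n) sums (f z * g z)"
    by simp
qed

section \<open>The Hardy space\<close>

abbreviation hcoeff :: "(complex \<Rightarrow> nat \<Rightarrow> complex) \<Rightarrow> nat \<Rightarrow> nat \<Rightarrow> complex" where
  "hcoeff h n i \<equiv> taylor_coeff (\<lambda>z. h z i) n"

lemma hardy_simps:
  "cscale (hardy d) = (\<lambda>c h z i. c * h z i)"
  "cinner (hardy d) h g = (\<Sum>n. \<Sum>i<d. hcoeff h n i * cnj (hcoeff g n i))"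
  by (simp_all add: hardy_def)

lemma hardy_outside: "h \<in> carrier (hardy d) \<Longrightarrow> z \<notin> \<DD> \<or> i \<ge> d \<Longrightarrow> h z i = 0"
  by (auto simp: hardy_def)

lemma hardy_holomorphic: "h \<in> carrier (hardy d) \<Longrightarrow> (\<lambda>z. h z i) holomorphic_on \<DD>"
proof (cases "i < d")
  case False
  assume "h \<in> carrier (hardy d)"
  then have "(\<lambda>z. h z i) = (\<lambda>z. 0)" using False hardy_outside by (intro ext) simp
  then show ?thesis by simp
qed (auto simp: hardy_def)

lemma hcoeff_outside: "h \<in> carrier (hardy d) \<Longrightarrow> i \<ge> d \<Longrightarrow> hcoeff h n i = 0"
  using hardy_outside[of h d _ i] by (simp add: taylor_coeff_0)

lemma hardy_sums: "h \<in> carrier (hardy d) \<Longrightarrow> z \<in> \<DD> \<Longrightarrow> (\<lambda>n. hcoeff h n i * z ^ n) sums h z i"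
  using taylor_sums[OF hardy_holomorphic] .

lemma hardy_summable: "h \<in> carrier (hardy d) \<Longrightarrow> summable (\<lambda>n. (cmod (hcoeff h n i))\<^sup>2)"
  by (cases "i < d") (auto simp: hcoeff_outside, auto simp: hardy_def)

lemma hardy_eqI:
  assumes "h \<in> carrier (hardy d)" "g \<in> carrier (hardy d)"
    and "\<And>z i. z \<in> \<DD> \<Longrightarrow> i < d \<Longrightarrow> h z i = g z i"
  shows "h = g"
proof (intro ext)
  fix z i
  show "h z i = g z i"
    using assms hardy_outside[of h d z i] hardy_outside[of g d z i] by (cases "z \<in> \<DD> \<and> i < d") auto
qed

lemma hardyI:
  assumes "\<And>z i. z \<notin> \<DD> \<or> i \<ge> d \<Longrightarrow> h z i = 0"
    and "\<And>z i. z \<in> \<DD> \<Longrightarrow> i < d \<Longrightarrow> (\<lambda>n. c n i * z ^ n) sums h z i"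
    and "\<And>i. i < d \<Longrightarrow> summable (\<lambda>n. (cmod (c n i))\<^sup>2)"
  shows "h \<in> carrier (hardy d)" and "\<And>n i. i < d \<Longrightarrow> hcoeff h n i = c n i"
proof -
  show *: "hcoeff h n i = c n i" if "i < d" for n i
    by (rule taylor_coeff_unique) (use assms(2) that in simp)
  have "(\<lambda>z. h z i) holomorphic_on \<DD>" if "i < d" for i
    by (rule power_series_holomorphic[where a = "\<lambda>n. c n i"]) (use assms(2) that in simp)
  then show "h \<in> carrier (hardy d)"
    using assms(1,3) by (auto simp: hardy_def *)
qed

lemma square_summable_power_series:
  fixes c :: "nat \<Rightarrow> complex"
  assumes "summable (\<lambda>n. (cmod (c n))\<^sup>2)" and z: "z \<in> \<DD>"
  shows "summable (\<lambda>n. c n * z ^ n)"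
proof -
  have "(\<lambda>n. (cmod (c n))\<^sup>2) \<longlonglongrightarrow> 0" by (rule summable_LIMSEQ_zero[OF assms(1)])
  then have "\<forall>\<^sub>F n in sequentially. (cmod (c n))\<^sup>2 < 1" by (rule order_tendstoD) simp
  then obtain N where N: "\<And>n. n \<ge> N \<Longrightarrow> (cmod (c n))\<^sup>2 < 1" by (auto simp: eventually_sequentially)
  show ?thesis
  proof (rule summable_comparison_test'[where N = N])
    show "summable (\<lambda>n. cmod z ^ n)" using z by (simp add: summable_geometric)
    fix n assume "n \<ge> N"
    then have "cmod (c n) \<le> 1" using N[of n] by (simp add: abs_square_less_1 less_imp_le)
    then show "norm (c n * z ^ n) \<le> cmod z ^ n"
      by (simp add: norm_mult norm_power mult_left_le_one_le)
  qed
qed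

lemma hardy_of_coeffs:
  assumes "\<And>i. i < d \<Longrightarrow> summable (\<lambda>n. (cmod (c n i))\<^sup>2)"
  obtains h where "h \<in> carrier (hardy d)" "\<And>n i. i < d \<Longrightarrow> hcoeff h n i = c n i"
proof -
  define h where "h z i = (if z \<in> \<DD> \<and> i < d then \<Sum>n. c n i * z ^ n else 0)" for z i
  have "(\<lambda>n. c n i * z ^ n) sums h z i" if "z \<in> \<DD>" "i < d" for z i
    using summable_sums[OF square_summable_power_series[OF assms[OF that(2)] that(1)]] that
    by (simp add: h_def)
  moreover have "h z i = 0" if "z \<notin> \<DD> \<or> i \<ge> d" for z i using that by (auto simp: h_def)
  ultimately show ?thesis using that[of h] hardyI[of d h c] assms by blast
qed

lemma hardy_add:
  assumes "h \<in> carrier (hardy d)" "g \<in> carrier (hardy d)"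
  shows "h + g \<in> carrier (hardy d)" "hcoeff (h + g) n i = hcoeff h n i + hcoeff g n i"
proof -
  show *: "hcoeff (h + g) n i = hcoeff h n i + hcoeff g n i" for n i
    using taylor_coeff_add[OF hardy_holomorphic[OF assms(1)] hardy_holomorphic[OF assms(2)]] by simp
  show "h + g \<in> carrier (hardy d)"
  proof (rule hardyI(1)[where c = "\<lambda>n i. hcoeff h n i + hcoeff g n i"])
    fix i
    have "(cmod (hcoeff h n i + hcoeff g n i))\<^sup>2 \<le> 2 * (cmod (hcoeff h n i))\<^sup>2 + 2 * (cmod (hcoeff g n i))\<^sup>2" for n
    proof -
      have "(cmod (hcoeff h n i + hcoeff g n i))\<^sup>2 \<le> (cmod (hcoeff h n i) + cmod (hcoeff g n i))\<^sup>2"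
        by (intro power_mono norm_triangle_ineq) auto
      also have "\<dots> \<le> 2 * (cmod (hcoeff h n i))\<^sup>2 + 2 * (cmod (hcoeff g n i))\<^sup>2"
        using sum_squares_bound[of "cmod (hcoeff h n i)" "cmod (hcoeff g n i)"]
        unfolding power2_sum by linarith
      finally show ?thesis .
    qed
    then show "summable (\<lambda>n. (cmod (hcoeff h n i + hcoeff g n i))\<^sup>2)"
      by (intro summable_comparison_test'[OF summable_add[OF summable_mult[OF hardy_summable[OF assms(1)]]
              summable_mult[OF hardy_summable[OF assms(2)]]]]) auto
    show "(h + g) z i = 0" if "z \<notin> \<DD> \<or> i \<ge> d" for z i
      using hardy_outside[OF assms(1) that] hardy_outside[OF assms(2) that] by simp
    show "(\<lambda>n. (hcoeff h n i + hcoeff g n i) * z ^ n) sums (h + g) z i" if "z \<in> \<DD>" for z i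
      using sums_add[OF hardy_sums[OF assms(1) that, of i] hardy_sums[OF assms(2) that, of i]]
      by (simp add: distrib_right)
  qed
qed

lemma hardy_scale:
  assumes "h \<in> carrier (hardy d)"
  shows "(\<lambda>z i. c * h z i) \<in> carrier (hardy d)" "hcoeff (\<lambda>z i. c * h z i) n i = c * hcoeff h n i"
proof -
  show *: "hcoeff (\<lambda>z i. c * h z i) n i = c * hcoeff h n i" for n i
    using taylor_coeff_cmult[OF hardy_holomorphic[OF assms]] by simp
  show "(\<lambda>z i. c * h z i) \<in> carrier (hardy d)"
    by (rule hardyI(1)[where c = "\<lambda>n i. c * hcoeff h n i"])
      (use assms hardy_outside[OF assms] in \<open>auto simp: mult.assoc norm_mult power_mult_distrib
        intro!: sums_mult hardy_sums summable_mult hardy_summable\<close>)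
qed

lemma hardy_zero: "0 \<in> carrier (hardy d)"
  by (simp add: hardy_def taylor_coeff_0)

lemma hardy_cinner_summable:
  assumes "h \<in> carrier (hardy d)" "g \<in> carrier (hardy d)"
  shows "summable (\<lambda>n. \<Sum>i<d. hcoeff h n i * cnj (hcoeff g n i))"
proof (intro summable_sum)
  fix i
  show "summable (\<lambda>n. hcoeff h n i * cnj (hcoeff g n i))"
  proof (rule summable_comparison_test')
    show "summable (\<lambda>n. (cmod (hcoeff h n i))\<^sup>2 + (cmod (hcoeff g n i))\<^sup>2)"
      by (rule summable_add[OF hardy_summable[OF assms(1)] hardy_summable[OF assms(2)]])
    show "norm (hcoeff h n i * cnj (hcoeff g n i)) \<le> (cmod (hcoeff h n i))\<^sup>2 + (cmod (hcoeff g n i))\<^sup>2" for n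
      using sum_squares_bound[of "cmod (hcoeff h n i)" "cmod (hcoeff g n i)"]
        mult_nonneg_nonneg[OF norm_ge_zero norm_ge_zero, of "hcoeff h n i" "hcoeff g n i"]
      unfolding norm_mult complex_mod_cnj by linarith
  qed
qed

lemma hardy_sqnorm_summable:
  "h \<in> carrier (hardy d) \<Longrightarrow> summable (\<lambda>n. sqnorm d (hcoeff h n))"
  unfolding sqnorm_def by (intro summable_sum hardy_summable)

lemma hardy_cinner_self:
  assumes "h \<in> carrier (hardy d)"
  shows "cinner (hardy d) h h = of_real (\<Sum>n. sqnorm d (hcoeff h n))"
proof -
  have "(\<Sum>i<d. hcoeff h n i * cnj (hcoeff h n i)) = complex_of_real (sqnorm d (hcoeff h n))" for n
    by (simp only: sqnorm_def of_real_sum complex_norm_square)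
  then show ?thesis
    unfolding hardy_simps by (simp add: suminf_of_real[OF hardy_sqnorm_summable[OF assms]])
qed

lemma hardy_hnorm_sq:
  assumes "h \<in> carrier (hardy d)"
  shows "(hnorm (hardy d) h)\<^sup>2 = (\<Sum>n. sqnorm d (hcoeff h n))"
  using suminf_nonneg[OF hardy_sqnorm_summable[OF assms]]
  by (simp add: hnorm_def hardy_cinner_self[OF assms])

lemma hardy_hnorm_nonneg: "h \<in> carrier (hardy d) \<Longrightarrow> 0 \<le> hnorm (hardy d) h"
  using suminf_nonneg[OF hardy_sqnorm_summable[of h d]]
  by (simp add: hnorm_def hardy_cinner_self)

lemma hardy_partial_le:
  assumes "h \<in> carrier (hardy d)"
  shows "(\<Sum>n<M. sqnorm d (hcoeff h n)) \<le> (hnorm (hardy d) h)\<^sup>2"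
  unfolding hardy_hnorm_sq[OF assms] by (rule sum_le_suminf[OF hardy_sqnorm_summable[OF assms]]) auto

lemma hardy_hnorm_leI:
  assumes "h \<in> carrier (hardy d)" "\<And>M. (\<Sum>n<M. sqnorm d (hcoeff h n)) \<le> B"
  shows "(hnorm (hardy d) h)\<^sup>2 \<le> B"
  unfolding hardy_hnorm_sq[OF assms(1)] by (rule suminf_le_const[OF hardy_sqnorm_summable[OF assms(1)] assms(2)])

lemma hardy_coeff_le:
  assumes h: "h \<in> carrier (hardy d)" and i: "i < d"
  shows "cmod (hcoeff h n i) \<le> hnorm (hardy d) h"
proof (rule power2_le_imp_le)
  have "(cmod (hcoeff h n i))\<^sup>2 \<le> sqnorm d (hcoeff h n)"
    unfolding sqnorm_def using i by (intro member_le_sum) auto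
  also have "\<dots> \<le> (\<Sum>n<Suc n. sqnorm d (hcoeff h n))" by (rule member_le_sum) auto
  also have "\<dots> \<le> (hnorm (hardy d) h)\<^sup>2" by (rule hardy_partial_le[OF h])
  finally show "(cmod (hcoeff h n i))\<^sup>2 \<le> (hnorm (hardy d) h)\<^sup>2" .
qed (rule hardy_hnorm_nonneg[OF h])

lemma hardy_diff:
  assumes "h \<in> carrier (hardy d)" "g \<in> carrier (hardy d)"
  shows "h - g \<in> carrier (hardy d)" "hcoeff (h - g) n i = hcoeff h n i - hcoeff g n i"
proof -
  have eq: "h - g = h + (\<lambda>z i. (-1) * g z i)" by (intro ext) simp
  show "h - g \<in> carrier (hardy d)"
    unfolding eq by (rule hardy_add(1)[OF assms(1) hardy_scale(1)[OF assms(2)]])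
  show "hcoeff (h - g) n i = hcoeff h n i - hcoeff g n i"
    unfolding eq hardy_add(2)[OF assms(1) hardy_scale(1)[OF assms(2)]] hardy_scale(2)[OF assms(2)] by simp
qed

lemma vector_space_hardy: "vector_space (cscale (hardy d))"
  by unfold_locales (simp_all add: hardy_simps fun_eq_iff algebra_simps)

text \<open>
  Completeness of \<open>\<ell>\<^sup>2\<close>: take limits of the coefficients and bound finite partial sums of the squared
  distance, uniformly in their length.
\<close>

lemma complete_hardy:
  assumes X: "\<And>n. X n \<in> carrier (hardy d)"
    and Cauchy: "\<And>e. e > 0 \<Longrightarrow> \<exists>N. \<forall>m\<ge>N. \<forall>n\<ge>N. hnorm (hardy d) (X m - X n) < e"
  shows "\<exists>x\<in>carrier (hardy d). (\<lambda>n. hnorm (hardy d) (X n - x)) \<longlonglongrightarrow> 0"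
proof -
  define c where "c n i = lim (\<lambda>m. hcoeff (X m) n i)" for n i
  have lim: "(\<lambda>m. hcoeff (X m) n i) \<longlonglongrightarrow> c n i" if i: "i < d" for n i
  proof -
    have "Cauchy (\<lambda>m. hcoeff (X m) n i)"
    proof (rule metric_CauchyI)
      fix e :: real assume "e > 0"
      then obtain N where N: "\<forall>m\<ge>N. \<forall>n\<ge>N. hnorm (hardy d) (X m - X n) < e" using Cauchy by blast
      have "dist (hcoeff (X m) n i) (hcoeff (X k) n i) < e" if "m \<ge> N" "k \<ge> N" for m k
      proof -
        have "cmod (hcoeff (X m - X k) n i) \<le> hnorm (hardy d) (X m - X k)"
          by (rule hardy_coeff_le[OF hardy_diff(1)[OF X X] i])
        also have "\<dots> < e" using N that by blast
        finally show ?thesis unfolding hardy_diff(2)[OF X X] dist_norm .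
      qed
      then show "\<exists>M. \<forall>m\<ge>M. \<forall>k\<ge>M. dist (hcoeff (X m) n i) (hcoeff (X k) n i) < e" by blast
    qed
    then show ?thesis
      unfolding c_def using Cauchy_convergent_iff convergent_LIMSEQ_iff by blast
  qed
  have tail: "\<exists>N. \<forall>m\<ge>N. \<forall>M. (\<Sum>n<M. sqnorm d (\<lambda>i. hcoeff (X m) n i - c n i)) \<le> e\<^sup>2" if e: "e > 0" for e
  proof -
    obtain N where N: "\<forall>m\<ge>N. \<forall>n\<ge>N. hnorm (hardy d) (X m - X n) < e" using Cauchy[OF e] by blast
    have "(\<Sum>n<M. sqnorm d (\<lambda>i. hcoeff (X m) n i - c n i)) \<le> e\<^sup>2" if m: "m \<ge> N" for m M
    proof (rule LIMSEQ_le_const2)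
      show "(\<lambda>k. \<Sum>n<M. sqnorm d (\<lambda>i. hcoeff (X m) n i - hcoeff (X k) n i))
          \<longlonglongrightarrow> (\<Sum>n<M. sqnorm d (\<lambda>i. hcoeff (X m) n i - c n i))"
        unfolding sqnorm_def by (intro tendsto_intros lim) simp
      have "(\<Sum>n<M. sqnorm d (\<lambda>i. hcoeff (X m) n i - hcoeff (X k) n i)) \<le> e\<^sup>2" if k: "k \<ge> N" for k
      proof -
        have D: "X m - X k \<in> carrier (hardy d)" by (rule hardy_diff(1)[OF X X])
        have "(\<Sum>n<M. sqnorm d (\<lambda>i. hcoeff (X m) n i - hcoeff (X k) n i)) \<le> (hnorm (hardy d) (X m - X k))\<^sup>2"
          using hardy_partial_le[OF D, of M] unfolding hardy_diff(2)[OF X X] .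
        also have "\<dots> \<le> e\<^sup>2"
        proof (rule power_mono[OF _ hardy_hnorm_nonneg[OF D]])
          show "hnorm (hardy d) (X m - X k) \<le> e" using N m k by (blast intro: less_imp_le)
        qed
        finally show ?thesis .
      qed
      then show "\<exists>N. \<forall>k\<ge>N. (\<Sum>n<M. sqnorm d (\<lambda>i. hcoeff (X m) n i - hcoeff (X k) n i)) \<le> e\<^sup>2" by blast
    qed
    then show ?thesis by blast
  qed
  have coord: "(\<Sum>n<M. (cmod (b n i))\<^sup>2) \<le> (\<Sum>n<M. sqnorm d (b n))" if "i < d" for b :: "nat \<Rightarrow> nat \<Rightarrow> complex" and i M
    unfolding sqnorm_def using that by (intro sum_mono member_le_sum) auto
  obtain N0 where N0: "\<And>M. (\<Sum>n<M. sqnorm d (\<lambda>i. hcoeff (X N0) n i - c n i)) \<le> 1\<^sup>2"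
    using tail[of 1] by auto
  have "summable (\<lambda>n. (cmod (hcoeff (X N0) n i - c n i))\<^sup>2)" if "i < d" for i
  proof (rule bounded_imp_summable[where B = "1\<^sup>2"])
    fix n
    show "(\<Sum>k\<le>n. (cmod (hcoeff (X N0) k i - c k i))\<^sup>2) \<le> 1\<^sup>2"
      unfolding lessThan_Suc_atMost[symmetric] by (rule order_trans[OF coord[OF that] N0])
  qed simp
  then obtain D where D: "D \<in> carrier (hardy d)" "\<And>n i. i < d \<Longrightarrow> hcoeff D n i = hcoeff (X N0) n i - c n i"
    using hardy_of_coeffs[of d "\<lambda>n i. hcoeff (X N0) n i - c n i"] by blast
  define x where "x = X N0 - D"
  have x: "x \<in> carrier (hardy d)" unfolding x_def by (rule hardy_diff(1)[OF X D(1)])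
  have xc: "hcoeff x n i = c n i" if "i < d" for n i
    unfolding x_def hardy_diff(2)[OF X D(1)] D(2)[OF that] by simp
  have "(\<lambda>n. hnorm (hardy d) (X n - x)) \<longlonglongrightarrow> 0"
  proof (rule LIMSEQ_I)
    fix r :: real assume r: "r > 0"
    then obtain N where N: "\<forall>m\<ge>N. \<forall>M. (\<Sum>n<M. sqnorm d (\<lambda>i. hcoeff (X m) n i - c n i)) \<le> (r/2)\<^sup>2"
      using tail[of "r/2"] by auto
    have "norm (hnorm (hardy d) (X m - x) - 0) < r" if m: "m \<ge> N" for m
    proof -
      have Dm: "X m - x \<in> carrier (hardy d)" by (rule hardy_diff(1)[OF X x])
      have "sqnorm d (hcoeff (X m - x) n) = sqnorm d (\<lambda>i. hcoeff (X m) n i - c n i)" for n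
        unfolding hardy_diff(2)[OF X x] by (intro sqnorm_cong) (simp add: xc)
      then have "(hnorm (hardy d) (X m - x))\<^sup>2 \<le> (r/2)\<^sup>2"
        using N m by (intro hardy_hnorm_leI[OF Dm]) simp
      then have "hnorm (hardy d) (X m - x) \<le> r / 2"
        by (rule power2_le_imp_le) (use r in simp)
      then show ?thesis using r hardy_hnorm_nonneg[OF Dm] by simp
    qed
    then show "\<exists>no. \<forall>n\<ge>no. norm (hnorm (hardy d) (X n - x) - 0) < r" by blast
  qed
  with x show ?thesis by blast
qed

lemma hilbert_hardy: "complex_hilbert_space (hardy d)"
proof -
  interpret V: vector_space "cscale (hardy d)" by (rule vector_space_hardy)
  show ?thesis
  proof unfold_locales
    show "V.subspace (carrier (hardy d))"
      by (rule V.subspaceI) (use hardy_zero hardy_add(1) hardy_scale(1) in \<open>auto simp: hardy_simps\<close>)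
  next
    fix x y z assume *: "x \<in> carrier (hardy d)" "y \<in> carrier (hardy d)" "z \<in> carrier (hardy d)"
    show "cinner (hardy d) (x + y) z = cinner (hardy d) x z + cinner (hardy d) y z"
      unfolding hardy_simps hardy_add(2)[OF *(1,2)]
      by (simp add: distrib_right sum.distrib suminf_add hardy_cinner_summable *)
  next
    fix x y c assume *: "x \<in> carrier (hardy d)" "y \<in> carrier (hardy d)"
    show "cinner (hardy d) (cscale (hardy d) c x) y = c * cinner (hardy d) x y"
      unfolding hardy_simps hardy_scale(2)[OF *(1)] suminf_mult[OF hardy_cinner_summable[OF *], symmetric]
      by (simp add: sum_distrib_left mult.assoc)
  next
    fix x y assume *: "x \<in> carrier (hardy d)" "y \<in> carrier (hardy d)"
    have "(\<lambda>n. cnj (\<Sum>i<d. hcoeff x n i * cnj (hcoeff y n i))) sums cnj (cinner (hardy d) x y)"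
      unfolding hardy_simps sums_cnj by (rule summable_sums[OF hardy_cinner_summable[OF *]])
    then show "cinner (hardy d) y x = cnj (cinner (hardy d) x y)"
      by (simp add: hardy_simps(2)[of d y x] sums_iff mult.commute)
  next
    fix x assume x: "x \<in> carrier (hardy d)"
    show "0 \<le> Re (cinner (hardy d) x x)"
      by (simp add: hardy_cinner_self[OF x] suminf_nonneg[OF hardy_sqnorm_summable[OF x]])
    assume "cinner (hardy d) x x = 0"
    then have "hnorm (hardy d) x = 0" by (simp add: hnorm_def)
    then have "hcoeff x n i = 0" if "i < d" for n i
      using hardy_coeff_le[OF x that, of n] by simp
    then have "(\<lambda>n. 0) sums x z i" if "z \<in> \<DD>" "i < d" for z i
      using hardy_sums[OF x that(1), of i] that(2) by simp
    then have "x z i = 0" if "z \<in> \<DD>" "i < d" for z i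
      using that sums_zero sums_unique2 by blast
    then show "x = 0" by (intro hardy_eqI[OF x hardy_zero]) simp
  qed (rule complete_hardy)
qed

section \<open>Multiplication operators\<close>

lemma Hinf_matD:
  assumes "\<Phi> \<in> Hinf_mat d"
  shows "z \<in> \<DD> \<Longrightarrow> \<Phi> z \<in> carrier_mat d d"
    and "i < d \<Longrightarrow> j < d \<Longrightarrow> (\<lambda>z. \<Phi> z $$ (i, j)) holomorphic_on \<DD>"
    and "\<exists>C\<ge>0. \<forall>z\<in>\<DD>. \<forall>i<d. \<forall>j<d. cmod (\<Phi> z $$ (i, j)) \<le> C"
proof -
  obtain C where "\<forall>z\<in>\<DD>. \<forall>i<d. \<forall>j<d. cmod (\<Phi> z $$ (i, j)) \<le> C"
    using assms by (auto simp: Hinf_mat_def)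
  then have "\<forall>z\<in>\<DD>. \<forall>i<d. \<forall>j<d. cmod (\<Phi> z $$ (i, j)) \<le> max C 0" by (meson max.coboundedI1)
  then show "\<exists>C\<ge>0. \<forall>z\<in>\<DD>. \<forall>i<d. \<forall>j<d. cmod (\<Phi> z $$ (i, j)) \<le> C"
    by (intro exI[of _ "max C 0"]) simp
qed (use assms in \<open>auto simp: Hinf_mat_def\<close>)

text \<open>
  The scalar estimate for each entry, combined over rows and columns by the Cauchy-Schwarz inequality.
\<close>

lemma mult_op_hardy:
  assumes \<Phi>: "\<Phi> \<in> Hinf_mat d" and h: "h \<in> carrier (hardy d)"
    and C: "C \<ge> 0" "\<forall>z\<in>\<DD>. \<forall>i<d. \<forall>j<d. cmod (\<Phi> z $$ (i, j)) \<le> C"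
  shows "mult_op d \<Phi> h \<in> carrier (hardy d)" "hnorm (hardy d) (mult_op d \<Phi> h) \<le> real d * C * hnorm (hardy d) h"
proof -
  let ?g = "mult_op d \<Phi> h"
  let ?p = "\<lambda>n i j. \<Sum>m\<le>n. taylor_coeff (\<lambda>z. \<Phi> z $$ (i, j)) m * hcoeff h (n - m) j"
  have hol: "(\<lambda>z. \<Phi> z $$ (i, j) * h z j) holomorphic_on \<DD>" if "i < d" "j < d" for i j
    by (intro holomorphic_intros Hinf_matD(2)[OF \<Phi>] hardy_holomorphic[OF h] that)
  have sums: "(\<lambda>n. (\<Sum>j<d. ?p n i j) * z ^ n) sums ?g z i" if "z \<in> \<DD>" "i < d" for z i
  proof -
    have "(\<lambda>n. \<Sum>j<d. taylor_coeff (\<lambda>z. \<Phi> z $$ (i, j) * h z j) n * z ^ n) sums (\<Sum>j<d. \<Phi> z $$ (i, j) * h z j)"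
      by (intro sums_sum taylor_sums hol that) (use that in auto)
    then show ?thesis
      using that by (simp add: mult_op_def sum_distrib_right taylor_coeff_mult[OF Hinf_matD(2)[OF \<Phi>] hardy_holomorphic[OF h]])
  qed
  have bound: "(\<Sum>n<M. (cmod (\<Sum>j<d. ?p n i j))\<^sup>2) \<le> real d * C\<^sup>2 * (hnorm (hardy d) h)\<^sup>2" if i: "i < d" for i M
  proof -
    have "(\<Sum>n<M. (cmod (\<Sum>j<d. ?p n i j))\<^sup>2) \<le> (\<Sum>n<M. (\<Sum>j<d. (cmod (?p n i j))\<^sup>2) * real d)"
    proof (rule sum_mono)
      fix n
      have "(cmod (\<Sum>j<d. ?p n i j))\<^sup>2 \<le> (\<Sum>j<d. cmod (?p n i j))\<^sup>2"
        by (intro power_mono norm_sum) auto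
      also have "\<dots> \<le> (\<Sum>j<d. (cmod (?p n i j))\<^sup>2) * real d"
        using sum_squared_le_sum_of_squares[of "\<lambda>j. cmod (?p n i j)" "{..<d}"] by simp
      finally show "(cmod (\<Sum>j<d. ?p n i j))\<^sup>2 \<le> (\<Sum>j<d. (cmod (?p n i j))\<^sup>2) * real d" .
    qed
    also have "\<dots> = real d * (\<Sum>j<d. \<Sum>n<M. (cmod (?p n i j))\<^sup>2)"
      unfolding sum_distrib_right[symmetric] by (subst sum.swap) (rule mult.commute)
    also have "\<dots> \<le> real d * (\<Sum>j<d. C\<^sup>2 * (\<Sum>n<M. (cmod (hcoeff h n j))\<^sup>2))"
      using C i by (intro mult_left_mono sum_mono multiplier_coeff_bound Hinf_matD(2)[OF \<Phi>]) auto
    also have "\<dots> = real d * C\<^sup>2 * (\<Sum>n<M. sqnorm d (hcoeff h n))"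
      unfolding sqnorm_def sum.swap[of _ "{..<d}" "{..<M}"] by (simp add: sum_distrib_left mult.assoc)
    also have "\<dots> \<le> real d * C\<^sup>2 * (hnorm (hardy d) h)\<^sup>2"
      by (intro mult_left_mono hardy_partial_le[OF h]) auto
    finally show ?thesis .
  qed
  have summ: "summable (\<lambda>n. (cmod (\<Sum>j<d. ?p n i j))\<^sup>2)" if "i < d" for i
    by (rule bounded_imp_summable[OF _ bound[OF that, of "Suc _", unfolded lessThan_Suc_atMost]]) simp
  note * = hardyI[of d ?g "\<lambda>n i. \<Sum>j<d. ?p n i j", OF _ sums summ]
  show g: "?g \<in> carrier (hardy d)"
    by (rule *(1)) (auto simp: mult_op_def)
  have gc: "hcoeff ?g n i = (\<Sum>j<d. ?p n i j)" if "i < d" for n i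
    by (rule *(2)) (use that in \<open>auto simp: mult_op_def\<close>)
  have "(hnorm (hardy d) ?g)\<^sup>2 \<le> (real d * C * hnorm (hardy d) h)\<^sup>2"
  proof (rule hardy_hnorm_leI[OF g])
    fix M
    have "(\<Sum>n<M. sqnorm d (hcoeff ?g n)) = (\<Sum>i<d. \<Sum>n<M. (cmod (\<Sum>j<d. ?p n i j))\<^sup>2)"
      unfolding sqnorm_def by (subst sum.swap) (simp add: gc)
    also have "\<dots> \<le> (\<Sum>i<d. real d * C\<^sup>2 * (hnorm (hardy d) h)\<^sup>2)"
      by (intro sum_mono bound) simp
    also have "\<dots> = (real d * C * hnorm (hardy d) h)\<^sup>2"
      by (simp add: power_mult_distrib power2_eq_square)
    finally show "(\<Sum>n<M. sqnorm d (hcoeff ?g n)) \<le> (real d * C * hnorm (hardy d) h)\<^sup>2" .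
  qed
  then show "hnorm (hardy d) ?g \<le> real d * C * hnorm (hardy d) h"
    by (rule power2_le_imp_le) (use C hardy_hnorm_nonneg[OF h] in simp)
qed

lemma bounded_mult_op:
  assumes \<Phi>: "\<Phi> \<in> Hinf_mat d"
  shows "bounded_op (hardy d) (hardy d) (mult_op d \<Phi>)"
proof -
  obtain C where C: "C \<ge> 0" "\<forall>z\<in>\<DD>. \<forall>i<d. \<forall>j<d. cmod (\<Phi> z $$ (i, j)) \<le> C"
    using Hinf_matD(3)[OF \<Phi>] by blast
  note * = mult_op_hardy[OF \<Phi> _ C]
  have "linear_op (hardy d) (hardy d) (mult_op d \<Phi>)"
    unfolding linear_op_def
  proof (intro conjI ballI allI *(1))
    show "mult_op d \<Phi> (x + y) = mult_op d \<Phi> x + mult_op d \<Phi> y" for x y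
      by (intro ext) (simp add: mult_op_def distrib_left sum.distrib)
    show "mult_op d \<Phi> (cscale (hardy d) c x) = cscale (hardy d) c (mult_op d \<Phi> x)" for c x
      by (intro ext) (simp add: mult_op_def hardy_simps sum_distrib_left mult_ac)
  qed
  moreover have "\<exists>C\<ge>0. \<forall>x\<in>carrier (hardy d). hnorm (hardy d) (mult_op d \<Phi> x) \<le> C * hnorm (hardy d) x"
    by (rule exI[of _ "real d * C"]) (use * C in auto)
  ultimately show ?thesis by (simp add: bounded_op_def)
qed

lemma mult_op_in: "\<Phi> \<in> Hinf_mat d \<Longrightarrow> h \<in> carrier (hardy d) \<Longrightarrow> mult_op d \<Phi> h \<in> carrier (hardy d)"
  using bounded_mult_op unfolding bounded_op_def linear_op_def by blast

section \<open>The Szego kernel\<close>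

text \<open>
  The reproducing kernel at \<open>l\<close> in the direction \<open>v\<close>.
\<close>

definition szego :: "nat \<Rightarrow> complex \<Rightarrow> (nat \<Rightarrow> complex) \<Rightarrow> complex \<Rightarrow> nat \<Rightarrow> complex" where
  "szego d l v = (\<lambda>z i. if z \<in> \<DD> \<and> i < d then v i / (1 - cnj l * z) else 0)"

lemma szego_hardy:
  assumes l: "l \<in> \<DD>"
  shows "szego d l v \<in> carrier (hardy d)" "i < d \<Longrightarrow> hcoeff (szego d l v) n i = v i * cnj l ^ n"
proof -
  have sums: "(\<lambda>n. (v i * cnj l ^ n) * z ^ n) sums szego d l v z i" if "z \<in> \<DD>" "i < d" for z i
  proof -
    have "cmod (cnj l * z) < 1"
      using l that mult_strict_mono[of "cmod l" 1 "cmod z" 1] by (simp add: norm_mult)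
    then have "(\<lambda>n. v i * (cnj l * z) ^ n) sums (v i * (1 / (1 - cnj l * z)))"
      by (intro sums_mult geometric_sums)
    then show ?thesis using that by (simp add: szego_def power_mult_distrib mult.assoc)
  qed
  have summ: "summable (\<lambda>n. (cmod (v i * cnj l ^ n))\<^sup>2)" for i
  proof -
    have "(cmod l)\<^sup>2 < 1" using l by (simp add: abs_square_less_1)
    then have "summable (\<lambda>n. (cmod (v i))\<^sup>2 * ((cmod l)\<^sup>2) ^ n)"
      by (intro summable_mult summable_geometric) simp
    then show ?thesis by (simp add: norm_mult norm_power power_mult_distrib flip: power_mult) (simp add: mult.commute)
  qed
  note * = hardyI[of d "szego d l v" "\<lambda>n i. v i * cnj l ^ n", OF _ sums summ]
  show "szego d l v \<in> carrier (hardy d)" by (rule *(1)) (auto simp: szego_def)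
  show "hcoeff (szego d l v) n i = v i * cnj l ^ n" if "i < d" by (rule *(2)) (use that in \<open>auto simp: szego_def\<close>)
qed

lemma cinner_szego:
  assumes l: "l \<in> \<DD>" and h: "h \<in> carrier (hardy d)"
  shows "cinner (hardy d) h (szego d l v) = (\<Sum>i<d. cnj (v i) * h l i)"
proof -
  have "(\<lambda>n. \<Sum>i<d. cnj (v i) * (hcoeff h n i * l ^ n)) sums (\<Sum>i<d. cnj (v i) * h l i)"
    by (intro sums_sum sums_mult hardy_sums[OF h l])
  moreover have "(\<Sum>i<d. cnj (v i) * (hcoeff h n i * l ^ n))
      = (\<Sum>i<d. hcoeff h n i * cnj (hcoeff (szego d l v) n i))" for n
    by (intro sum.cong refl) (simp add: szego_hardy(2)[OF l])
  ultimately show ?thesis by (simp add: hardy_simps sums_iff)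
qed

text \<open>
  Pairing the image of the kernel in direction \<open>x\<close> with the kernel in direction \<open>\<Psi>(z) x\<close>, and using that
  multiplication by \<open>\<Psi>\<close> preserves norms, gives \<open>\<parallel>\<Psi>(z) x\<parallel>\<^sup>2 \<le> \<parallel>x\<parallel> \<parallel>\<Psi>(z) x\<parallel>\<close> up to the common factor
  \<open>1 / (1 - \<bar>z\<bar>\<^sup>2)\<close>.
\<close>

lemma inner_fun_contraction:
  assumes inner: "inner_fun d \<Psi>" and z: "z \<in> \<DD>"
  shows "sqnorm d (matvec d (\<Psi> z) x) \<le> sqnorm d x"
proof -
  interpret H: complex_hilbert_space "hardy d" by (rule hilbert_hardy)
  have \<Psi>: "\<Psi> \<in> Hinf_mat d" and iso: "\<And>h. h \<in> carrier (hardy d) \<Longrightarrow> hnorm (hardy d) (mult_op d \<Psi> h) = hnorm (hardy d) h"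
    using inner by (auto simp: inner_fun_def isometry_op_def)
  have "(cmod z)\<^sup>2 < 1" using z by (simp add: abs_square_less_1)
  define s where "s = 1 / (1 - (cmod z)\<^sup>2)"
  have s: "s > 0" using \<open>(cmod z)\<^sup>2 < 1\<close> by (simp add: s_def)
  have at: "szego d z u z i = of_real s * u i" if "i < d" for u i
    using that z by (simp add: szego_def s_def complex_norm_square mult.commute del: of_real_power)
  have norm: "(hnorm (hardy d) (szego d z u))\<^sup>2 = s * sqnorm d u" for u
  proof -
    have "complex_of_real ((hnorm (hardy d) (szego d z u))\<^sup>2) = (\<Sum>i<d. cnj (u i) * (of_real s * u i))"
      using cinner_szego[OF z szego_hardy(1)[OF z], of d u u] at
      by (simp only: H.cinner_self[OF szego_hardy(1)[OF z]] cong: sum.cong) simp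
    also have "\<dots> = complex_of_real (s * sqnorm d u)"
      by (simp add: sqnorm_def sum_distrib_left complex_norm_square mult_ac del: of_real_power)
    finally show ?thesis by (simp only: of_real_eq_iff)
  qed
  define v where "v = matvec d (\<Psi> z) x"
  have M: "mult_op d \<Psi> (szego d z x) \<in> carrier (hardy d)"
    by (rule mult_op_in[OF \<Psi> szego_hardy(1)[OF z]])
  have "cinner (hardy d) (mult_op d \<Psi> (szego d z x)) (szego d z v) = (\<Sum>i<d. cnj (v i) * (of_real s * v i))"
    unfolding cinner_szego[OF z M]
  proof (rule sum.cong[OF refl])
    fix i assume i: "i \<in> {..<d}"
    have "mult_op d \<Psi> (szego d z x) z i = (\<Sum>j<d. \<Psi> z $$ (i, j) * (of_real s * x j))"
      using i z by (simp add: mult_op_def at)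
    then show "cnj (v i) * mult_op d \<Psi> (szego d z x) z i = cnj (v i) * (of_real s * v i)"
      by (simp add: v_def matvec_def sum_distrib_left mult_ac)
  qed
  also have "\<dots> = complex_of_real (s * sqnorm d v)"
    by (simp add: sqnorm_def sum_distrib_left complex_norm_square mult_ac del: of_real_power)
  finally have "s * sqnorm d v \<le> hnorm (hardy d) (mult_op d \<Psi> (szego d z x)) * hnorm (hardy d) (szego d z v)"
    using H.Cauchy_Schwarz[OF M szego_hardy(1)[OF z], of v] s by (simp add: norm_mult)
  then have "(s * sqnorm d v)\<^sup>2 \<le> (hnorm (hardy d) (szego d z x) * hnorm (hardy d) (szego d z v))\<^sup>2"
    using s unfolding iso[OF szego_hardy(1)[OF z]] by (intro power_mono) auto
  then have "(s * sqnorm d v) * (s * sqnorm d v) \<le> (s * sqnorm d x) * (s * sqnorm d v)"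
    unfolding power_mult_distrib[of "hnorm _ _"] norm by (simp add: power2_eq_square)
  then have "sqnorm d v \<le> sqnorm d x" if "sqnorm d v > 0"
    using s that by (simp add: mult_le_cancel_right_pos)
  then have "sqnorm d v \<le> sqnorm d x"
    using sqnorm_nonneg[of d v] sqnorm_nonneg[of d x] by linarith
  then show ?thesis by (simp add: v_def)
qed

section \<open>Bounded holomorphic functions of two variables\<close>

text \<open>
  Cauchy estimates on a disc of radius \<open>(1 - \<rho>) / 2\<close>.  The constants depend only on the bound for \<open>g\<close>;
  in two variables this yields estimates that are uniform in the other variable.
\<close>

lemma deriv_bounds:
  assumes g: "g holomorphic_on \<DD>" and B: "\<And>z. z \<in> \<DD> \<Longrightarrow> cmod (g z) \<le> B"
    and \<rho>: "\<rho> < 1" and x: "cmod x \<le> \<rho>"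
  shows "cmod (deriv g x) \<le> B / ((1 - \<rho>) / 2)"
    and "cmod (deriv (deriv g) x) \<le> 2 * B / ((1 - \<rho>) / 2)\<^sup>2"
proof -
  let ?r = "(1 - \<rho>) / 2"
  have sub: "cball x ?r \<subseteq> \<DD>"
  proof
    fix y assume "y \<in> cball x ?r"
    then have "cmod (y - x) \<le> ?r" by (simp add: dist_norm norm_minus_commute)
    then have "cmod y < 1" using norm_triangle_sub[of y x] x \<rho> by argo
    then show "y \<in> \<DD>" by simp
  qed
  have "cmod ((deriv ^^ n) g x) \<le> fact n * B / ?r ^ n" for n
  proof (rule Cauchy_inequality)
    show "g holomorphic_on ball x ?r"
      using sub ball_subset_cball by (blast intro: holomorphic_on_subset[OF g])
    show "continuous_on (cball x ?r) g"
      using sub holomorphic_on_imp_continuous_on[OF g] continuous_on_subset by blast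
    show "cmod (g y) \<le> B" if "cmod (x - y) = ?r" for y
      by (rule B, rule subsetD[OF sub]) (simp only: mem_cball dist_norm that order_refl)
  qed (use \<rho> in simp)
  from this[of 1] this[of 2] show "cmod (deriv g x) \<le> B / ?r" "cmod (deriv (deriv g) x) \<le> 2 * B / ?r\<^sup>2"
    by (simp_all add: numeral_2_eq_2)
qed

lemma holomorphic_Lipschitz:
  assumes g: "g holomorphic_on \<DD>" and B: "\<And>z. z \<in> \<DD> \<Longrightarrow> cmod (g z) \<le> B"
    and \<rho>: "\<rho> < 1" and x: "cmod x \<le> \<rho>" and y: "cmod y \<le> \<rho>"
  shows "cmod (g x - g y) \<le> B / ((1 - \<rho>) / 2) * cmod (x - y)"
    and "cmod (deriv g x - deriv g y) \<le> 2 * B / ((1 - \<rho>) / 2)\<^sup>2 * cmod (x - y)"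
proof -
  have sub: "z \<in> \<DD>" if "z \<in> cball 0 \<rho>" for z using that \<rho> by simp
  show "cmod (g x - g y) \<le> B / ((1 - \<rho>) / 2) * cmod (x - y)"
  proof (rule field_differentiable_bound[where S = "cball 0 \<rho>"])
    show "(g has_field_derivative deriv g z) (at z within cball 0 \<rho>)" if "z \<in> cball 0 \<rho>" for z
      using holomorphic_derivI[OF g open_ball sub[OF that]] has_field_derivative_at_within by blast
    show "cmod (deriv g z) \<le> B / ((1 - \<rho>) / 2)" if "z \<in> cball 0 \<rho>" for z
      using deriv_bounds(1)[OF g B \<rho>] that by simp
  qed (use x y in auto)
  have g': "deriv g holomorphic_on \<DD>" using g by (rule holomorphic_deriv) simp
  show "cmod (deriv g x - deriv g y) \<le> 2 * B / ((1 - \<rho>) / 2)\<^sup>2 * cmod (x - y)"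
  proof (rule field_differentiable_bound[where S = "cball 0 \<rho>"])
    show "(deriv g has_field_derivative deriv (deriv g) z) (at z within cball 0 \<rho>)" if "z \<in> cball 0 \<rho>" for z
      using holomorphic_derivI[OF g' open_ball sub[OF that]] has_field_derivative_at_within by blast
    show "cmod (deriv (deriv g) z) \<le> 2 * B / ((1 - \<rho>) / 2)\<^sup>2" if "z \<in> cball 0 \<rho>" for z
      using deriv_bounds(2)[OF g B \<rho>] that by simp
  qed (use x y in auto)
qed

lemma Hinf2D:
  assumes "f \<in> Hinf2"
  shows "w \<in> \<DD> \<Longrightarrow> (\<lambda>z. f (z, w)) holomorphic_on \<DD>"
    and "z \<in> \<DD> \<Longrightarrow> (\<lambda>w. f (z, w)) holomorphic_on \<DD>"
    and "\<exists>C\<ge>0. \<forall>z\<in>\<DD>. \<forall>w\<in>\<DD>. cmod (f (z, w)) \<le> C"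
proof -
  have der: "\<exists>a b. (f has_derivative (\<lambda>(u, v). a * u + b * v)) (at (z, w))" if "z \<in> \<DD>" "w \<in> \<DD>" for z w
    using assms that by (auto simp: Hinf2_def)
  show "(\<lambda>z. f (z, w)) holomorphic_on \<DD>" if w: "w \<in> \<DD>"
  proof (rule holomorphic_onI)
    fix z assume z: "z \<in> \<DD>"
    obtain a b where f': "(f has_derivative (\<lambda>(u, v). a * u + b * v)) (at (z, w))" using der[OF z w] by blast
    have "((\<lambda>z. (z, w)) has_derivative (\<lambda>u. (u, 0))) (at z)" by (auto intro!: derivative_eq_intros)
    from diff_chain_at[OF this f'] have "((\<lambda>z. f (z, w)) has_derivative (\<lambda>u. a * u)) (at z)"
      by (simp add: o_def)
    then have "((\<lambda>z. f (z, w)) has_field_derivative a) (at z)" by (simp add: has_field_derivative_def)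
    then show "(\<lambda>z. f (z, w)) field_differentiable at z within \<DD>"
      using field_differentiable_at_within field_differentiable_def by blast
  qed
  show "(\<lambda>w. f (z, w)) holomorphic_on \<DD>" if z: "z \<in> \<DD>"
  proof (rule holomorphic_onI)
    fix w assume w: "w \<in> \<DD>"
    obtain a b where f': "(f has_derivative (\<lambda>(u, v). a * u + b * v)) (at (z, w))" using der[OF z w] by blast
    have "((\<lambda>w. (z, w)) has_derivative (\<lambda>u. (0, u))) (at w)" by (auto intro!: derivative_eq_intros)
    from diff_chain_at[OF this f'] have "((\<lambda>w. f (z, w)) has_derivative (\<lambda>u. b * u)) (at w)"
      by (simp add: o_def)
    then have "((\<lambda>w. f (z, w)) has_field_derivative b) (at w)" by (simp add: has_field_derivative_def)
    then show "(\<lambda>w. f (z, w)) field_differentiable at w within \<DD>"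
      using field_differentiable_at_within field_differentiable_def by blast
  qed
  obtain C where C: "\<forall>p\<in>\<DD> \<times> \<DD>. cmod (f p) \<le> C" using assms by (auto simp: Hinf2_def)
  then have "cmod (f (0, 0)) \<le> C" by simp
  then have "C \<ge> 0" using norm_ge_zero order_trans by blast
  with C show "\<exists>C\<ge>0. \<forall>z\<in>\<DD>. \<forall>w\<in>\<DD>. cmod (f (z, w)) \<le> C" by blast
qed

text \<open>
  For bounded functions separate holomorphy implies joint differentiability.  By the Cauchy estimates
  the partial derivative in \<open>w\<close> is Lipschitz in each variable, hence jointly continuous, and a function
  with one partial derivative and the other one continuous is differentiable.
\<close>

lemma Hinf2I:
  assumes hz: "\<And>w. w \<in> \<DD> \<Longrightarrow> (\<lambda>z. f (z, w)) holomorphic_on \<DD>"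
    and hw: "\<And>z. z \<in> \<DD> \<Longrightarrow> (\<lambda>w. f (z, w)) holomorphic_on \<DD>"
    and C: "\<And>z w. z \<in> \<DD> \<Longrightarrow> w \<in> \<DD> \<Longrightarrow> cmod (f (z, w)) \<le> C"
  shows "f \<in> Hinf2"
proof -
  define fw where "fw z w = deriv (\<lambda>w. f (z, w)) w" for z w
  have "\<exists>a b. (f has_derivative (\<lambda>(u, v). a * u + b * v)) (at (z, w))" if z: "z \<in> \<DD>" and w: "w \<in> \<DD>" for z w
  proof -
    define \<rho> where "\<rho> = (1 + max (cmod z) (cmod w)) / 2"
    have \<rho>: "\<rho> < 1" "cmod z < \<rho>" "cmod w < \<rho>" using z w by (auto simp: \<rho>_def)
    define S where "S = ball (0::complex) \<rho>"
    have SD: "y \<in> \<DD>" if "y \<in> S" for y using that \<rho> by (simp add: S_def)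
    define K where "K = 1 / ((1 - \<rho>) / 2)"
    have lim: "((\<lambda>(x, y). fw x y) \<longlongrightarrow> fw z w) (at (z, w) within S \<times> S)"
    proof (rule LIM_zero_cancel, rule Lim_null_comparison)
      show "\<forall>\<^sub>F p in at (z, w) within S \<times> S. cmod ((case p of (x, y) \<Rightarrow> fw x y) - fw z w)
          \<le> 2 * C / ((1 - \<rho>) / 2)\<^sup>2 * cmod (snd p - w) + C * K * cmod (fst p - z) * K"
        unfolding eventually_at_filter
      proof (rule always_eventually, intro allI impI)
        fix p assume "p \<noteq> (z, w)" and pS: "p \<in> S \<times> S"
        obtain x y where p: "p = (x, y)" by force
        have xy: "x \<in> S" "y \<in> S" using pS p by auto
        (* change w first, then z; the second change is the derivative of a small difference *)
        have 1: "cmod (fw x y - fw x w) \<le> 2 * C / ((1 - \<rho>) / 2)\<^sup>2 * cmod (y - w)"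
          unfolding fw_def using xy \<rho> SD
          by (intro holomorphic_Lipschitz(2)[OF hw C]) (auto simp: S_def)
        have hx: "(\<lambda>v. f (x, v)) field_differentiable at w" "(\<lambda>v. f (z, v)) field_differentiable at w"
          using hw[OF SD[OF xy(1)]] hw[OF z] w holomorphic_on_imp_differentiable_at open_ball by blast+
        have "cmod (deriv (\<lambda>v. f (x, v) - f (z, v)) w) \<le> (C * K * cmod (x - z)) / ((1 - \<rho>) / 2)"
        proof (rule deriv_bounds(1))
          show "(\<lambda>v. f (x, v) - f (z, v)) holomorphic_on \<DD>"
            by (intro holomorphic_intros hw SD xy z)
          show "cmod (f (x, v) - f (z, v)) \<le> C * K * cmod (x - z)" if v: "v \<in> \<DD>" for v
            using holomorphic_Lipschitz(1)[OF hz[OF v] C[OF _ v] \<rho>(1), of x z] xy \<rho> by (simp add: S_def K_def)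
        qed (use \<rho> in auto)
        then have 2: "cmod (fw x w - fw z w) \<le> C * K * cmod (x - z) * K"
          unfolding fw_def deriv_diff[OF hx] by (simp add: K_def)
        show "cmod ((case p of (x, y) \<Rightarrow> fw x y) - fw z w)
            \<le> 2 * C / ((1 - \<rho>) / 2)\<^sup>2 * cmod (snd p - w) + C * K * cmod (fst p - z) * K"
          using norm_triangle_ineq[of "fw x y - fw x w" "fw x w - fw z w"] 1 2 by (simp add: p)
      qed
      have "((\<lambda>p. 2 * C / ((1 - \<rho>) / 2)\<^sup>2 * cmod (snd p - w) + C * K * cmod (fst p - z) * K)
          \<longlongrightarrow> 2 * C / ((1 - \<rho>) / 2)\<^sup>2 * cmod (snd (z, w) - w) + C * K * cmod (fst (z, w) - z) * K) (at (z, w) within S \<times> S)"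
        by (intro tendsto_intros)
      then show "((\<lambda>p. 2 * C / ((1 - \<rho>) / 2)\<^sup>2 * cmod (snd p - w) + C * K * cmod (fst p - z) * K) \<longlongrightarrow> 0) (at (z, w) within S \<times> S)"
        by simp
    qed
    have "((\<lambda>(x, y). f (x, y)) has_derivative
        (\<lambda>(u, v). deriv (\<lambda>z. f (z, w)) z * u + blinfun_mult_right (fw z w) v)) (at (z, w) within S \<times> S)"
    proof (rule has_derivative_partialsI)
      show "((\<lambda>x. f (x, w)) has_derivative (*) (deriv (\<lambda>z. f (z, w)) z)) (at z within S)"
        using holomorphic_derivI[OF hz[OF w] open_ball z]
        by (simp add: has_field_derivative_def has_derivative_at_withinI)
      show "((\<lambda>y. f (x, y)) has_derivative blinfun_apply (blinfun_mult_right (fw x y))) (at y within S)"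
        if "x \<in> S" "y \<in> S" for x y
        using holomorphic_derivI[OF hw[OF SD[OF that(1)]] open_ball SD[OF that(2)]]
        by (simp add: has_field_derivative_def has_derivative_at_withinI fw_def)
      have "((\<lambda>p. blinfun_mult_right (case p of (x, y) \<Rightarrow> fw x y)) \<longlongrightarrow> blinfun_mult_right (fw z w)) (at (z, w) within S \<times> S)"
        by (rule bounded_linear.tendsto[OF bounded_linear_blinfun_mult_right lim])
      then show "continuous (at (z, w) within S \<times> S) (\<lambda>(x, y). blinfun_mult_right (fw x y))"
        by (simp add: continuous_within case_prod_unfold)
    qed (use \<rho> in \<open>auto simp: S_def\<close>)
    moreover have "at (z, w) within S \<times> S = at (z, w)"
      using \<rho> by (intro at_within_open) (auto simp: S_def open_Times)
    ultimately show ?thesis by auto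
  qed
  then show ?thesis using C unfolding Hinf2_def by fast
qed

lemma Hinf2_const: "(\<lambda>p. c) \<in> Hinf2"
  by (rule Hinf2I[where C = "cmod c"]) auto

lemma Hinf2_fst: "fst \<in> Hinf2"
  by (rule Hinf2I[where C = 1]) auto

lemma Hinf2_snd: "snd \<in> Hinf2"
  by (rule Hinf2I[where C = 1]) auto

lemma Hinf2_add:
  assumes f: "f \<in> Hinf2" and g: "g \<in> Hinf2"
  shows "(\<lambda>p. f p + g p) \<in> Hinf2"
proof -
  obtain C where C: "\<forall>z\<in>\<DD>. \<forall>w\<in>\<DD>. cmod (f (z, w)) \<le> C" using Hinf2D(3)[OF f] by blast
  obtain D where D: "\<forall>z\<in>\<DD>. \<forall>w\<in>\<DD>. cmod (g (z, w)) \<le> D" using Hinf2D(3)[OF g] by blast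
  show ?thesis
  proof (rule Hinf2I[where C = "C + D"])
    show "(\<lambda>z. f (z, w) + g (z, w)) holomorphic_on \<DD>" if "w \<in> \<DD>" for w
      by (intro holomorphic_intros Hinf2D(1)[OF f that] Hinf2D(1)[OF g that])
    show "(\<lambda>w. f (z, w) + g (z, w)) holomorphic_on \<DD>" if "z \<in> \<DD>" for z
      by (intro holomorphic_intros Hinf2D(2)[OF f that] Hinf2D(2)[OF g that])
    show "cmod (f (z, w) + g (z, w)) \<le> C + D" if "z \<in> \<DD>" "w \<in> \<DD>" for z w
      using C D that by (intro order_trans[OF norm_triangle_ineq] add_mono) auto
  qed
qed

lemma Hinf2_mult:
  assumes f: "f \<in> Hinf2" and g: "g \<in> Hinf2"
  shows "(\<lambda>p. f p * g p) \<in> Hinf2"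
proof -
  obtain C where C: "C \<ge> 0" "\<forall>z\<in>\<DD>. \<forall>w\<in>\<DD>. cmod (f (z, w)) \<le> C" using Hinf2D(3)[OF f] by blast
  obtain D where D: "\<forall>z\<in>\<DD>. \<forall>w\<in>\<DD>. cmod (g (z, w)) \<le> D" using Hinf2D(3)[OF g] by blast
  show ?thesis
  proof (rule Hinf2I[where C = "C * D"])
    show "(\<lambda>z. f (z, w) * g (z, w)) holomorphic_on \<DD>" if "w \<in> \<DD>" for w
      by (intro holomorphic_intros Hinf2D(1)[OF f that] Hinf2D(1)[OF g that])
    show "(\<lambda>w. f (z, w) * g (z, w)) holomorphic_on \<DD>" if "z \<in> \<DD>" for z
      by (intro holomorphic_intros Hinf2D(2)[OF f that] Hinf2D(2)[OF g that])
    show "cmod (f (z, w) * g (z, w)) \<le> C * D" if "z \<in> \<DD>" "w \<in> \<DD>" for z w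
      using C D that unfolding norm_mult by (intro mult_mono) auto
  qed
qed

lemma Hinf2_inverse:
  assumes f: "f \<in> Hinf2" and e: "e > 0" "\<And>z w. z \<in> \<DD> \<Longrightarrow> w \<in> \<DD> \<Longrightarrow> e \<le> cmod (f (z, w))"
  shows "(\<lambda>p. inverse (f p)) \<in> Hinf2"
proof (rule Hinf2I[where C = "inverse e"])
  have nz: "f (z, w) \<noteq> 0" if "z \<in> \<DD>" "w \<in> \<DD>" for z w using e(2)[OF that] e(1) by auto
  show "(\<lambda>z. inverse (f (z, w))) holomorphic_on \<DD>" if "w \<in> \<DD>" for w
    using nz that by (intro holomorphic_on_inverse Hinf2D(1)[OF f]) auto
  show "(\<lambda>w. inverse (f (z, w))) holomorphic_on \<DD>" if "z \<in> \<DD>" for z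
    using nz that by (intro holomorphic_on_inverse Hinf2D(2)[OF f]) auto
  show "cmod (inverse (f (z, w))) \<le> inverse e" if "z \<in> \<DD>" "w \<in> \<DD>" for z w
    using e(2)[OF that] e(1) by (simp add: norm_inverse le_imp_inverse_le)
qed

lemma Hinf2_swap:
  assumes f: "f \<in> Hinf2"
  shows "(\<lambda>(z, w). f (w, z)) \<in> Hinf2"
proof -
  obtain C where C: "\<forall>z\<in>\<DD>. \<forall>w\<in>\<DD>. cmod (f (z, w)) \<le> C" using Hinf2D(3)[OF f] by blast
  show ?thesis
    by (rule Hinf2I[where C = C]) (use C Hinf2D(1,2)[OF f] in auto)
qed

text \<open>
  The difference quotient is bounded close to \<open>z = l\<close> by a Lipschitz constant of \<open>f\<close> and far away by the
  supremum of \<open>f\<close>.  Its separate holomorphy is only at stake on the line \<open>z = l\<close>.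
\<close>

lemma Hinf2_quotient_fst:
  assumes f: "f \<in> Hinf2" and l: "l \<in> \<DD>"
  obtains g where "g \<in> Hinf2" "\<And>z w. z \<in> \<DD> \<Longrightarrow> w \<in> \<DD> \<Longrightarrow> f (z, w) = f (l, w) + (z - l) * g (z, w)"
proof -
  define g where "g = (\<lambda>(z, w). if z = l then deriv (\<lambda>z. f (z, w)) l else (f (z, w) - f (l, w)) / (z - l))"
  obtain C where C: "C \<ge> 0" "\<And>z w. z \<in> \<DD> \<Longrightarrow> w \<in> \<DD> \<Longrightarrow> cmod (f (z, w)) \<le> C" using Hinf2D(3)[OF f] by blast
  define \<rho> where "\<rho> = (1 + cmod l) / 2"
  define B where "B = C / ((1 - \<rho>) / 2)"
  have \<rho>: "\<rho> < 1" "cmod l < \<rho>" using l by (auto simp: \<rho>_def)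
  have hol: "(\<lambda>z. g (z, w)) holomorphic_on \<DD>" if "w \<in> \<DD>" for w
    using pole_lemma[OF Hinf2D(1)[OF f that], of l] l by (simp add: g_def)
  have bound: "cmod (g (z, w)) \<le> B" if z: "z \<in> \<DD>" and w: "w \<in> \<DD>" for z w
  proof (cases "z = l")
    case True
    then show ?thesis
      using deriv_bounds(1)[OF Hinf2D(1)[OF f w] C(2)[OF _ w] \<rho>(1), of l] \<rho> by (simp add: g_def B_def)
  next
    case False
    have "cmod (f (z, w) - f (l, w)) \<le> B * cmod (z - l)"
    proof (cases "cmod z \<le> \<rho>")
      case True
      then show ?thesis
        using holomorphic_Lipschitz(1)[OF Hinf2D(1)[OF f w] C(2)[OF _ w] \<rho>(1), of z l] \<rho> by (simp add: B_def)
    next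
      case False
      have "cmod (f (z, w) - f (l, w)) \<le> 2 * C"
        using norm_triangle_ineq4[of "f (z, w)" "f (l, w)"] C(2)[OF z w] C(2)[OF l w] by linarith
      also have "\<dots> = B * (1 - \<rho>)" using \<rho> by (simp add: B_def)
      also have "\<dots> \<le> B * cmod (z - l)"
      proof (rule mult_left_mono)
        show "1 - \<rho> \<le> cmod (z - l)"
          using False norm_triangle_ineq2[of z l] \<rho>_def by argo
        show "0 \<le> B" using C(1) \<rho> by (simp add: B_def)
      qed
      finally show ?thesis .
    qed
    then show ?thesis using False by (simp add: g_def norm_divide pos_divide_le_eq)
  qed
  have holw: "(\<lambda>w. g (z, w)) holomorphic_on \<DD>" if z: "z \<in> \<DD>" "z \<noteq> l" for z
    using that by (auto simp: g_def intro!: holomorphic_intros Hinf2D(2)[OF f] l)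
  (* on the exceptional line, g is a uniform limit of its values on nearby lines *)
  have "(\<lambda>w. g (l, w)) holomorphic_on \<DD>"
  proof (rule holomorphic_uniform_sequence[OF open_ball])
    define h where "h n = l + of_real ((\<rho> - cmod l) / real (n + 2))" for n
    have hl: "cmod (h n - l) = (\<rho> - cmod l) / real (n + 2)" for n
    proof -
      have "0 \<le> (\<rho> - cmod l) / real (n + 2)" using \<rho> by simp
      then show ?thesis unfolding h_def by (simp only: add_diff_cancel_left' norm_of_real abs_of_nonneg)
    qed
    have small: "(\<rho> - cmod l) / real (n + 2) \<le> \<rho> - cmod l" for n
      using \<rho> by (simp add: divide_le_eq)
    have h\<rho>: "cmod (h n) \<le> \<rho>" for n
      using norm_triangle_sub[of "h n" l] hl[of n] small[of n] by linarith
    have hD: "h n \<in> \<DD>" for n using h\<rho>[of n] \<rho> by simp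
    have hne: "h n \<noteq> l" for n
    proof
      assume "h n = l"
      then have "(\<rho> - cmod l) / real (n + 2) = 0" using hl[of n] by simp
      then show False using \<rho> by simp
    qed
    show "(\<lambda>w. g (h n, w)) holomorphic_on \<DD>" for n by (rule holw[OF hD hne])
    fix w assume "w \<in> \<DD>"
    then obtain d where d: "d > 0" "cball w d \<subseteq> \<DD>" using open_contains_cball open_ball by blast
    have "uniform_limit (cball w d) (\<lambda>n w. g (h n, w)) (\<lambda>w. g (l, w)) sequentially"
    proof (rule uniform_limitI)
      fix e :: real assume e: "e > 0"
      have "(\<lambda>n. B / ((1 - \<rho>) / 2) * ((\<rho> - cmod l) / real (n + 2))) \<longlonglongrightarrow> 0"
        by real_asymp
      then have "\<forall>\<^sub>F n in sequentially. B / ((1 - \<rho>) / 2) * ((\<rho> - cmod l) / real (n + 2)) < e"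
        using e by (rule order_tendstoD)
      then show "\<forall>\<^sub>F n in sequentially. \<forall>x\<in>cball w d. dist (g (h n, x)) (g (l, x)) < e"
      proof (rule eventually_mono, intro ballI)
        fix n x assume n: "B / ((1 - \<rho>) / 2) * ((\<rho> - cmod l) / real (n + 2)) < e" and x: "x \<in> cball w d"
        have xD: "x \<in> \<DD>" using x d by blast
        have "cmod (g (h n, x) - g (l, x)) \<le> B / ((1 - \<rho>) / 2) * cmod (h n - l)"
          using holomorphic_Lipschitz(1)[OF hol[OF xD] bound[OF _ xD] \<rho>(1) h\<rho>] \<rho> by simp
        then show "dist (g (h n, x)) (g (l, x)) < e" using n by (simp add: dist_norm hl)
      qed
    qed
    with d show "\<exists>d. 0 < d \<and> cball w d \<subseteq> \<DD> \<and> uniform_limit (cball w d) (\<lambda>n w. g (h n, w)) (\<lambda>w. g (l, w)) sequentially"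
      by blast
  qed
  with holw have "(\<lambda>w. g (z, w)) holomorphic_on \<DD>" if "z \<in> \<DD>" for z using that by (cases "z = l") auto
  with hol bound have "g \<in> Hinf2" by (intro Hinf2I)
  moreover have "f (z, w) = f (l, w) + (z - l) * g (z, w)" for z w by (simp add: g_def)
  ultimately show ?thesis using that by blast
qed

lemma Hinf2_quotient_snd:
  assumes f: "f \<in> Hinf2" and m: "m \<in> \<DD>"
  obtains g where "g \<in> Hinf2" "\<And>z w. z \<in> \<DD> \<Longrightarrow> w \<in> \<DD> \<Longrightarrow> f (z, w) = f (z, m) + (w - m) * g (z, w)"
proof -
  obtain g where g: "g \<in> Hinf2" "\<And>z w. z \<in> \<DD> \<Longrightarrow> w \<in> \<DD> \<Longrightarrow> f (w, z) = f (w, m) + (z - m) * g (z, w)"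
    using Hinf2_quotient_fst[OF Hinf2_swap[OF f] m] by auto
  show ?thesis by (rule that[OF Hinf2_swap[OF g(1)]]) (use g(2) in simp)
qed

text \<open>
  The Gleason problem at a point of the bidisc is solved by changing one variable at a time.
\<close>

lemma Hinf2_Gleason:
  assumes f: "f \<in> Hinf2" and l: "l \<in> \<DD>" and m: "m \<in> \<DD>"
  obtains g h where "g \<in> Hinf2" "h \<in> Hinf2"
    "\<And>z w. z \<in> \<DD> \<Longrightarrow> w \<in> \<DD> \<Longrightarrow> f (z, w) = f (l, m) + (z - l) * g (z, w) + (w - m) * h (z, w)"
proof -
  obtain g where g: "g \<in> Hinf2" "\<And>z w. z \<in> \<DD> \<Longrightarrow> w \<in> \<DD> \<Longrightarrow> f (z, w) = f (l, w) + (z - l) * g (z, w)"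
    using Hinf2_quotient_fst[OF f l] by blast
  obtain h where h: "h \<in> Hinf2" "\<And>z w. z \<in> \<DD> \<Longrightarrow> w \<in> \<DD> \<Longrightarrow> f (z, w) = f (z, m) + (w - m) * h (z, w)"
    using Hinf2_quotient_snd[OF f m] by blast
  have "(\<lambda>(z, w). h (l, w)) \<in> Hinf2"
  proof -
    obtain C where C: "\<forall>z\<in>\<DD>. \<forall>w\<in>\<DD>. cmod (h (z, w)) \<le> C" using Hinf2D(3)[OF h(1)] by blast
    show ?thesis by (rule Hinf2I[where C = C]) (use C l Hinf2D(2)[OF h(1)] in auto)
  qed
  with g(1) show ?thesis
  proof (rule that)
    show "f (z, w) = f (l, m) + (z - l) * g (z, w) + (w - m) * (case (z, w) of (z, w) \<Rightarrow> h (l, w))"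
      if "z \<in> \<DD>" "w \<in> \<DD>" for z w
      using g(2)[OF that] h(2)[OF l that(2)] by simp
  qed
qed

section \<open>Functions of a matrix\<close>

lemma smult_pow_mat:
  assumes A: "(A :: complex mat) \<in> carrier_mat d d"
  shows "(c \<cdot>\<^sub>m A) ^\<^sub>m n = c ^ n \<cdot>\<^sub>m A ^\<^sub>m n"
proof (induction n)
  case (Suc n)
  have P: "A ^\<^sub>m n \<in> carrier_mat d d" by (rule pow_carrier_mat[OF A])
  have "(c \<cdot>\<^sub>m A) ^\<^sub>m Suc n = (c ^ n \<cdot>\<^sub>m A ^\<^sub>m n) * (c \<cdot>\<^sub>m A)" using Suc by simp
  also have "\<dots> = c ^ n \<cdot>\<^sub>m (A ^\<^sub>m n * (c \<cdot>\<^sub>m A))" using A P by (intro mult_smult_assoc_mat) auto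
  also have "A ^\<^sub>m n * (c \<cdot>\<^sub>m A) = c \<cdot>\<^sub>m (A ^\<^sub>m n * A)" using A P by (intro mult_smult_distrib) auto
  also have "c ^ n \<cdot>\<^sub>m (c \<cdot>\<^sub>m (A ^\<^sub>m n * A)) = c ^ Suc n \<cdot>\<^sub>m A ^\<^sub>m Suc n"
    by (rule eq_matI) auto
  finally show ?case .
qed (use A in \<open>auto intro!: eq_matI\<close>)

text \<open>
  Dividing \<open>A\<close> by a number \<open>r\<close> strictly between its spectral radius and \<open>1\<close> keeps the spectral radius below
  \<open>1\<close>, and then the Jordan normal form bounds all powers.
\<close>

lemma matrix_power_decay:
  assumes A: "A \<in> carrier_mat d d" and sp: "spectrum A \<subseteq> \<DD>"
  obtains c r where "0 \<le> c" "0 < r" "r < 1"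
    "\<And>n i j. i < d \<Longrightarrow> j < d \<Longrightarrow> cmod ((A ^\<^sub>m n) $$ (i, j)) \<le> c * r ^ n"
proof (cases "d = 0")
  case True
  then show ?thesis by (intro that[of 0 "1/2"]) auto
next
  case False
  then have d: "d > 0" by simp
  define s where "s = spectral_radius A"
  have s: "0 \<le> s" "s < 1"
    using spectral_radius_mem_max(1)[OF A d] sp by (auto simp: s_def)
  define r where "r = (s + 1) / 2"
  have r: "0 < r" "r < 1" "s < r" using s by (auto simp: r_def)
  define B where "B = complex_of_real (1 / r) \<cdot>\<^sub>m A"
  have B: "B \<in> carrier_mat d d" using A by (simp add: B_def)
  have "spectral_radius B \<in> norm ` spectrum B" by (rule spectral_radius_mem_max(1)[OF B d])
  then obtain k where k: "eigenvalue B k" "spectral_radius B = cmod k" by (auto simp: spectrum_def)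
  then obtain v where v: "v \<in> carrier_vec d" "v \<noteq> 0\<^sub>v d" "B *\<^sub>v v = k \<cdot>\<^sub>v v"
    using B by (auto simp: eigenvalue_def eigenvector_def)
  have "A = of_real r \<cdot>\<^sub>m B" using r by (intro eq_matI) (auto simp: B_def)
  moreover have "(of_real r \<cdot>\<^sub>m B) *\<^sub>v v = of_real r \<cdot>\<^sub>v (B *\<^sub>v v)"
    using B v(1) by (intro eq_vecI) (auto simp: scalar_prod_def sum_distrib_left mult_ac)
  ultimately have "A *\<^sub>v v = of_real r \<cdot>\<^sub>v (B *\<^sub>v v)" by simp
  then have "eigenvector A v (of_real r * k)" using v A by (simp add: eigenvector_def smult_smult_assoc)
  then have "of_real r * k \<in> spectrum A" by (auto simp: spectrum_def eigenvalue_def)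
  then have "cmod (of_real r * k) \<le> s"
    unfolding s_def by (intro spectral_radius_mem_max(2)[OF A d] imageI)
  then have "r * cmod k \<le> s" using r by (simp add: norm_mult)
  then have "r * cmod k < r * 1" using r by linarith
  then have "spectral_radius B < 1" using r k(2) by simp
  moreover obtain as where "char_poly B = (\<Prod>a\<leftarrow>as. [:- a, 1:])" using char_poly_factorized[OF B] by blast
  ultimately obtain c where c: "\<And>n. norm_bound (B ^\<^sub>m n) c"
    using spectral_radius_jnf_norm_bound_less_1[OF B] jordan_nf_exists[OF B] by blast
  have dims: "dim_row (B ^\<^sub>m n) = d" "dim_col (B ^\<^sub>m n) = d" for n
    using pow_carrier_mat[OF B, of n] by (blast dest: carrier_matD)+
  have c': "cmod ((B ^\<^sub>m n) $$ (i, j)) \<le> c" if "i < d" "j < d" for n i j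
    using c[of n] that unfolding norm_bound_def dims by blast
  have c0: "0 \<le> c" using c'[OF d d, of 0] norm_ge_zero order_trans by blast
  show ?thesis
  proof (rule that[OF c0 r(1,2)])
    fix n i j assume ij: "i < d" "j < d"
    have "A ^\<^sub>m n = of_real r ^ n \<cdot>\<^sub>m B ^\<^sub>m n"
      using smult_pow_mat[OF B] \<open>A = of_real r \<cdot>\<^sub>m B\<close> by simp
    then have "(A ^\<^sub>m n) $$ (i, j) = of_real r ^ n * (B ^\<^sub>m n) $$ (i, j)"
      using ij by (simp only: index_smult_mat(1) dims)
    then show "cmod ((A ^\<^sub>m n) $$ (i, j)) \<le> c * r ^ n"
      using c'[OF ij, of n] r by (simp add: norm_mult norm_power mult.commute mult_right_mono)
  qed
qed

locale matrix_in_disc =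
  fixes d :: nat and A :: "complex mat"
  assumes A: "A \<in> carrier_mat d d" and sp: "spectrum A \<subseteq> \<DD>"
begin

lemma pow_carrier: "A ^\<^sub>m n \<in> carrier_mat d d"
  by (rule pow_carrier_mat[OF A])

lemma index_mat_mult:
  "B \<in> carrier_mat d d \<Longrightarrow> C \<in> carrier_mat d d \<Longrightarrow> i < d \<Longrightarrow> j < d
    \<Longrightarrow> (B * C) $$ (i, j) = (\<Sum>k<d. B $$ (i, k) * C $$ (k, j))" for B C :: "complex mat"
  by (simp add: scalar_prod_def atLeast0LessThan)

text \<open>
  The margin \<open>R > 1\<close> makes \<open>\<Sum>n. a\<^sub>n x\<^sup>n A\<^sup>n\<close> continuous in \<open>x\<close> at \<open>x = 1\<close>; this is how \<open>f(r A)\<close> is compared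
  with \<open>f(A)\<close>.
\<close>

lemma fun_of_mat_abs_summable:
  assumes f: "f holomorphic_on \<DD>" and ij: "i < d" "j < d"
  shows "\<exists>R>1. summable (\<lambda>n. norm (taylor_coeff f n * (A ^\<^sub>m n) $$ (i, j) * of_real R ^ n))"
proof -
  obtain c r where c: "0 \<le> c" "0 < r" "r < 1"
    "\<And>n i j. i < d \<Longrightarrow> j < d \<Longrightarrow> cmod ((A ^\<^sub>m n) $$ (i, j)) \<le> c * r ^ n"
    using matrix_power_decay[OF A sp] by blast
  define R where "R = 2 / (1 + r)"
  have R: "R > 1" "r * R < 1" "0 \<le> r * R" using c by (auto simp: R_def field_simps)
  have "summable (\<lambda>n. norm (taylor_coeff f n * (A ^\<^sub>m n) $$ (i, j) * of_real R ^ n))"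
  proof (rule summable_comparison_test')
    show "summable (\<lambda>n. c * (cmod (taylor_coeff f n) * (r * R) ^ n))"
      by (intro summable_mult taylor_abs_summable f R)
    fix n
    have "cmod (taylor_coeff f n) * (cmod ((A ^\<^sub>m n) $$ (i, j)) * R ^ n)
        \<le> cmod (taylor_coeff f n) * ((c * r ^ n) * R ^ n)"
      using R by (intro mult_left_mono mult_right_mono c(4) ij) auto
    then show "norm (norm (taylor_coeff f n * (A ^\<^sub>m n) $$ (i, j) * of_real R ^ n))
        \<le> c * (cmod (taylor_coeff f n) * (r * R) ^ n)"
      using R by (simp add: norm_mult norm_power power_mult_distrib mult_ac)
  qed
  with R show ?thesis by blast
qed

lemma fun_of_mat_sums:
  assumes f: "f holomorphic_on \<DD>" and ij: "i < d" "j < d"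
  shows "(\<lambda>n. taylor_coeff f n * (A ^\<^sub>m n) $$ (i, j)) sums fun_of_mat d f A $$ (i, j)"
proof -
  obtain R where R: "R > 1" "summable (\<lambda>n. norm (taylor_coeff f n * (A ^\<^sub>m n) $$ (i, j) * of_real R ^ n))"
    using fun_of_mat_abs_summable[OF f ij] by blast
  have "summable (\<lambda>n. (taylor_coeff f n * (A ^\<^sub>m n) $$ (i, j)) * 1 ^ n)"
    by (rule powser_inside[OF summable_norm_cancel[OF R(2)]]) (use R in simp)
  then show ?thesis using ij by (simp add: fun_of_mat_def summable_sums)
qed

lemma fun_of_mat_carrier: "fun_of_mat d f A \<in> carrier_mat d d"
  by (simp add: fun_of_mat_def)

lemma fun_of_mat_cong:
  assumes "f holomorphic_on \<DD>" "\<And>w. w \<in> \<DD> \<Longrightarrow> f w = g w"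
  shows "fun_of_mat d g A = fun_of_mat d f A"
  using taylor_coeff_cong[OF assms] by (simp add: fun_of_mat_def)

lemma fun_of_mat_add:
  assumes f: "f holomorphic_on \<DD>" and g: "g holomorphic_on \<DD>" and ij: "i < d" "j < d"
  shows "fun_of_mat d (\<lambda>w. f w + g w) A $$ (i, j) = fun_of_mat d f A $$ (i, j) + fun_of_mat d g A $$ (i, j)"
  using fun_of_mat_sums[OF holomorphic_on_add[OF f g] ij]
    sums_add[OF fun_of_mat_sums[OF f ij] fun_of_mat_sums[OF g ij]]
  by (simp add: taylor_coeff_add[OF f g] distrib_right sums_unique2)

lemma fun_of_mat_cmult:
  assumes f: "f holomorphic_on \<DD>" and ij: "i < d" "j < d"
  shows "fun_of_mat d (\<lambda>w. c * f w) A $$ (i, j) = c * fun_of_mat d f A $$ (i, j)"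
proof -
  have "(\<lambda>w. c * f w) holomorphic_on \<DD>" by (intro holomorphic_intros f)
  from fun_of_mat_sums[OF this ij] show ?thesis
    using sums_mult[OF fun_of_mat_sums[OF f ij], of c]
    by (simp add: taylor_coeff_cmult[OF f] mult.assoc sums_unique2)
qed

lemma fun_of_mat_one:
  assumes ij: "i < d" "j < d"
  shows "fun_of_mat d (\<lambda>w. 1) A $$ (i, j) = (if i = j then 1 else 0)"
proof -
  have tc: "taylor_coeff (\<lambda>w. 1) n = (if n = 0 then 1 else 0)" for n
  proof (rule taylor_coeff_unique)
    show "(\<lambda>n. (if n = 0 then 1 else 0) * z ^ n) sums 1" for z :: complex
      using sums_If_finite_set[of "{0}" "\<lambda>n. z ^ n"] by (simp add: if_distrib[where f = "\<lambda>t. t * _"] cong: if_cong)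
  qed
  have "(\<lambda>n. taylor_coeff (\<lambda>w. 1) n * (A ^\<^sub>m n) $$ (i, j)) sums (if i = j then 1 else 0)"
    using sums_If_finite_set[of "{0}" "\<lambda>n. (A ^\<^sub>m n) $$ (i, j)"] A ij
    by (simp add: tc if_distrib[where f = "\<lambda>t. t * _"] cong: if_cong)
  then show ?thesis using fun_of_mat_sums[OF holomorphic_on_const[of 1] ij] sums_unique2 by blast
qed

lemma fun_of_mat_mult_left:
  assumes f: "f holomorphic_on \<DD>" and B: "B \<in> carrier_mat d d" and ij: "i < d" "j < d"
  shows "(\<lambda>n. taylor_coeff f n * (B * A ^\<^sub>m n) $$ (i, j)) sums (B * fun_of_mat d f A) $$ (i, j)"
proof -
  have "(\<lambda>n. \<Sum>k<d. B $$ (i, k) * (taylor_coeff f n * (A ^\<^sub>m n) $$ (k, j)))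
      sums (\<Sum>k<d. B $$ (i, k) * fun_of_mat d f A $$ (k, j))"
    using ij by (intro sums_sum sums_mult fun_of_mat_sums f) auto
  moreover have "(\<Sum>k<d. B $$ (i, k) * (taylor_coeff f n * (A ^\<^sub>m n) $$ (k, j)))
      = taylor_coeff f n * (B * A ^\<^sub>m n) $$ (i, j)" for n
    unfolding index_mat_mult[OF B pow_carrier ij] sum_distrib_left
    by (rule sum.cong[OF refl]) (rule mult.left_commute)
  ultimately show ?thesis unfolding index_mat_mult[OF B fun_of_mat_carrier ij] by simp
qed

lemma fun_of_mat_mult_right:
  assumes f: "f holomorphic_on \<DD>" and B: "B \<in> carrier_mat d d" and ij: "i < d" "j < d"
  shows "(\<lambda>n. taylor_coeff f n * (A ^\<^sub>m n * B) $$ (i, j)) sums (fun_of_mat d f A * B) $$ (i, j)"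
proof -
  have "(\<lambda>n. \<Sum>k<d. (taylor_coeff f n * (A ^\<^sub>m n) $$ (i, k)) * B $$ (k, j))
      sums (\<Sum>k<d. fun_of_mat d f A $$ (i, k) * B $$ (k, j))"
    using ij by (intro sums_sum sums_mult2 fun_of_mat_sums f) auto
  moreover have "(\<Sum>k<d. (taylor_coeff f n * (A ^\<^sub>m n) $$ (i, k)) * B $$ (k, j))
      = taylor_coeff f n * (A ^\<^sub>m n * B) $$ (i, j)" for n
    unfolding index_mat_mult[OF pow_carrier B ij] sum_distrib_left
    by (rule sum.cong[OF refl]) (rule mult.assoc)
  ultimately show ?thesis unfolding index_mat_mult[OF fun_of_mat_carrier B ij] by simp
qed

lemma fun_of_mat_commute:
  assumes f: "f holomorphic_on \<DD>" and B: "B \<in> carrier_mat d d" and comm: "A * B = B * A"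
  shows "fun_of_mat d f A * B = B * fun_of_mat d f A"
proof (rule eq_matI)
  have pw: "A ^\<^sub>m n * B = B * A ^\<^sub>m n" for n
  proof (induction n)
    case (Suc n)
    have "A ^\<^sub>m Suc n * B = A ^\<^sub>m n * (B * A)"
      using assoc_mult_mat[OF pow_carrier A B] by (simp add: comm)
    also have "\<dots> = (A ^\<^sub>m n * B) * A" by (rule assoc_mult_mat[OF pow_carrier B A, symmetric])
    also have "\<dots> = B * (A ^\<^sub>m n * A)" unfolding Suc by (rule assoc_mult_mat[OF B pow_carrier A])
    finally show ?case by simp
  qed (use A B in simp)
  fix i j assume "i < dim_row (B * fun_of_mat d f A)" "j < dim_col (B * fun_of_mat d f A)"
  then have ij: "i < d" "j < d" using B fun_of_mat_carrier[of f] by auto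
  show "(fun_of_mat d f A * B) $$ (i, j) = (B * fun_of_mat d f A) $$ (i, j)"
    by (rule sums_unique2[OF fun_of_mat_mult_right[OF f B ij, unfolded pw] fun_of_mat_mult_left[OF f B ij]])
qed (use B fun_of_mat_carrier[of f] in auto)

lemma fun_of_mat_times_id:
  assumes f: "f holomorphic_on \<DD>" and ij: "i < d" "j < d"
  shows "fun_of_mat d (\<lambda>w. w * f w) A $$ (i, j) = (A * fun_of_mat d f A) $$ (i, j)"
proof -
  have hol: "(\<lambda>w. w * f w) holomorphic_on \<DD>" by (intro holomorphic_intros f)
  have tc: "taylor_coeff (\<lambda>w. w * f w) n = (case n of 0 \<Rightarrow> 0 | Suc k \<Rightarrow> taylor_coeff f k)" for n
  proof (rule taylor_coeff_unique)
    fix z :: complex assume "z \<in> \<DD>"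
    from sums_mult[OF taylor_sums[OF f this], of z]
    have "(\<lambda>n. (case Suc n of 0 \<Rightarrow> 0 | Suc k \<Rightarrow> taylor_coeff f k) * z ^ Suc n) sums (z * f z)"
      by (simp add: mult_ac)
    then show "(\<lambda>n. (case n of 0 \<Rightarrow> 0 | Suc k \<Rightarrow> taylor_coeff f k) * z ^ n) sums (z * f z)"
      by (subst (asm) sums_Suc_iff) simp
  qed
  have "(\<lambda>n. taylor_coeff (\<lambda>w. w * f w) (Suc n) * (A ^\<^sub>m Suc n) $$ (i, j)) sums (A * fun_of_mat d f A) $$ (i, j)"
    using fun_of_mat_mult_left[OF f A ij] unfolding pow_mat_Suc_left[OF A] by (simp add: tc)
  then have "(\<lambda>n. taylor_coeff (\<lambda>w. w * f w) n * (A ^\<^sub>m n) $$ (i, j)) sums (A * fun_of_mat d f A) $$ (i, j)"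
    by (subst (asm) sums_Suc_iff) (simp add: tc)
  then show ?thesis using fun_of_mat_sums[OF hol ij] sums_unique2 by blast
qed

lemma fun_of_mat_left_eigenvector:
  assumes f: "f holomorphic_on \<DD>" and \<mu>: "\<mu> \<in> \<DD>" and j: "j < d"
    and ev: "\<And>j. j < d \<Longrightarrow> (\<Sum>i<d. u i * A $$ (i, j)) = \<mu> * u j"
  shows "(\<Sum>i<d. u i * fun_of_mat d f A $$ (i, j)) = f \<mu> * u j"
proof -
  have pw: "(\<Sum>i<d. u i * (A ^\<^sub>m n) $$ (i, j)) = \<mu> ^ n * u j" if "j < d" for n j
    using that
  proof (induction n arbitrary: j)
    case 0
    have "(\<Sum>i<d. u i * (A ^\<^sub>m 0) $$ (i, j)) = (\<Sum>i<d. if i = j then u i else 0)"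
      using A 0 by (intro sum.cong refl) auto
    then show ?case using 0 by simp
  next
    case (Suc n)
    have "(\<Sum>i<d. u i * (A ^\<^sub>m Suc n) $$ (i, j)) = (\<Sum>i<d. \<Sum>k<d. u i * A $$ (i, k) * (A ^\<^sub>m n) $$ (k, j))"
      unfolding pow_mat_Suc_left[OF A] using Suc.prems
      by (intro sum.cong refl) (simp add: index_mat_mult[OF A pow_carrier] sum_distrib_left mult.assoc)
    also have "\<dots> = (\<Sum>k<d. (\<Sum>i<d. u i * A $$ (i, k)) * (A ^\<^sub>m n) $$ (k, j))"
      by (subst sum.swap) (simp add: sum_distrib_right)
    also have "\<dots> = (\<Sum>k<d. \<mu> * (u k * (A ^\<^sub>m n) $$ (k, j)))"
      by (intro sum.cong refl) (simp add: ev mult.assoc)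
    also have "\<dots> = \<mu> ^ Suc n * u j" using Suc by (simp flip: sum_distrib_left)
    finally show ?case .
  qed
  have "(\<lambda>n. \<Sum>i<d. u i * (taylor_coeff f n * (A ^\<^sub>m n) $$ (i, j)))
      sums (\<Sum>i<d. u i * fun_of_mat d f A $$ (i, j))"
    using j by (intro sums_sum sums_mult fun_of_mat_sums f) auto
  moreover have "(\<Sum>i<d. u i * (taylor_coeff f n * (A ^\<^sub>m n) $$ (i, j))) = taylor_coeff f n * \<mu> ^ n * u j" for n
  proof -
    have "(\<Sum>i<d. u i * (taylor_coeff f n * (A ^\<^sub>m n) $$ (i, j))) = taylor_coeff f n * (\<Sum>i<d. u i * (A ^\<^sub>m n) $$ (i, j))"
      unfolding sum_distrib_left by (rule sum.cong[OF refl]) (rule mult.left_commute)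
    then show ?thesis unfolding pw[OF j] by (simp only: mult.assoc)
  qed
  moreover have "(\<lambda>n. taylor_coeff f n * \<mu> ^ n * u j) sums (f \<mu> * u j)"
    by (intro sums_mult2 taylor_sums f \<mu>)
  ultimately show ?thesis by (simp only:) (rule sums_unique2)
qed

text \<open>
  Comparing coefficients in \<open>adj(X - A) (X - A) = \<chi>(X)\<close> and multiplying the \<open>n\<close>-th one by \<open>A\<^sup>n\<close> gives a
  telescoping sum.
\<close>

lemma Cayley_Hamilton_sums:
  assumes ij: "i < d" "j < d"
  shows "(\<lambda>n. coeff (char_poly A) n * (A ^\<^sub>m n) $$ (i, j)) sums 0"
proof -
  let ?N = "char_poly_matrix A"
  let ?Q = "adj_mat ?N"
  have N: "?N \<in> carrier_mat d d" using A by simp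
  have Q: "?Q \<in> carrier_mat d d" by (rule adj_mat(1)[OF N])
  have entry: "[:0, 1:] * ?Q $$ (i, k) - (\<Sum>l<d. Polynomial.smult (A $$ (l, k)) (?Q $$ (i, l))) = (if i = k then char_poly A else 0)"
    if k: "k < d" for k
  proof -
    have "(?Q * ?N) $$ (i, k) = (\<Sum>l<d. ?Q $$ (i, l) * ?N $$ (l, k))"
      using Q N ij k by (simp add: scalar_prod_def atLeast0LessThan)
    also have "\<dots> = (\<Sum>l<d. (if l = k then [:0, 1:] * ?Q $$ (i, l) else 0) - Polynomial.smult (A $$ (l, k)) (?Q $$ (i, l)))"
      using A k by (intro sum.cong refl) (auto simp: char_poly_matrix_def algebra_simps)
    also have "\<dots> = [:0, 1:] * ?Q $$ (i, k) - (\<Sum>l<d. Polynomial.smult (A $$ (l, k)) (?Q $$ (i, l)))"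
      using k by (simp add: sum_subtractf)
    also have "(?Q * ?N) $$ (i, k) = (if i = k then char_poly A else 0)"
      unfolding adj_mat(3)[OF N] using ij k by (simp add: char_poly_def)
    finally show ?thesis by (rule sym)
  qed
  define b where "b n = (\<Sum>k<d. coeff (?Q $$ (i, k)) n * (A ^\<^sub>m Suc n) $$ (k, j))" for n
  have step: "coeff (char_poly A) n * (A ^\<^sub>m n) $$ (i, j) = (case n of 0 \<Rightarrow> 0 | Suc m \<Rightarrow> b m) - b n" for n
  proof -
    have "(\<Sum>k<d. coeff (if i = k then char_poly A else 0) n * (A ^\<^sub>m n) $$ (k, j))
        = (\<Sum>k<d. if k = i then coeff (char_poly A) n * (A ^\<^sub>m n) $$ (k, j) else 0)"
      by (intro sum.cong refl) auto
    then have "coeff (char_poly A) n * (A ^\<^sub>m n) $$ (i, j)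
        = (\<Sum>k<d. coeff (if i = k then char_poly A else 0) n * (A ^\<^sub>m n) $$ (k, j))"
      using ij by simp
    also have "\<dots> = (\<Sum>k<d. (coeff ([:0, 1:] * ?Q $$ (i, k)) n
        - (\<Sum>l<d. A $$ (l, k) * coeff (?Q $$ (i, l)) n)) * (A ^\<^sub>m n) $$ (k, j))"
      by (intro sum.cong refl) (simp add: entry[symmetric] coeff_sum del: mult_pCons_left)
    also have "\<dots> = (\<Sum>k<d. coeff ([:0, 1:] * ?Q $$ (i, k)) n * (A ^\<^sub>m n) $$ (k, j))
        - (\<Sum>k<d. \<Sum>l<d. coeff (?Q $$ (i, l)) n * (A $$ (l, k) * (A ^\<^sub>m n) $$ (k, j)))"
    proof -
      have "(c - (\<Sum>l<d. A $$ (l, k) * q l)) * p = c * p - (\<Sum>l<d. q l * (A $$ (l, k) * p))" for c p q k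
        by (simp only: left_diff_distrib sum_distrib_right mult.assoc mult.left_commute)
      then show ?thesis by (simp only: sum_subtractf)
    qed
    also have "(\<Sum>k<d. \<Sum>l<d. coeff (?Q $$ (i, l)) n * (A $$ (l, k) * (A ^\<^sub>m n) $$ (k, j)))
        = (\<Sum>l<d. coeff (?Q $$ (i, l)) n * (\<Sum>k<d. A $$ (l, k) * (A ^\<^sub>m n) $$ (k, j)))"
      by (subst sum.swap) (simp add: sum_distrib_left)
    also have "\<dots> = b n"
      unfolding b_def pow_mat_Suc_left[OF A] using ij
      by (intro sum.cong refl) (simp add: index_mat_mult[OF A pow_carrier])
    also have "(\<Sum>k<d. coeff ([:0, 1:] * ?Q $$ (i, k)) n * (A ^\<^sub>m n) $$ (k, j)) = (case n of 0 \<Rightarrow> 0 | Suc m \<Rightarrow> b m)"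
      by (cases n) (simp_all add: b_def coeff_pCons)
    finally show ?thesis .
  qed
  have partial: "(\<Sum>n<Suc M. coeff (char_poly A) n * (A ^\<^sub>m n) $$ (i, j)) = - b M" for M
    unfolding step by (induction M) simp_all
  have "b M = 0" if "M > Max (insert 0 ((\<lambda>k. degree (?Q $$ (i, k))) ` {..<d}))" for M
    unfolding b_def using that by (intro sum.neutral) (auto intro!: coeff_eq_0)
  then have "\<forall>\<^sub>F M in sequentially. b M = 0"
    by (rule eventually_mono[OF eventually_gt_at_top])
  then have "\<forall>\<^sub>F M in sequentially. - b M = 0" by (rule eventually_mono) simp
  then have "(\<lambda>M. - b M) \<longlonglongrightarrow> 0" by (rule tendsto_eventually)
  then show ?thesis unfolding sums_def partial[symmetric] by (rule LIMSEQ_imp_Suc)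
qed

lemma taylor_coeff_poly: "taylor_coeff (poly p) n = coeff p n"
proof (rule taylor_coeff_unique)
  show "(\<lambda>n. coeff p n * z ^ n) sums poly p z" for z
    unfolding poly_altdef by (rule sums_finite) (auto simp: coeff_eq_0 not_le)
qed

lemma Cayley_Hamilton:
  assumes ij: "i < d" "j < d"
  shows "fun_of_mat d (poly (char_poly A)) A $$ (i, j) = 0"
  using Cayley_Hamilton_sums[OF ij] ij by (simp add: fun_of_mat_def taylor_coeff_poly sums_iff)

end

section \<open>The functional calculus of the model\<close>

text \<open>
  The coefficient of \<open>w\<^sup>n\<^sup>+\<^sup>1\<close> in \<open>f\<close> is the coefficient of \<open>w\<^sup>n\<close> in the difference quotient
  \<open>(f(z, w) - f(z, 0)) / w\<close>, which is again bounded and holomorphic on the bidisc.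
\<close>

lemma Hinf2_taylor_coeff:
  assumes "f \<in> Hinf2"
  shows "(\<lambda>z. taylor_coeff (\<lambda>w. f (z, w)) n) holomorphic_on \<DD>"
  using assms
proof (induction n arbitrary: f)
  case 0
  have "(\<lambda>z. f (z, 0)) holomorphic_on \<DD>" by (rule Hinf2D(1)[OF 0]) simp
  moreover have "taylor_coeff g 0 = g 0" for g by (simp add: taylor_coeff_def)
  ultimately show ?case by simp
next
  case (Suc n)
  obtain g where g: "g \<in> Hinf2" "\<And>z w. z \<in> \<DD> \<Longrightarrow> w \<in> \<DD> \<Longrightarrow> f (z, w) = f (z, 0) + (w - 0) * g (z, w)"
    using Hinf2_quotient_snd[OF Suc.prems, of 0] by auto
  have "taylor_coeff (\<lambda>w. f (z, w)) (Suc n) = taylor_coeff (\<lambda>w. g (z, w)) n" if z: "z \<in> \<DD>" for z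
  proof -
    let ?c = "\<lambda>n. case n of 0 \<Rightarrow> f (z, 0) | Suc k \<Rightarrow> taylor_coeff (\<lambda>w. g (z, w)) k"
    have "taylor_coeff (\<lambda>w. f (z, w)) (Suc n) = ?c (Suc n)"
    proof (rule taylor_coeff_unique)
      fix w :: complex assume w: "w \<in> \<DD>"
      have "(\<lambda>n. ?c (Suc n) * w ^ Suc n) sums (w * g (z, w))"
        using sums_mult[OF taylor_sums[OF Hinf2D(2)[OF g(1) z] w], of w] by (simp add: mult_ac)
      then have "(\<lambda>n. ?c n * w ^ n) sums (w * g (z, w) + ?c 0 * w ^ 0)"
        by (subst (asm) sums_Suc_iff) simp
      then show "(\<lambda>n. ?c n * w ^ n) sums f (z, w)" using g(2)[OF z w] by (simp add: add.commute)
    qed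
    then show ?thesis by simp
  qed
  then show ?case by (intro holomorphic_transform[OF Suc.IH[OF g(1)]]) simp
qed

lemma taylor_coeff_bound:
  assumes f: "f holomorphic_on \<DD>" and C: "\<And>z. z \<in> \<DD> \<Longrightarrow> cmod (f z) \<le> C"
  shows "cmod (taylor_coeff f n) \<le> C"
proof (rule power2_le_imp_le)
  (* f is the product of f with the constant function 1 *)
  have s: "(\<Sum>m\<le>k. taylor_coeff f m * (if k - m = 0 then 1 else 0)) = taylor_coeff f k" for k
  proof -
    have "(\<Sum>m\<le>k. taylor_coeff f m * (if k - m = 0 then 1 else 0)) = (\<Sum>m\<le>k. if m = k then taylor_coeff f m else 0)"
      by (intro sum.cong refl) auto
    then show ?thesis by simp
  qed
  have "(cmod (taylor_coeff f n))\<^sup>2 \<le> (\<Sum>k<Suc n. (cmod (taylor_coeff f k))\<^sup>2)"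
    by (rule member_le_sum) auto
  also have "\<dots> \<le> C\<^sup>2 * (\<Sum>k<Suc n. (cmod (if k = 0 then 1 else 0))\<^sup>2)"
    using multiplier_coeff_bound[OF f C, of "\<lambda>k. if k = 0 then 1 else 0" "Suc n"] unfolding s .
  also have "(\<Sum>k<Suc n. (cmod (if k = 0 then 1 else 0))\<^sup>2) = (\<Sum>k<Suc n. if k = 0 then 1 else 0 :: real)"
    by (intro sum.cong refl) auto
  also have "\<dots> = 1" by simp
  finally show "(cmod (taylor_coeff f n))\<^sup>2 \<le> C\<^sup>2" by simp
  have "cmod (f 0) \<le> C" by (rule C) simp
  then show "0 \<le> C" using norm_ge_zero[of "f 0"] by linarith
qed

text \<open>
  For \<open>r < 1\<close> the series of \<open>f(z, r \<Psi>(z))\<close> converges uniformly in \<open>z\<close>, because the powers of \<open>\<Psi>(z)\<close> are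
  contractions; its entries are therefore holomorphic, and by von Neumann's inequality they are bounded
  by the supremum of \<open>f\<close>.  As \<open>r\<close> tends to \<open>1\<close> they converge pointwise to the entries of
  \<open>f(z, \<Psi>(z))\<close>.  Convergence is not uniform, but Montel's theorem still makes the limit holomorphic.
\<close>

lemma model_symbol_Hinf:
  assumes \<Psi>: "rational_pure_inner d \<Psi>" and f: "f \<in> Hinf2"
  shows "(\<lambda>z. fun_of_mat d (\<lambda>w. f (z, w)) (\<Psi> z)) \<in> Hinf_mat d"
proof -
  have inner: "inner_fun d \<Psi>" and Hm: "\<Psi> \<in> Hinf_mat d" and sp: "\<And>z. z \<in> \<DD> \<Longrightarrow> spectrum (\<Psi> z) \<subseteq> \<DD>"
    using \<Psi> by (auto simp: rational_pure_inner_def inner_fun_def)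
  have disc: "matrix_in_disc d (\<Psi> z)" if "z \<in> \<DD>" for z
    by unfold_locales (use Hinf_matD(1)[OF Hm that] sp[OF that] in auto)
  obtain C where C0: "C \<ge> 0" and C: "\<And>z w. z \<in> \<DD> \<Longrightarrow> w \<in> \<DD> \<Longrightarrow> cmod (f (z, w)) \<le> C"
    using Hinf2D(3)[OF f] by blast
  define a where "a n z = taylor_coeff (\<lambda>w. f (z, w)) n" for n z
  note fz = Hinf2D(2)[OF f]
  have a_hol: "a n holomorphic_on \<DD>" for n unfolding a_def by (rule Hinf2_taylor_coeff[OF f])
  have a_bd: "cmod (a n z) \<le> C" if "z \<in> \<DD>" for n z
    unfolding a_def by (rule taylor_coeff_bound[OF fz[OF that] C[OF that]])
  define P where "P n i j z = (\<Psi> z ^\<^sub>m n) $$ (i, j)" for n i j z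
  have P_hol: "P n i j holomorphic_on \<DD>" if "i < d" "j < d" for n i j
    using that
  proof (induction n arbitrary: i j)
    case 0
    have "P 0 i j z = (if i = j then 1 else 0)" if "z \<in> \<DD>" for z
      using Hinf_matD(1)[OF Hm that] 0 by (simp add: P_def)
    then show ?case by (intro holomorphic_transform[OF holomorphic_on_const[of "if i = j then 1 else 0"]]) simp
  next
    case (Suc n)
    have eq: "P (Suc n) i j z = (\<Sum>k<d. \<Psi> z $$ (i, k) * P n k j z)" if z: "z \<in> \<DD>" for z
      unfolding P_def pow_mat_Suc_left[OF Hinf_matD(1)[OF Hm z]]
      by (rule matrix_in_disc.index_mat_mult[OF disc[OF z] Hinf_matD(1)[OF Hm z]
            matrix_in_disc.pow_carrier[OF disc[OF z]] Suc.prems])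
    have "(\<lambda>z. \<Sum>k<d. \<Psi> z $$ (i, k) * P n k j z) holomorphic_on \<DD>"
      using Suc.prems by (intro holomorphic_intros Hinf_matD(2)[OF Hm] Suc.IH) auto
    then show ?case by (rule holomorphic_transform) (simp only: eq)
  qed
  have P_matvec: "P n i j z = matvec d (\<Psi> z ^\<^sub>m n) (\<lambda>k. if k = j then 1 else 0) i" if "j < d" for n i j z
  proof -
    have "matvec d (\<Psi> z ^\<^sub>m n) (\<lambda>k. if k = j then 1 else 0) i = (\<Sum>k<d. if k = j then (\<Psi> z ^\<^sub>m n) $$ (i, k) else 0)"
      unfolding matvec_def by (intro sum.cong refl) simp
    then show ?thesis using that by (simp add: P_def)
  qed
  have e1: "sqnorm d (\<lambda>k. if k = j then 1 else 0) = 1" if "j < d" for j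
  proof -
    have "sqnorm d (\<lambda>k. if k = j then 1 else 0) = (\<Sum>k<d. if k = j then 1 else 0)"
      unfolding sqnorm_def by (intro sum.cong refl) auto
    then show ?thesis using that by simp
  qed
  have coord: "cmod (x i) \<le> B" if "sqnorm d x \<le> B\<^sup>2" "i < d" "B \<ge> 0" for x i B
  proof (rule power2_le_imp_le)
    have "(cmod (x i))\<^sup>2 \<le> sqnorm d x" unfolding sqnorm_def using that by (intro member_le_sum) auto
    then show "(cmod (x i))\<^sup>2 \<le> B\<^sup>2" using that(1) by linarith
  qed (use that in simp)
  have P_bd: "cmod (P n i j z) \<le> 1" if "z \<in> \<DD>" "i < d" "j < d" for n i j z
    unfolding P_matvec[OF that(3)]
    using contraction_power[OF Hinf_matD(1)[OF Hm that(1)] inner_fun_contraction[OF inner that(1)],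
        of n "\<lambda>k. if k = j then 1 else 0"]
    by (intro coord) (simp_all add: that e1[OF that(3)])
  define F where "F r i j z = (\<Sum>n. a n z * of_real r ^ n * P n i j z)" for r i j z
  have F_bd: "cmod (F r i j z) \<le> C" if "0 \<le> r" "r < 1" "z \<in> \<DD>" "i < d" "j < d" for r i j z
  proof -
    have "sqnorm d (\<lambda>i. \<Sum>n. a n z * of_real r ^ n * matvec d (\<Psi> z ^\<^sub>m n) (\<lambda>k. if k = j then 1 else 0) i)
        \<le> C\<^sup>2 * sqnorm d (\<lambda>k. if k = j then 1 else 0)"
      unfolding a_def using that
      by (intro von_Neumann Hinf_matD(1)[OF Hm] inner_fun_contraction[OF inner] fz C) auto
    then have "sqnorm d (\<lambda>i. F r i j z) \<le> C\<^sup>2"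
      unfolding F_def P_matvec[OF that(5)] e1[OF that(5)] by simp
    then show ?thesis by (rule coord[OF _ that(4) C0])
  qed
  have F_hol: "F r i j holomorphic_on \<DD>" if r: "0 \<le> r" "r < 1" and ij: "i < d" "j < d" for r i j
  proof (rule holomorphic_uniform_sequence[OF open_ball])
    show "(\<lambda>z. \<Sum>n<N. a n z * of_real r ^ n * P n i j z) holomorphic_on \<DD>" for N
      by (intro holomorphic_intros a_hol P_hol ij)
    fix z assume "z \<in> \<DD>"
    then obtain e where e: "e > 0" "cball z e \<subseteq> \<DD>" using open_contains_cball open_ball by blast
    have "uniform_limit \<DD> (\<lambda>N z. \<Sum>n<N. a n z * of_real r ^ n * P n i j z) (F r i j) sequentially"
      unfolding F_def
    proof (rule Weierstrass_m_test)
      show "summable (\<lambda>n. C * r ^ n)" using r by (intro summable_mult summable_geometric) simp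
      show "norm (a n z * of_real r ^ n * P n i j z) \<le> C * r ^ n" if "z \<in> \<DD>" for n z
      proof -
        have "cmod (a n z) * r ^ n * cmod (P n i j z) \<le> C * r ^ n * 1"
          using that r C0 by (intro mult_mono a_bd P_bd ij) auto
        then show ?thesis using r by (simp add: norm_mult norm_power)
      qed
    qed
    then have "uniform_limit (cball z e) (\<lambda>N z. \<Sum>n<N. a n z * of_real r ^ n * P n i j z) (F r i j) sequentially"
      using uniform_limit_on_subset e(2) by blast
    with e show "\<exists>d. 0 < d \<and> cball z d \<subseteq> \<DD> \<and>
        uniform_limit (cball z d) (\<lambda>N z. \<Sum>n<N. a n z * of_real r ^ n * P n i j z) (F r i j) sequentially" by blast
  qed
  define r where "r k = 1 - 1 / real (k + 2)" for k
  have r: "0 \<le> r k" "r k < 1" for k by (simp_all add: r_def)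
  have r_lim: "r \<longlonglongrightarrow> 1" unfolding r_def by real_asymp
  let ?G = "\<lambda>i j z. fun_of_mat d (\<lambda>w. f (z, w)) (\<Psi> z) $$ (i, j)"
  have F_lim: "(\<lambda>k. F (r k) i j z) \<longlonglongrightarrow> ?G i j z" if z: "z \<in> \<DD>" and ij: "i < d" "j < d" for i j z
  proof -
    obtain R where R: "R > 1" "summable (\<lambda>n. norm (a n z * P n i j z * of_real R ^ n))"
      using matrix_in_disc.fun_of_mat_abs_summable[OF disc[OF z] fz[OF z] ij] unfolding a_def P_def by blast
    have "isCont (\<lambda>x. \<Sum>n. (a n z * P n i j z) * x ^ n) (1::complex)"
      by (rule isCont_powser[OF summable_norm_cancel[OF R(2)]]) (use R in simp)
    moreover have "(\<lambda>k. complex_of_real (r k)) \<longlonglongrightarrow> 1" using tendsto_of_real[OF r_lim] by simp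
    ultimately have "(\<lambda>k. \<Sum>n. (a n z * P n i j z) * of_real (r k) ^ n) \<longlonglongrightarrow> (\<Sum>n. (a n z * P n i j z) * 1 ^ n)"
      by (rule isCont_tendsto_compose)
    moreover have "(\<Sum>n. (a n z * P n i j z) * 1 ^ n) = ?G i j z"
      using ij by (simp add: a_def P_def fun_of_mat_def)
    moreover have "(\<Sum>n. (a n z * P n i j z) * of_real (r k) ^ n) = F (r k) i j z" for k
      unfolding F_def by (rule suminf_cong) simp
    ultimately show ?thesis by simp
  qed
  have G_hol: "?G i j holomorphic_on \<DD>" if ij: "i < d" "j < d" for i j
  proof -
    obtain g q where g: "g holomorphic_on \<DD>" "strict_mono (q :: nat \<Rightarrow> nat)"
        "\<And>x. x \<in> \<DD> \<Longrightarrow> ((\<lambda>n. F (r (q n)) i j x) \<longlongrightarrow> g x) sequentially"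
    proof (rule Montel[of \<DD> "{h. h holomorphic_on \<DD> \<and> (\<forall>z\<in>\<DD>. cmod (h z) \<le> C)}" "\<lambda>k. F (r k) i j"])
      show "\<exists>B. \<forall>h\<in>{h. h holomorphic_on \<DD> \<and> (\<forall>z\<in>\<DD>. cmod (h z) \<le> C)}. \<forall>z\<in>K. cmod (h z) \<le> B"
        if "K \<subseteq> \<DD>" for K using that by (intro exI[of _ C]) auto
      show "range (\<lambda>k. F (r k) i j) \<subseteq> {h. h holomorphic_on \<DD> \<and> (\<forall>z\<in>\<DD>. cmod (h z) \<le> C)}"
        by (intro image_subsetI CollectI conjI ballI F_hol[OF r ij]) (rule F_bd[OF r _ ij])
      fix g and q :: "nat \<Rightarrow> nat"
      assume "g holomorphic_on \<DD>" "strict_mono q" "\<And>x. x \<in> \<DD> \<Longrightarrow> ((\<lambda>n. F (r (q n)) i j x) \<longlongrightarrow> g x) sequentially"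
      then show thesis by (rule that)
    qed (rule open_ball, blast)
    have "g z = ?G i j z" if "z \<in> \<DD>" for z
      by (rule LIMSEQ_unique[OF g(3)[OF that] LIMSEQ_subseq_LIMSEQ[OF F_lim[OF that ij] g(2), unfolded o_def]])
    with g(1) show ?thesis by (rule holomorphic_transform)
  qed
  have G_bd: "cmod (?G i j z) \<le> C" if "z \<in> \<DD>" "i < d" "j < d" for i j z
  proof (rule LIMSEQ_le_const2[OF tendsto_norm[OF F_lim[OF that]]])
    show "\<exists>N. \<forall>n\<ge>N. norm (F (r n) i j z) \<le> C" by (intro exI allI impI F_bd[OF r that])
  qed
  show ?thesis
    unfolding Hinf_mat_def
  proof (intro CollectI conjI ballI allI impI exI[of _ C])
    show "fun_of_mat d (\<lambda>w. f (z, w)) (\<Psi> z) \<in> carrier_mat d d" if "z \<in> \<DD>" for z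
      by (rule matrix_in_disc.fun_of_mat_carrier[OF disc[OF that]])
  qed (rule G_hol G_bd; assumption)+
qed

section \<open>Compressions to the complement of an invariant set\<close>

text \<open>
  Writing \<open>a = A - l\<close> and \<open>b = B - m\<close>, the relation \<open>1 = a G + b E\<close> is a contracting homotopy of the Koszul
  complex: \<open>(x, y) \<mapsto> G x + E y\<close> inverts the first map on the kernel of the second one, and
  \<open>x \<mapsto> (- E x, G x)\<close> is a right inverse of the second one.
\<close>

lemma koszul_exact_if_unit:
  assumes hs: "complex_hilbert_space L"
    and lin: "linear_op L L A" "linear_op L L B" "linear_op L L G" "linear_op L L E"
    and AB: "\<And>x. x \<in> carrier L \<Longrightarrow> A (B x) = B (A x)"
    and AG: "\<And>x. x \<in> carrier L \<Longrightarrow> A (G x) = G (A x)"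
    and BG: "\<And>x. x \<in> carrier L \<Longrightarrow> B (G x) = G (B x)"
    and AE: "\<And>x. x \<in> carrier L \<Longrightarrow> A (E x) = E (A x)"
    and BE: "\<And>x. x \<in> carrier L \<Longrightarrow> B (E x) = E (B x)"
    and unit: "\<And>x. x \<in> carrier L \<Longrightarrow>
      x = (A (G x) - cscale L l (G x)) + (B (E x) - cscale L m (E x))"
  shows "koszul_exact L A B l m"
proof -
  interpret L: complex_hilbert_space L by fact
  define a where "a x = A x - cscale L l x" for x
  define b where "b x = B x - cscale L m x" for x
  note inn = L.add_in L.diff_in L.scale_in linear_opD(1)[OF lin(1)] linear_opD(1)[OF lin(2)]
    linear_opD(1)[OF lin(3)] linear_opD(1)[OF lin(4)]
  have diff: "T (x - y) = T x - T y" if "linear_op L L T" "x \<in> carrier L" "y \<in> carrier L" for T x y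
    using linear_opD(2)[OF that(1) L.diff_in[OF that(2,3)] that(3)] by (simp add: algebra_simps)
  have zero: "T 0 = 0" if "linear_op L L T" for T
    using diff[OF that, of 0 0] by simp
  have in_ab: "a x \<in> carrier L" "b x \<in> carrier L" if "x \<in> carrier L" for x
    using that by (simp_all add: a_def b_def inn)
  note lins = linear_opD(3)[OF lin(1)] linear_opD(3)[OF lin(2)] linear_opD(3)[OF lin(3)] linear_opD(3)[OF lin(4)]
    diff[OF lin(1)] diff[OF lin(2)] diff[OF lin(3)] diff[OF lin(4)]
  have aG: "G (a x) = a (G x)" and bG: "G (b x) = b (G x)" and aE: "E (a x) = a (E x)"
    and bE: "E (b x) = b (E x)" if "x \<in> carrier L" for x
    using that by (simp_all add: a_def b_def lins inn AG BG AE BE)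
  have ab: "a (b x) = b (a x)" if "x \<in> carrier L" for x
    using that by (simp add: a_def b_def lins inn AB L.scale_right_diff_distrib mult.commute)
  have unit': "x = a (G x) + b (E x)" if "x \<in> carrier L" for x
    using unit[OF that] by (simp add: a_def b_def)
  have a_add: "a (x + y) = a x + a y" if "x \<in> carrier L" "y \<in> carrier L" for x y
    using that by (simp add: a_def linear_opD(2)[OF lin(1)] L.scale_right_distrib)
  have b_add: "b (x + y) = b x + b y" if "x \<in> carrier L" "y \<in> carrier L" for x y
    using that by (simp add: b_def linear_opD(2)[OF lin(2)] L.scale_right_distrib)
  have a0: "a 0 = 0" and b0: "b 0 = 0" by (simp_all add: a_def b_def zero lin)
  have k0: "koszul0 L A B l m x = (a x, b x)" for x by (simp add: koszul0_def a_def b_def)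
  have k1: "koszul1 L A B l m (x, y) = a y - b x" for x y by (simp add: koszul1_def a_def b_def)
  have "{x \<in> carrier L. koszul0 L A B l m x = (0, 0)} = {0}"
  proof (intro equalityI subsetI)
    fix x assume "x \<in> {x \<in> carrier L. koszul0 L A B l m x = (0, 0)}"
    then have x: "x \<in> carrier L" "a x = 0" "b x = 0" by (auto simp: k0)
    have "a (G x) + b (E x) = 0"
      unfolding aG[OF x(1), symmetric] bE[OF x(1), symmetric] x(2,3) by (simp add: zero lin)
    then show "x \<in> {0}" using unit'[OF x(1)] by simp
  qed (simp add: k0 a0 b0)
  moreover have "koszul0 L A B l m ` carrier L = {p \<in> carrier L \<times> carrier L. koszul1 L A B l m p = 0}"
  proof (intro equalityI subsetI)
    fix p assume "p \<in> koszul0 L A B l m ` carrier L"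
    then show "p \<in> {p \<in> carrier L \<times> carrier L. koszul1 L A B l m p = 0}"
      by (auto simp: k0 k1 in_ab ab)
  next
    fix p assume "p \<in> {p \<in> carrier L \<times> carrier L. koszul1 L A B l m p = 0}"
    then obtain x y where p: "p = (x, y)" and x: "x \<in> carrier L" and y: "y \<in> carrier L" and eq: "a y = b x"
      by (auto simp: k1)
    let ?u = "G x + E y"
    have GE: "G z \<in> carrier L" "E z \<in> carrier L" if "z \<in> carrier L" for z
      using that linear_opD(1)[OF lin(3)] linear_opD(1)[OF lin(4)] by blast+
    have u: "?u \<in> carrier L" by (rule L.add_in[OF GE(1)[OF x] GE(2)[OF y]])
    have "a ?u = a (G x) + b (E x)"
      unfolding a_add[OF GE(1)[OF x] GE(2)[OF y]] aE[OF y, symmetric] eq bE[OF x] ..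
    moreover have "b ?u = a (G y) + b (E y)"
      unfolding b_add[OF GE(1)[OF x] GE(2)[OF y]] bG[OF x, symmetric] eq[symmetric] aG[OF y] ..
    ultimately have "koszul0 L A B l m ?u = p"
      unfolding k0 p using unit'[OF x] unit'[OF y] by simp
    then show "p \<in> koszul0 L A B l m ` carrier L" using u by blast
  qed
  moreover have "koszul1 L A B l m ` (carrier L \<times> carrier L) = carrier L"
  proof (intro equalityI subsetI)
    fix x assume x: "x \<in> carrier L"
    have GE: "G x \<in> carrier L" "E x \<in> carrier L"
      using x linear_opD(1)[OF lin(3)] linear_opD(1)[OF lin(4)] by blast+
    have mE: "0 - E x \<in> carrier L" by (rule L.diff_in[OF L.zero_in GE(2)])
    have "b (0 - E x) + b (E x) = 0"
      unfolding b_add[OF mE GE(2), symmetric] by (simp add: b0)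
    then have neg: "b (0 - E x) = - b (E x)" by (rule eq_neg_iff_add_eq_0[THEN iffD2])
    have "koszul1 L A B l m (0 - E x, G x) = a (G x) + b (E x)"
      unfolding k1 neg by simp
    then have "x = koszul1 L A B l m (0 - E x, G x)" unfolding unit'[OF x, symmetric] ..
    then show "x \<in> koszul1 L A B l m ` (carrier L \<times> carrier L)"
      using mE GE(1) by blast
  qed (auto simp: k1 in_ab inn)
  ultimately show ?thesis unfolding koszul_exact_def by blast
qed

locale orth_complement = complex_hilbert_space H for H :: "'a::ab_group_add inner_product_space" +
  fixes R :: "'a set"
  assumes R: "R \<subseteq> carrier H"
begin

definition K where "K = {k \<in> carrier H. \<forall>y\<in>R. cinner H y k = 0}"

definition P where "P = orth_proj H K"

lemma K_in: "k \<in> K \<Longrightarrow> k \<in> carrier H"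
  by (simp add: K_def)

lemma hilbert_K: "complex_hilbert_space (H\<lparr>carrier := K\<rparr>)"
  by (rule closed_subspace_hilbert[OF complex_hilbert_space_axioms K_def R])

lemma P_in: "x \<in> carrier H \<Longrightarrow> P x \<in> K"
  and P_orth: "x \<in> carrier H \<Longrightarrow> k \<in> K \<Longrightarrow> cinner H (x - P x) k = 0"
  using orth_proj_exists[OF complex_hilbert_space_axioms hilbert_K _ , of x] K_in unfolding P_def by blast+

lemma cinner_P: "x \<in> carrier H \<Longrightarrow> k \<in> K \<Longrightarrow> cinner H (P x) k = cinner H x k"
  using P_orth[of x k] by (simp add: cinner_diff_left K_in P_in)

lemma P_eqI:
  assumes x: "x \<in> carrier H" and y: "y \<in> K" and eq: "\<And>k. k \<in> K \<Longrightarrow> cinner H x k = cinner H y k"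
  shows "P x = y"
proof -
  interpret K: complex_hilbert_space "H\<lparr>carrier := K\<rparr>" by (rule hilbert_K)
  have "P x - y \<in> K" using K.diff_in[of "P x" y] P_in[OF x] y by simp
  then have "cinner H (P x - y) (P x - y) = 0"
    using eq[of "P x - y"] cinner_P[OF x, of "P x - y"] by (simp add: cinner_diff_left K_in P_in[OF x] y)
  then show ?thesis using cinner_definite[OF K_in[OF \<open>P x - y \<in> K\<close>]] by simp
qed

lemma P_add: "x \<in> carrier H \<Longrightarrow> y \<in> carrier H \<Longrightarrow> P (x + y) = P x + P y"
  using complex_hilbert_space.add_in[OF hilbert_K]
  by (intro P_eqI) (simp_all add: add_in P_in cinner_add_left K_in cinner_P)

lemma P_diff: "x \<in> carrier H \<Longrightarrow> y \<in> carrier H \<Longrightarrow> P (x - y) = P x - P y"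
  using complex_hilbert_space.diff_in[OF hilbert_K]
  by (intro P_eqI) (simp_all add: diff_in P_in cinner_diff_left K_in cinner_P)

lemma P_scale: "x \<in> carrier H \<Longrightarrow> P (cscale H c x) = cscale H c (P x)"
  using complex_hilbert_space.scale_in[OF hilbert_K]
  by (intro P_eqI) (simp_all add: scale_in P_in cinner_scale_left K_in cinner_P)

lemma P_id: "k \<in> K \<Longrightarrow> P k = k"
  by (intro P_eqI) (simp_all add: K_in)

lemma P_R: "x \<in> R \<Longrightarrow> P x = 0"
  using R complex_hilbert_space.zero_in[OF hilbert_K] by (intro P_eqI) (auto simp: K_def)

text \<open>
  If \<open>B\<close> maps \<open>R\<close> to \<open>R\<close>, then its adjoint maps the complement \<open>K\<close> to itself, so \<open>B\<close> preserves the kernel of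
  the projection \<open>P\<close>.  Hence compression to \<open>K\<close> is multiplicative on such operators.
\<close>

lemma P_commute:
  assumes B: "bounded_op H H B" and BR: "\<And>y. y \<in> R \<Longrightarrow> B y \<in> R" and x: "x \<in> carrier H"
  shows "P (B (P x)) = P (B x)"
proof -
  have lin: "linear_op H H B" using B by (simp add: bounded_op_def)
  have Px: "P x \<in> carrier H" by (rule K_in[OF P_in[OF x]])
  show ?thesis
  proof (rule P_eqI[OF linear_opD(1)[OF lin Px] P_in[OF linear_opD(1)[OF lin x]]])
    fix k assume k: "k \<in> K"
    let ?a = "adjoint_op H H B k"
    note adj = adjoint_op_exists[OF complex_hilbert_space_axioms complex_hilbert_space_axioms B K_in[OF k]]
    have aK: "?a \<in> K"
      using adj BR k R unfolding K_def by fastforce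
    have "cinner H (B (P x)) k = cinner H (P x) ?a" using adj Px by blast
    also have "\<dots> = cinner H x ?a" by (rule cinner_P[OF x aK])
    also have "\<dots> = cinner H (B x) k" using adj x by simp
    finally show "cinner H (B (P x)) k = cinner H (P (B x)) k"
      using cinner_P[OF linear_opD(1)[OF lin x] k] by simp
  qed
qed

lemma compression_linear:
  assumes "bounded_op H H B"
  shows "linear_op (H\<lparr>carrier := K\<rparr>) (H\<lparr>carrier := K\<rparr>) (\<lambda>x. P (B x))"
  using assms unfolding linear_op_def bounded_op_def
  by (auto simp: K_in P_in P_add P_scale)

lemma compression_commute:
  assumes "bounded_op H H B" "\<And>y. y \<in> R \<Longrightarrow> B y \<in> R"
    and "bounded_op H H C" "\<And>y. y \<in> R \<Longrightarrow> C y \<in> R"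
    and BC: "\<And>x. x \<in> carrier H \<Longrightarrow> B (C x) = C (B x)" and k: "k \<in> K"
  shows "P (B (P (C k))) = P (C (P (B k)))"
proof -
  have "B k \<in> carrier H" "C k \<in> carrier H"
    using assms(1,3) K_in[OF k] unfolding bounded_op_def linear_op_def by blast+
  then show ?thesis
    using P_commute[OF assms(1,2), of "C k"] P_commute[OF assms(3,4), of "B k"] BC[OF K_in[OF k]] by simp
qed

end

section \<open>Gleason decompositions at boundary points\<close>

text \<open>
  Congruence of \<open>F\<close> to the constant \<open>c\<close> modulo the ideal generated by \<open>z - l\<close> and \<open>w - m\<close>.  The point
  \<open>(l, m)\<close> may lie outside the bidisc, and \<open>c\<close> takes the role of the value of \<open>F\<close> there.  Being a congruence,
  the relation is compatible with sums, products and bounded inverses; so it passes from the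
  coordinates to every function that is built from them by these operations.
\<close>

definition gleason_at :: "complex \<Rightarrow> complex \<Rightarrow> (complex \<times> complex \<Rightarrow> complex) \<Rightarrow> complex \<Rightarrow> bool" where
  "gleason_at l m F c \<longleftrightarrow> F \<in> Hinf2 \<and> (\<exists>g\<in>Hinf2. \<exists>h\<in>Hinf2. \<forall>z\<in>\<DD>. \<forall>w\<in>\<DD>.
     F (z, w) = c + (z - l) * g (z, w) + (w - m) * h (z, w))"

lemma gleason_atI:
  assumes "F \<in> Hinf2" "g \<in> Hinf2" "h \<in> Hinf2"
    and "\<And>z w. z \<in> \<DD> \<Longrightarrow> w \<in> \<DD> \<Longrightarrow> F (z, w) = c + (z - l) * g (z, w) + (w - m) * h (z, w)"
  shows "gleason_at l m F c"
  using assms unfolding gleason_at_def by blast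

lemma gleason_atE:
  assumes "gleason_at l m F c"
  obtains g h where "F \<in> Hinf2" "g \<in> Hinf2" "h \<in> Hinf2"
    "\<And>z w. z \<in> \<DD> \<Longrightarrow> w \<in> \<DD> \<Longrightarrow> F (z, w) = c + (z - l) * g (z, w) + (w - m) * h (z, w)"
  using assms unfolding gleason_at_def by blast

lemma gleason_const: "gleason_at l m (\<lambda>p. c) c"
  by (rule gleason_atI[OF _ Hinf2_const[of 0] Hinf2_const[of 0]]) (simp_all add: Hinf2_const)

lemma gleason_fst: "gleason_at l m fst l"
  by (rule gleason_atI[OF _ Hinf2_const[of 1] Hinf2_const[of 0]]) (simp_all add: Hinf2_fst)

lemma gleason_snd: "gleason_at l m snd m"
  by (rule gleason_atI[OF _ Hinf2_const[of 0] Hinf2_const[of 1]]) (simp_all add: Hinf2_snd)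

lemma gleason_add:
  assumes "gleason_at l m F c" "gleason_at l m G e"
  shows "gleason_at l m (\<lambda>p. F p + G p) (c + e)"
proof -
  obtain g h where F: "F \<in> Hinf2" "g \<in> Hinf2" "h \<in> Hinf2"
    "\<And>z w. z \<in> \<DD> \<Longrightarrow> w \<in> \<DD> \<Longrightarrow> F (z, w) = c + (z - l) * g (z, w) + (w - m) * h (z, w)"
    using assms(1) by (rule gleason_atE) blast
  obtain g' h' where G: "G \<in> Hinf2" "g' \<in> Hinf2" "h' \<in> Hinf2"
    "\<And>z w. z \<in> \<DD> \<Longrightarrow> w \<in> \<DD> \<Longrightarrow> G (z, w) = e + (z - l) * g' (z, w) + (w - m) * h' (z, w)"
    using assms(2) by (rule gleason_atE) blast
  show ?thesis
    by (rule gleason_atI[OF Hinf2_add[OF F(1) G(1)] Hinf2_add[OF F(2) G(2)] Hinf2_add[OF F(3) G(3)]])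
      (simp only: F(4) G(4), simp add: algebra_simps)
qed

lemma gleason_mult:
  assumes "gleason_at l m F c" "gleason_at l m G e"
  shows "gleason_at l m (\<lambda>p. F p * G p) (c * e)"
proof -
  obtain g h where F: "F \<in> Hinf2" "g \<in> Hinf2" "h \<in> Hinf2"
    "\<And>z w. z \<in> \<DD> \<Longrightarrow> w \<in> \<DD> \<Longrightarrow> F (z, w) = c + (z - l) * g (z, w) + (w - m) * h (z, w)"
    using assms(1) by (rule gleason_atE) blast
  obtain g' h' where G: "G \<in> Hinf2" "g' \<in> Hinf2" "h' \<in> Hinf2"
    "\<And>z w. z \<in> \<DD> \<Longrightarrow> w \<in> \<DD> \<Longrightarrow> G (z, w) = e + (z - l) * g' (z, w) + (w - m) * h' (z, w)"
    using assms(2) by (rule gleason_atE) blast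
  have comb: "(\<lambda>p. u p * G p + c * u' p) \<in> Hinf2" if "u \<in> Hinf2" "u' \<in> Hinf2" for u u'
    using that by (intro Hinf2_add Hinf2_mult Hinf2_const G(1))
  show ?thesis
  proof (rule gleason_atI[OF Hinf2_mult[OF F(1) G(1)] comb[OF F(2) G(2)] comb[OF F(3) G(3)]])
    fix z w :: complex assume "z \<in> \<DD>" "w \<in> \<DD>"
    note eqs = F(4)[OF this] G(4)[OF this]
    have "F (z, w) * G (z, w) = (F (z, w) - c) * G (z, w) + c * G (z, w)" by (simp add: algebra_simps)
    also have "c * G (z, w) = c * (e + (z - l) * g' (z, w) + (w - m) * h' (z, w))" by (simp only: eqs(2))
    also have "F (z, w) - c = (z - l) * g (z, w) + (w - m) * h (z, w)" by (simp add: eqs(1))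
    finally show "F (z, w) * G (z, w) = c * e + (z - l) * (g (z, w) * G (z, w) + c * g' (z, w))
        + (w - m) * (h (z, w) * G (z, w) + c * h' (z, w))"
      by (simp add: algebra_simps)
  qed
qed

lemma gleason_inverse:
  assumes "gleason_at l m F c" and c: "c \<noteq> 0"
    and e: "e > 0" "\<And>z w. z \<in> \<DD> \<Longrightarrow> w \<in> \<DD> \<Longrightarrow> e \<le> cmod (F (z, w))"
  shows "gleason_at l m (\<lambda>p. inverse (F p)) (inverse c)"
proof -
  obtain g h where F: "F \<in> Hinf2" "g \<in> Hinf2" "h \<in> Hinf2"
    "\<And>z w. z \<in> \<DD> \<Longrightarrow> w \<in> \<DD> \<Longrightarrow> F (z, w) = c + (z - l) * g (z, w) + (w - m) * h (z, w)"
    using assms(1) by (rule gleason_atE) blast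
  note inv = Hinf2_inverse[OF F(1) e]
  have comb: "(\<lambda>p. - inverse c * (inverse (F p) * u p)) \<in> Hinf2" if "u \<in> Hinf2" for u
    using that by (intro Hinf2_mult Hinf2_const inv)
  show ?thesis
  proof (rule gleason_atI[OF inv comb[OF F(2)] comb[OF F(3)]])
    fix z w :: complex assume zw: "z \<in> \<DD>" "w \<in> \<DD>"
    have nz: "F (z, w) \<noteq> 0" using e(2)[OF zw] e(1) by auto
    have "inverse (F (z, w)) = inverse c - inverse c * inverse (F (z, w)) * (F (z, w) - c)"
      using nz c by (simp add: field_simps)
    also have "F (z, w) - c = (z - l) * g (z, w) + (w - m) * h (z, w)" by (simp add: F(4)[OF zw])
    finally show "inverse (F (z, w)) = inverse c + (z - l) * (- inverse c * (inverse (F (z, w)) * g (z, w)))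
        + (w - m) * (- inverse c * (inverse (F (z, w)) * h (z, w)))"
      by (simp add: algebra_simps)
  qed
qed

lemma gleason_sum:
  "(\<And>k. k \<in> S \<Longrightarrow> gleason_at l m (F k) (c k)) \<Longrightarrow> gleason_at l m (\<lambda>p. \<Sum>k\<in>S. F k p) (\<Sum>k\<in>S. c k)"
  by (induction S rule: infinite_finite_induct) (simp_all add: gleason_const gleason_add)

lemma gleason_prod:
  "(\<And>k. k \<in> S \<Longrightarrow> gleason_at l m (F k) (c k)) \<Longrightarrow> gleason_at l m (\<lambda>p. \<Prod>k\<in>S. F k p) (\<Prod>k\<in>S. c k)"
  by (induction S rule: infinite_finite_induct) (simp_all add: gleason_const gleason_mult)

lemma gleason_poly: "gleason_at l m (\<lambda>p. poly q (fst p)) (poly q l)"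
proof (induction q)
  case (pCons a q)
  show ?case
    using gleason_add[OF gleason_const gleason_mult[OF gleason_fst pCons(2)]] by simp
qed (simp add: gleason_const)

lemma gleason_cong:
  assumes "gleason_at l m F c" "\<And>z w. z \<in> \<DD> \<Longrightarrow> w \<in> \<DD> \<Longrightarrow> G (z, w) = F (z, w)"
  shows "gleason_at l m G c"
proof -
  obtain g h where F: "F \<in> Hinf2" "g \<in> Hinf2" "h \<in> Hinf2"
    "\<And>z w. z \<in> \<DD> \<Longrightarrow> w \<in> \<DD> \<Longrightarrow> F (z, w) = c + (z - l) * g (z, w) + (w - m) * h (z, w)"
    using assms(1) by (rule gleason_atE) blast
  obtain C where C: "\<forall>z\<in>\<DD>. \<forall>w\<in>\<DD>. cmod (F (z, w)) \<le> C" using Hinf2D(3)[OF F(1)] by blast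
  have "G \<in> Hinf2"
  proof (rule Hinf2I[where C = C])
    show "(\<lambda>z. G (z, w)) holomorphic_on \<DD>" if "w \<in> \<DD>" for w
      using Hinf2D(1)[OF F(1) that] by (rule holomorphic_transform) (use that in \<open>simp add: assms(2)\<close>)
    show "(\<lambda>w. G (z, w)) holomorphic_on \<DD>" if "z \<in> \<DD>" for z
      using Hinf2D(2)[OF F(1) that] by (rule holomorphic_transform) (use that in \<open>simp add: assms(2)\<close>)
  qed (use C assms(2) in auto)
  then show ?thesis using F assms(2) by (intro gleason_atI[of G g h]) auto
qed

text \<open>
  At a zero of \<open>q\<close> on the unit circle boundedness forces \<open>p\<close> to vanish as well.  Cancelling the common
  linear factor lowers the degree of \<open>q\<close>.
\<close>

lemma bounded_rational_reduced:
  fixes p q :: "complex poly"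
  assumes "\<And>z. z \<in> \<DD> \<Longrightarrow> poly q z \<noteq> 0" "\<And>z. z \<in> \<DD> \<Longrightarrow> r z = poly p z / poly q z"
    and "\<And>z. z \<in> \<DD> \<Longrightarrow> cmod (r z) \<le> C"
  shows "\<exists>p q. (\<forall>z\<in>cball 0 1. poly q z \<noteq> 0) \<and> (\<forall>z\<in>\<DD>. r z = poly p z / poly q z)"
  using assms
proof (induction "degree q" arbitrary: p q rule: less_induct)
  case less
  show ?case
  proof (cases "\<forall>z\<in>cball 0 1. poly q z \<noteq> 0")
    case True
    then show ?thesis using less.prems(2) by blast
  next
    case False
    then obtain a where a: "a \<in> cball 0 1" "poly q a = 0" by blast
    have "closed {z. cmod (poly p z) \<le> C * cmod (poly q z)}"
      by (intro closed_Collect_le continuous_intros)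
    moreover have "\<DD> \<subseteq> {z. cmod (poly p z) \<le> C * cmod (poly q z)}"
      using less.prems by (auto simp: norm_divide divide_le_eq)
    ultimately have "closure \<DD> \<subseteq> {z. cmod (poly p z) \<le> C * cmod (poly q z)}" by (rule closure_minimal[rotated])
    then have "cmod (poly p a) \<le> C * cmod (poly q a)" using a(1) by auto
    then have "poly p a = 0" using a(2) by simp
    then obtain p' where p': "p = [:- a, 1:] * p'" by (auto simp: poly_eq_0_iff_dvd)
    obtain q' where q': "q = [:- a, 1:] * q'" using a(2) by (auto simp: poly_eq_0_iff_dvd)
    have "poly q 0 \<noteq> 0" using less.prems(1) by simp
    then have "q' \<noteq> 0" by (auto simp: q')
    then have "degree q = Suc (degree q')" unfolding q' by (subst degree_mult_eq) auto
    then have deg: "degree q' < degree q" by simp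
    have ne: "poly q' z \<noteq> 0" "z - a \<noteq> 0" if "z \<in> \<DD>" for z
      using less.prems(1)[OF that] by (auto simp: q')
    have "r z = poly p' z / poly q' z" if "z \<in> \<DD>" for z
    proof -
      have "r z = ((z - a) * poly p' z) / ((z - a) * poly q' z)"
      proof -
        have "poly [:- a, 1:] z = z - a" by simp
        then show ?thesis by (simp only: less.prems(2)[OF that] p' q' poly_mult)
      qed
      then show ?thesis unfolding nonzero_mult_divide_mult_cancel_left[OF ne(2)[OF that]] .
    qed
    then show ?thesis using less.hyps[OF deg ne(1)] less.prems(3) by blast
  qed
qed

lemma gleason_rational:
  fixes p q :: "complex poly"
  assumes q: "\<forall>z\<in>cball 0 1. poly q z \<noteq> 0" and l: "l \<in> cball 0 1"
  shows "gleason_at l m (\<lambda>x. poly p (fst x) * inverse (poly q (fst x))) (poly p l * inverse (poly q l))"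
proof -
  have "compact (cball (0::complex) 1)" "cball (0::complex) 1 \<noteq> {}" by auto
  moreover have "continuous_on (cball 0 1) (\<lambda>z. cmod (poly q z))" by (intro continuous_intros)
  ultimately obtain b where b: "b \<in> cball 0 1" "\<And>z. z \<in> cball 0 1 \<Longrightarrow> cmod (poly q b) \<le> cmod (poly q z)"
    using continuous_attains_inf[of "cball 0 1" "\<lambda>z. cmod (poly q z)"] by blast
  have "gleason_at l m (\<lambda>x. inverse (poly q (fst x))) (inverse (poly q l))"
  proof (rule gleason_inverse[OF gleason_poly])
    show "0 < cmod (poly q b)" using q b(1) by simp
    show "cmod (poly q b) \<le> cmod (poly q (fst (z, w)))" if "z \<in> \<DD>" for z w :: complex
      using b(2)[of z] that by simp
    show "poly q l \<noteq> 0" using q l by blast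
  qed
  with gleason_poly show ?thesis by (rule gleason_mult)
qed

lemma gleason_det:
  assumes M: "\<And>p. M p \<in> carrier_mat d d" and N: "N \<in> carrier_mat d d"
    and e: "\<And>i j. i < d \<Longrightarrow> j < d \<Longrightarrow> gleason_at l m (\<lambda>p. M p $$ (i, j)) (N $$ (i, j))"
  shows "gleason_at l m (\<lambda>p. Determinant.det (M p)) (Determinant.det N)"
proof -
  have "\<pi> i < d" if "\<pi> permutes {0..<d}" "i < d" for \<pi> i
    using permutes_in_image[OF that(1), of i] that(2) by simp
  then show ?thesis
    unfolding Determinant.det_def'[OF M] Determinant.det_def'[OF N]
    by (intro gleason_sum gleason_mult gleason_const gleason_prod e) auto
qed

section \<open>The model and its characteristic function\<close>

locale rational_model =
  fixes d :: nat and \<Psi> :: "complex \<Rightarrow> complex mat"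
  assumes model: "rational_pure_inner d \<Psi>"
begin

definition symbol :: "(complex \<times> complex \<Rightarrow> complex) \<Rightarrow> complex \<Rightarrow> complex mat" where
  "symbol f z = fun_of_mat d (\<lambda>w. f (z, w)) (\<Psi> z)"

lemma \<Psi>_Hinf: "\<Psi> \<in> Hinf_mat d"
  and \<Psi>_spectrum: "z \<in> \<DD> \<Longrightarrow> spectrum (\<Psi> z) \<subseteq> \<DD>"
  using model by (auto simp: rational_pure_inner_def inner_fun_def)

lemma \<Psi>_carrier: "z \<in> \<DD> \<Longrightarrow> \<Psi> z \<in> carrier_mat d d"
  by (rule Hinf_matD(1)[OF \<Psi>_Hinf])

lemma \<Psi>_disc: "z \<in> \<DD> \<Longrightarrow> matrix_in_disc d (\<Psi> z)"
  by unfold_locales (simp_all only: \<Psi>_carrier \<Psi>_spectrum)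

lemma model_calc_symbol: "model_calc d \<Psi> f = mult_op d (symbol f)"
  by (simp add: model_calc_def symbol_def [abs_def])

lemma symbol_Hinf: "f \<in> Hinf2 \<Longrightarrow> symbol f \<in> Hinf_mat d"
  unfolding symbol_def [abs_def] by (rule model_symbol_Hinf[OF model])

lemma bounded_model_calc: "f \<in> Hinf2 \<Longrightarrow> bounded_op (hardy d) (hardy d) (model_calc d \<Psi> f)"
  unfolding model_calc_symbol by (intro bounded_mult_op symbol_Hinf)

lemma shift_Hinf: "(\<lambda>z. z \<cdot>\<^sub>m 1\<^sub>m d) \<in> Hinf_mat d"
  unfolding Hinf_mat_def
proof (intro CollectI conjI ballI allI impI exI[of _ 1])
  fix i j assume "i < d" "j < d"
  then show "(\<lambda>z. (z \<cdot>\<^sub>m 1\<^sub>m d) $$ (i, j)) holomorphic_on \<DD>" by (auto intro!: holomorphic_intros)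
  show "cmod ((z \<cdot>\<^sub>m 1\<^sub>m d) $$ (i, j)) \<le> 1" if "z \<in> \<DD>" for z
    using that \<open>i < d\<close> \<open>j < d\<close> by auto
qed simp

lemma shift_apply: "shift_op d h z i = (if z \<in> \<DD> \<and> i < d then z * h z i else 0)"
proof -
  have "(\<Sum>j<d. (z \<cdot>\<^sub>m 1\<^sub>m d) $$ (i, j) * h z j) = (\<Sum>j<d. if j = i then z * h z j else 0)" if "i < d"
    using that by (intro sum.cong refl) auto
  then show ?thesis by (simp add: shift_op_def mult_op_def)
qed

lemma bounded_shift: "bounded_op (hardy d) (hardy d) (shift_op d)"
  unfolding shift_op_def by (rule bounded_mult_op[OF shift_Hinf])

lemma mult_op_compose:
  assumes "\<Phi> \<in> Hinf_mat d" "\<Theta> \<in> Hinf_mat d"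
  shows "mult_op d \<Phi> (mult_op d \<Theta> h) = mult_op d (\<lambda>z. \<Phi> z * \<Theta> z) h"
proof (intro ext)
  fix z i
  show "mult_op d \<Phi> (mult_op d \<Theta> h) z i = mult_op d (\<lambda>z. \<Phi> z * \<Theta> z) h z i"
  proof (cases "z \<in> \<DD> \<and> i < d")
    case True
    then have zi: "z \<in> \<DD>" "i < d" by auto
    have "mult_op d \<Phi> (mult_op d \<Theta> h) z i = matvec d (\<Phi> z) (matvec d (\<Theta> z) (h z)) i"
      using zi by (simp add: mult_op_def matvec_def)
    also have "\<dots> = matvec d (\<Phi> z * \<Theta> z) (h z) i"
      by (rule matvec_mult[OF Hinf_matD(1)[OF assms(1) zi(1)] Hinf_matD(1)[OF assms(2) zi(1)] zi(2), symmetric])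
    also have "\<dots> = mult_op d (\<lambda>z. \<Phi> z * \<Theta> z) h z i"
      using zi by (simp add: mult_op_def matvec_def)
    finally show ?thesis .
  next
    case False
    then show ?thesis unfolding mult_op_def by (simp only: if_False)
  qed
qed

lemma mult_op_commute:
  assumes "\<Phi> \<in> Hinf_mat d" "\<Theta> \<in> Hinf_mat d"
    and "\<And>z. z \<in> \<DD> \<Longrightarrow> \<Phi> z * \<Theta> z = \<Theta> z * \<Phi> z"
  shows "mult_op d \<Phi> (mult_op d \<Theta> h) = mult_op d \<Theta> (mult_op d \<Phi> h)"
  unfolding mult_op_compose[OF assms(1,2)] mult_op_compose[OF assms(2,1)]
  by (intro ext) (simp add: mult_op_def assms(3))

lemma symbol_commute_\<Psi>:
  assumes "f \<in> Hinf2" "z \<in> \<DD>"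
  shows "\<Psi> z * symbol f z = symbol f z * \<Psi> z"
  unfolding symbol_def
  by (rule matrix_in_disc.fun_of_mat_commute[OF \<Psi>_disc Hinf2D(2) \<Psi>_carrier refl, symmetric]) (fact assms)+

lemma model_calc_commute:
  assumes f: "f \<in> Hinf2" and g: "g \<in> Hinf2"
  shows "model_calc d \<Psi> f (model_calc d \<Psi> g h) = model_calc d \<Psi> g (model_calc d \<Psi> f h)"
  unfolding model_calc_symbol
proof (rule mult_op_commute[OF symbol_Hinf[OF f] symbol_Hinf[OF g]])
  fix z assume z: "z \<in> \<DD>"
  show "symbol f z * symbol g z = symbol g z * symbol f z"
    unfolding symbol_def[of f]
    by (rule matrix_in_disc.fun_of_mat_commute[OF \<Psi>_disc[OF z] Hinf2D(2)[OF f z]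
          Hinf_matD(1)[OF symbol_Hinf[OF g] z] symbol_commute_\<Psi>[OF g z]])
qed

lemma model_calc_commute_\<Psi>:
  assumes f: "f \<in> Hinf2"
  shows "mult_op d \<Psi> (model_calc d \<Psi> f h) = model_calc d \<Psi> f (mult_op d \<Psi> h)"
  unfolding model_calc_symbol
  by (rule mult_op_commute[OF \<Psi>_Hinf symbol_Hinf[OF f] symbol_commute_\<Psi>[OF f]])

lemma shift_commute:
  assumes "\<Phi> \<in> Hinf_mat d"
  shows "shift_op d (mult_op d \<Phi> h) = mult_op d \<Phi> (shift_op d h)"
proof (intro ext)
  fix z i
  show "shift_op d (mult_op d \<Phi> h) z i = mult_op d \<Phi> (shift_op d h) z i"
    by (simp add: shift_apply) (simp add: mult_op_def shift_apply sum_distrib_left mult.left_commute)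
qed

text \<open>
  The functional calculus applied to \<open>1 = f + (z - l) g + (w - m) e\<close>, entry by entry at every \<open>z\<close>.
\<close>

lemma model_calc_unit:
  assumes f: "f \<in> Hinf2" and g: "g \<in> Hinf2" and e: "e \<in> Hinf2"
    and unit: "\<And>z w. z \<in> \<DD> \<Longrightarrow> w \<in> \<DD> \<Longrightarrow> 1 = f (z, w) + (z - l) * g (z, w) + (w - m) * e (z, w)"
    and k: "k \<in> carrier (hardy d)"
  shows "k = model_calc d \<Psi> f k
    + ((shift_op d (model_calc d \<Psi> g k) - cscale (hardy d) l (model_calc d \<Psi> g k))
      + (mult_op d \<Psi> (model_calc d \<Psi> e k) - cscale (hardy d) m (model_calc d \<Psi> e k)))"
proof (intro ext)
  fix z i
  let ?F = "symbol f z" and ?G = "symbol g z" and ?E = "symbol e z"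
  show "k z i = (model_calc d \<Psi> f k
    + ((shift_op d (model_calc d \<Psi> g k) - cscale (hardy d) l (model_calc d \<Psi> g k))
      + (mult_op d \<Psi> (model_calc d \<Psi> e k) - cscale (hardy d) m (model_calc d \<Psi> e k)))) z i"
  proof (cases "z \<in> \<DD> \<and> i < d")
    case False
    then have "mult_op d \<Phi> h z i = 0" "shift_op d h z i = 0" for \<Phi> h
      unfolding mult_op_def shift_op_def by (simp_all only: if_False)
    then show ?thesis using hardy_outside[OF k, of z i] False by (auto simp: model_calc_symbol hardy_simps)
  next
    case True
    then have z: "z \<in> \<DD>" and i: "i < d" by auto
    interpret matrix_in_disc d "\<Psi> z" by (rule \<Psi>_disc[OF z])
    note hf = Hinf2D(2)[OF f z] and hg = Hinf2D(2)[OF g z] and he = Hinf2D(2)[OF e z]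
    have entry: "(if i = j then 1 else 0) = ?F $$ (i, j) + (z - l) * ?G $$ (i, j)
        + ((\<Psi> z * ?E) $$ (i, j) + (- m) * ?E $$ (i, j))" if j: "j < d" for j
    proof -
      have h1: "(\<lambda>w. (z - l) * g (z, w)) holomorphic_on \<DD>" "(\<lambda>w. (- m) * e (z, w)) holomorphic_on \<DD>"
        "(\<lambda>w. w * e (z, w)) holomorphic_on \<DD>"
        by (intro holomorphic_intros hg he)+
      have h2: "(\<lambda>w. f (z, w) + (z - l) * g (z, w)) holomorphic_on \<DD>"
        "(\<lambda>w. w * e (z, w) + (- m) * e (z, w)) holomorphic_on \<DD>"
        by (rule holomorphic_on_add[OF hf h1(1)], rule holomorphic_on_add[OF h1(3,2)])
      have h3: "(\<lambda>w. (f (z, w) + (z - l) * g (z, w)) + (w * e (z, w) + (- m) * e (z, w))) holomorphic_on \<DD>"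
        by (rule holomorphic_on_add[OF h2])
      have "fun_of_mat d (\<lambda>w. 1) (\<Psi> z)
          = fun_of_mat d (\<lambda>w. (f (z, w) + (z - l) * g (z, w)) + (w * e (z, w) + (- m) * e (z, w))) (\<Psi> z)"
        by (rule fun_of_mat_cong[OF h3]) (simp add: unit[OF z] algebra_simps)
      then show ?thesis
        using fun_of_mat_one[OF i j]
        by (simp only: fun_of_mat_add[OF h2 i j] fun_of_mat_add[OF hf h1(1) i j] fun_of_mat_add[OF h1(3,2) i j]
            fun_of_mat_cmult[OF hg i j] fun_of_mat_cmult[OF he i j] fun_of_mat_times_id[OF he i j] symbol_def)
    qed
    have "k z i = (\<Sum>j<d. if j = i then k z j else 0)" using i by simp
    also have "\<dots> = (\<Sum>j<d. (if i = j then 1 else 0) * k z j)" by (intro sum.cong refl) auto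
    also have "\<dots> = (\<Sum>j<d. (?F $$ (i, j) * k z j + (z - l) * (?G $$ (i, j) * k z j))
        + ((\<Psi> z * ?E) $$ (i, j) * k z j + (- m) * (?E $$ (i, j) * k z j)))"
      by (intro sum.cong refl) (simp only: entry lessThan_iff, simp only: distrib_right mult.assoc)
    also have "\<dots> = ((\<Sum>j<d. ?F $$ (i, j) * k z j) + (z - l) * (\<Sum>j<d. ?G $$ (i, j) * k z j))
        + ((\<Sum>j<d. (\<Psi> z * ?E) $$ (i, j) * k z j) + (- m) * (\<Sum>j<d. ?E $$ (i, j) * k z j))"
      by (simp only: sum.distrib sum_distrib_left)
    also have "(\<Sum>j<d. ?F $$ (i, j) * k z j) = model_calc d \<Psi> f k z i"
      using z i by (simp add: model_calc_symbol mult_op_def)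
    also have "(\<Sum>j<d. ?G $$ (i, j) * k z j) = model_calc d \<Psi> g k z i"
      using z i by (simp add: model_calc_symbol mult_op_def)
    also have "(\<Sum>j<d. ?E $$ (i, j) * k z j) = model_calc d \<Psi> e k z i"
      using z i by (simp add: model_calc_symbol mult_op_def)
    also have "(\<Sum>j<d. (\<Psi> z * ?E) $$ (i, j) * k z j) = mult_op d \<Psi> (model_calc d \<Psi> e k) z i"
      unfolding model_calc_symbol mult_op_compose[OF \<Psi>_Hinf symbol_Hinf[OF e]] using z i by (simp add: mult_op_def)
    finally show ?thesis
      using z i by (simp add: shift_apply hardy_simps algebra_simps)
  qed
qed

definition char_fun :: "complex \<times> complex \<Rightarrow> complex" where
  "char_fun = (\<lambda>(z, w). poly (char_poly (\<Psi> z)) w)"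

lemma char_fun_det:
  assumes "z \<in> \<DD>"
  shows "char_fun (z, w) = Determinant.det (Matrix.mat d d (\<lambda>(i, j). (if i = j then w else 0) - \<Psi> z $$ (i, j)))"
proof -
  have "- char_matrix (\<Psi> z) w = Matrix.mat d d (\<lambda>(i, j). (if i = j then w else 0) - \<Psi> z $$ (i, j))"
    using \<Psi>_carrier[OF assms] by (intro eq_matI) (auto simp: char_matrix_def)
  then show ?thesis by (simp add: char_fun_def char_poly_matrix[OF \<Psi>_carrier[OF assms]])
qed

lemma symbol_char_fun:
  assumes "z \<in> \<DD>" "i < d" "j < d"
  shows "symbol (\<lambda>p. c * char_fun p) z $$ (i, j) = 0"
proof -
  interpret matrix_in_disc d "\<Psi> z" by (rule \<Psi>_disc[OF assms(1)])
  have "poly (char_poly (\<Psi> z)) holomorphic_on \<DD>" by (intro holomorphic_intros)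
  from fun_of_mat_cmult[OF this assms(2,3), of c] show ?thesis
    by (simp add: symbol_def char_fun_def Cayley_Hamilton[OF assms(2,3)])
qed

lemma model_calc_char_fun: "model_calc d \<Psi> (\<lambda>p. c * char_fun p) h = 0"
  by (intro ext) (simp add: model_calc_symbol mult_op_def symbol_char_fun)

lemma entries_reduced:
  obtains p q :: "nat \<Rightarrow> nat \<Rightarrow> complex poly" where
    "\<And>i j. i < d \<Longrightarrow> j < d \<Longrightarrow> \<forall>z\<in>cball 0 1. poly (q i j) z \<noteq> 0"
    "\<And>i j z. i < d \<Longrightarrow> j < d \<Longrightarrow> z \<in> \<DD> \<Longrightarrow> \<Psi> z $$ (i, j) = poly (p i j) z * inverse (poly (q i j) z)"
proof -
  obtain C where C: "\<And>z i j. z \<in> \<DD> \<Longrightarrow> i < d \<Longrightarrow> j < d \<Longrightarrow> cmod (\<Psi> z $$ (i, j)) \<le> C"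
    using Hinf_matD(3)[OF \<Psi>_Hinf] by blast
  have "\<exists>p q :: complex poly. i < d \<longrightarrow> j < d \<longrightarrow>
    (\<forall>z\<in>cball 0 1. poly q z \<noteq> 0) \<and> (\<forall>z\<in>\<DD>. \<Psi> z $$ (i, j) = poly p z / poly q z)" for i j
  proof (cases "i < d \<and> j < d")
    case True
    then obtain p q :: "complex poly" where "\<And>z. z \<in> \<DD> \<Longrightarrow> poly q z \<noteq> 0"
        "\<And>z. z \<in> \<DD> \<Longrightarrow> \<Psi> z $$ (i, j) = poly p z / poly q z"
      using model unfolding rational_pure_inner_def rational_entries_def by blast
    from bounded_rational_reduced[OF this C] True show ?thesis by blast
  qed blast
  then obtain p q :: "nat \<Rightarrow> nat \<Rightarrow> complex poly" where
    "\<And>i j. i < d \<longrightarrow> j < d \<longrightarrow> (\<forall>z\<in>cball 0 1. poly (q i j) z \<noteq> 0)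
      \<and> (\<forall>z\<in>\<DD>. \<Psi> z $$ (i, j) = poly (p i j) z / poly (q i j) z)" by metis
  then have pq: "\<forall>z\<in>cball 0 1. poly (q i j) z \<noteq> 0" "\<forall>z\<in>\<DD>. \<Psi> z $$ (i, j) = poly (p i j) z / poly (q i j) z"
    if "i < d" "j < d" for i j
    using that by blast+
  show ?thesis
  proof (rule that[of q p])
    show "\<Psi> z $$ (i, j) = poly (p i j) z * inverse (poly (q i j) z)" if "i < d" "j < d" "z \<in> \<DD>" for i j z
      unfolding divide_inverse[symmetric] using pq(2)[OF that(1,2)] that(3) by blast
  qed (rule pq(1))
qed

text \<open>
  \<open>\<chi>(z, m)\<close> is the product of the differences \<open>m - a\<close> over the \<open>d\<close> eigenvalues \<open>a\<close> of \<open>\<Psi>(z)\<close>.  If the product is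
  less than \<open>(e / 2)\<^sup>d\<close>, one of them is less than \<open>e / 2\<close>.  That eigenvalue lies in the open disc, so
  \<open>(z, a)\<close> is a point of the variety.
\<close>

lemma closure_V_if_char_fun_small:
  assumes X: "X \<longlonglongrightarrow> l" "\<And>n. X n \<in> \<DD>" and lim: "(\<lambda>n. char_fun (X n, m)) \<longlonglongrightarrow> 0"
  shows "(l, m) \<in> closure (V_set d \<Psi>)"
proof (rule closure_approachable[THEN iffD2], intro allI impI)
  fix e :: real assume e: "e > 0"
  have "\<forall>\<^sub>F n in sequentially. dist (X n) l < e / 2" using tendstoD[OF X(1), of "e / 2"] e by simp
  moreover have "\<forall>\<^sub>F n in sequentially. cmod (char_fun (X n, m)) < (e / 2) ^ d"
    using tendstoD[OF lim, of "(e / 2) ^ d"] e by simp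
  ultimately have "\<forall>\<^sub>F n in sequentially. dist (X n) l < e / 2 \<and> cmod (char_fun (X n, m)) < (e / 2) ^ d"
    by (rule eventually_conj)
  then obtain n where n: "dist (X n) l < e / 2" "cmod (char_fun (X n, m)) < (e / 2) ^ d"
    using eventually_happens'[OF sequentially_bot] by blast
  let ?z = "X n"
  note carr = \<Psi>_carrier[OF X(2)[of n]]
  obtain as where as: "char_poly (\<Psi> ?z) = (\<Prod>a\<leftarrow>as. [:- a, 1:])" "length as = d"
    using char_poly_factorized[OF carr] by blast
  have prod: "cmod (poly (\<Prod>a\<leftarrow>bs. [:- a, 1:]) m) \<ge> (e / 2) ^ length bs"
    if "\<And>a. a \<in> set bs \<Longrightarrow> cmod (m - a) \<ge> e / 2" for bs
    using that
  proof (induction bs)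
    case (Cons b bs)
    then have "(e / 2) * (e / 2) ^ length bs \<le> cmod (m - b) * cmod (poly (\<Prod>a\<leftarrow>bs. [:- a, 1:]) m)"
      using e by (intro mult_mono) auto
    then show ?case by (simp add: norm_mult[symmetric] algebra_simps)
  qed simp
  have "\<exists>a\<in>set as. cmod (m - a) < e / 2"
    using prod[of as] n(2) as by (force simp: char_fun_def not_less)
  then obtain a where a: "a \<in> set as" "cmod (m - a) < e / 2" by blast
  have "poly (char_poly (\<Psi> ?z)) a = 0" unfolding as(1) by (rule linear_poly_root[OF a(1)])
  then have ev: "eigenvalue (\<Psi> ?z) a" using eigenvalue_root_char_poly[OF carr] by simp
  have aD: "a \<in> \<DD>" using \<Psi>_spectrum[OF X(2)] ev unfolding spectrum_def by blast
  have "char_matrix (\<Psi> ?z) a = \<Psi> ?z - a \<cdot>\<^sub>m 1\<^sub>m d"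
    using carr by (intro eq_matI) (auto simp: char_matrix_def)
  then have "(?z, a) \<in> V_set d \<Psi>"
    using X(2) aD ev eigenvalue_det[OF carr, of a] by (simp add: V_set_def)
  moreover have "dist (?z, a) (l, m) < e"
  proof -
    have "dist (?z, a) (l, m) \<le> dist ?z l + dist a m"
      unfolding dist_Pair_Pair by (rule sqrt_sum_squares_le_sum) auto
    then show ?thesis using n(1) a(2) by (simp add: dist_norm norm_minus_commute)
  qed
  ultimately show "\<exists>y\<in>V_set d \<Psi>. dist y (l, m) < e" by blast
qed

text \<open>
  The constant \<open>c\<close> is the determinant of \<open>m - \<Psi>(l)\<close>, with \<open>\<Psi>(l)\<close> given by the reduced fractions.  If it
  were zero, approaching \<open>l\<close> along its radius would put \<open>(l, m)\<close> into the closure of the variety.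
\<close>

lemma char_fun_gleason:
  assumes l: "l \<in> cball 0 1" and V: "(l, m) \<notin> closure (V_set d \<Psi>)"
  obtains c where "c \<noteq> 0" "gleason_at l m char_fun c"
proof -
  obtain p q :: "nat \<Rightarrow> nat \<Rightarrow> complex poly" where
    q: "\<And>i j. i < d \<Longrightarrow> j < d \<Longrightarrow> \<forall>z\<in>cball 0 1. poly (q i j) z \<noteq> 0"
    and pq: "\<And>i j z. i < d \<Longrightarrow> j < d \<Longrightarrow> z \<in> \<DD> \<Longrightarrow> \<Psi> z $$ (i, j) = poly (p i j) z * inverse (poly (q i j) z)"
    by (rule entries_reduced[OF that])
  define M where "M z w = Matrix.mat d d (\<lambda>(i, j). (if i = j then w else 0) + - 1 * (poly (p i j) z * inverse (poly (q i j) z)))"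
    for z w :: complex
  have M: "M z w \<in> carrier_mat d d" for z w by (simp add: M_def)
  have char_M: "char_fun (z, w) = Determinant.det (M z w)" if "z \<in> \<DD>" for z w
    unfolding char_fun_det[OF that] M_def
    by (rule arg_cong[where f = Determinant.det], rule eq_matI) (auto simp: pq[OF _ _ that])
  have diag: "gleason_at l m (\<lambda>x. if i = j then snd x else 0) (if i = j then m else 0)" for i j :: nat
    by (cases "i = j") (simp_all add: gleason_snd gleason_const)
  have "gleason_at l m (\<lambda>x. Determinant.det (M (fst x) (snd x))) (Determinant.det (M l m))"
  proof (rule gleason_det[OF M M])
    fix i j assume ij: "i < d" "j < d"
    have "gleason_at l m (\<lambda>x. (if i = j then snd x else 0) + - 1 * (poly (p i j) (fst x) * inverse (poly (q i j) (fst x))))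
        ((if i = j then m else 0) + - 1 * (poly (p i j) l * inverse (poly (q i j) l)))"
      by (intro gleason_add gleason_mult[OF gleason_const gleason_rational[OF q[OF ij] l]] diag)
    then show "gleason_at l m (\<lambda>x. M (fst x) (snd x) $$ (i, j)) (M l m $$ (i, j))"
      using ij by (simp add: M_def)
  qed
  then have gl: "gleason_at l m char_fun (Determinant.det (M l m))"
    by (rule gleason_cong) (simp add: char_M)
  have "Determinant.det (M l m) \<noteq> 0"
  proof
    assume det0: "Determinant.det (M l m) = 0"
    (* the points approach l along its radius and stay in the open disc *)
    define X where "X n = of_real (1 - 1 / real (n + 2)) * l" for n
    have "(\<lambda>n. 1 - 1 / real (n + 2)) \<longlonglongrightarrow> 1" by real_asymp
    then have "(\<lambda>n. complex_of_real (1 - 1 / real (n + 2)) * l) \<longlonglongrightarrow> of_real 1 * l"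
      by (intro tendsto_intros)
    then have X: "X \<longlonglongrightarrow> l" by (simp add: X_def [abs_def])
    have XD: "X n \<in> \<DD>" for n
    proof -
      have "0 \<le> 1 - 1 / real (n + 2)" "1 - 1 / real (n + 2) < 1" by simp_all
      moreover have "cmod l \<le> 1" using l by simp
      ultimately have "\<bar>1 - 1 / real (n + 2)\<bar> * cmod l < 1"
        using mult_left_le[of "cmod l" "1 - 1 / real (n + 2)"] by linarith
      then show ?thesis unfolding X_def mem_ball dist_norm norm_minus_commute[of 0] diff_zero norm_mult norm_of_real .
    qed
    have entry: "(\<lambda>n. M (X n) m $$ (i, j)) \<longlonglongrightarrow> M l m $$ (i, j)" if ij: "i < d" "j < d" for i j
    proof -
      have "poly (q i j) l \<noteq> 0" using q[OF ij] l by blast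
      then have "(\<lambda>n. (if i = j then m else 0) + - 1 * (poly (p i j) (X n) * inverse (poly (q i j) (X n))))
          \<longlonglongrightarrow> (if i = j then m else 0) + - 1 * (poly (p i j) l * inverse (poly (q i j) l))"
        by (intro tendsto_add tendsto_mult tendsto_const tendsto_inverse tendsto_poly X)
      then show ?thesis using ij unfolding M_def by simp
    qed
    have "(\<lambda>n. Determinant.det (M (X n) m)) \<longlonglongrightarrow> Determinant.det (M l m)"
      unfolding Determinant.det_def'[OF M]
    proof (intro tendsto_sum tendsto_mult tendsto_const tendsto_prod)
      fix \<pi> i assume "\<pi> \<in> {\<pi>. \<pi> permutes {0..<d}}" and i: "i \<in> {0..<d}"
      then have "\<pi> i \<in> {0..<d}" using permutes_in_image[of \<pi> "{0..<d}" i] by blast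
      then show "(\<lambda>n. M (X n) m $$ (i, \<pi> i)) \<longlonglongrightarrow> M l m $$ (i, \<pi> i)"
        using i by (intro entry) simp_all
    qed
    then have "(\<lambda>n. char_fun (X n, m)) \<longlonglongrightarrow> 0" by (simp add: char_M[OF XD] det0)
    from closure_V_if_char_fun_small[OF X XD this] V show False by simp
  qed
  with gl that show ?thesis by blast
qed

text \<open>
  A congruence at one point contains membership in \<open>H\<^sup>\<infinity>\<close>; the point \<open>(0, 2)\<close> is far from the variety.
\<close>

lemma char_fun_Hinf: "char_fun \<in> Hinf2"
proof -
  have "bounded (V_set d \<Psi>)"
    by (rule bounded_subset[of "\<DD> \<times> \<DD>"]) (auto simp: V_set_def intro!: bounded_Times)
  then have "closure (V_set d \<Psi>) \<subseteq> cball 0 1 \<times> cball 0 1"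
    by (intro closure_minimal closed_Times) (auto simp: V_set_def)
  then have "(0, 2) \<notin> closure (V_set d \<Psi>)" by auto
  from char_fun_gleason[OF _ this] show ?thesis by (auto elim: gleason_atE)
qed

lemma left_eigenvector:
  assumes z: "z \<in> \<DD>" and root: "char_fun (z, w) = 0"
  obtains u i where "i < d" "u i \<noteq> 0" "\<And>j. j < d \<Longrightarrow> (\<Sum>i<d. u i * \<Psi> z $$ (i, j)) = w * u j"
proof -
  let ?T = "transpose_mat (\<Psi> z)"
  have T: "?T \<in> carrier_mat d d" using \<Psi>_carrier[OF z] by simp
  have "eigenvalue ?T w"
    using root \<Psi>_carrier[OF z] by (simp add: eigenvalue_root_char_poly[OF T] char_fun_def)
  then obtain v where v: "v \<in> carrier_vec d" "v \<noteq> 0\<^sub>v d" "?T *\<^sub>v v = w \<cdot>\<^sub>v v"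
    using T by (auto simp: eigenvalue_def eigenvector_def)
  have "\<exists>i<d. Matrix.vec_index v i \<noteq> 0"
  proof (rule ccontr)
    assume "\<not> (\<exists>i<d. Matrix.vec_index v i \<noteq> 0)"
    then have "v = 0\<^sub>v d" using v(1) by (intro eq_vecI) auto
    then show False using v(2) by simp
  qed
  then obtain i where i: "i < d" "Matrix.vec_index v i \<noteq> 0" by blast
  have "(\<Sum>i<d. Matrix.vec_index v i * \<Psi> z $$ (i, j)) = w * Matrix.vec_index v j" if j: "j < d" for j
  proof -
    have "Matrix.vec_index (?T *\<^sub>v v) j = (\<Sum>i<d. Matrix.vec_index v i * \<Psi> z $$ (i, j))"
      using T v(1) \<Psi>_carrier[OF z] j by (simp add: scalar_prod_def atLeast0LessThan mult.commute)
    then show ?thesis unfolding v(3) using v(1) j by simp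
  qed
  with i that[of i "\<lambda>i. Matrix.vec_index v i"] show ?thesis by blast
qed

end

section \<open>The Taylor spectrum of the constrained co-extension\<close>

text \<open>
  The properties of an annihilator on which the spectral argument rests.
\<close>

locale annihilator_model = rational_model d \<Psi> for d \<Psi> +
  fixes A :: "(complex \<times> complex \<Rightarrow> complex) set"
  assumes A_Hinf: "A \<subseteq> Hinf2"
    and A_char_fun: "char_fun \<in> A"
    and A_scale: "\<And>f c. f \<in> A \<Longrightarrow> (\<lambda>p. c * f p) \<in> A"
begin

definition range_set where
  "range_set = (\<Union>f\<in>A. model_calc d \<Psi> f ` carrier (hardy d))"

lemma range_setI: "f \<in> A \<Longrightarrow> u \<in> carrier (hardy d) \<Longrightarrow> model_calc d \<Psi> f u \<in> range_set"
  unfolding range_set_def by blast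

lemma model_calc_in: "f \<in> Hinf2 \<Longrightarrow> u \<in> carrier (hardy d) \<Longrightarrow> model_calc d \<Psi> f u \<in> carrier (hardy d)"
  unfolding model_calc_symbol by (rule mult_op_in[OF symbol_Hinf])

sublocale C: orth_complement "hardy d" range_set
proof -
  interpret complex_hilbert_space "hardy d" by (rule hilbert_hardy)
  show "orth_complement (hardy d) range_set"
    by unfold_locales (use A_Hinf model_calc_in in \<open>auto simp: range_set_def\<close>)
qed

lemma K_eq: "C.K = {k \<in> carrier (hardy d). \<forall>f\<in>A. adjoint_op (hardy d) (hardy d) (model_calc d \<Psi> f) k = 0}"
proof -
  have "adjoint_op (hardy d) (hardy d) (model_calc d \<Psi> f) k = 0
      \<longleftrightarrow> (\<forall>u\<in>carrier (hardy d). cinner (hardy d) (model_calc d \<Psi> f u) k = 0)"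
    if "f \<in> A" "k \<in> carrier (hardy d)" for f k
    using that A_Hinf by (intro adjoint_op_eq_0_iff hilbert_hardy bounded_model_calc) auto
  moreover have "(\<forall>y\<in>range_set. cinner (hardy d) y k = 0)
      \<longleftrightarrow> (\<forall>f\<in>A. \<forall>u\<in>carrier (hardy d). cinner (hardy d) (model_calc d \<Psi> f u) k = 0)" for k
    unfolding range_set_def by blast
  ultimately show ?thesis unfolding C.K_def by auto
qed

abbreviation "K_space \<equiv> (hardy d)\<lparr>carrier := C.K\<rparr>"
abbreviation "S1 k \<equiv> C.P (shift_op d k)"
abbreviation "S2 k \<equiv> C.P (mult_op d \<Psi> k)"

lemma range_invariant:
  assumes "y \<in> range_set"
  shows "shift_op d y \<in> range_set" "mult_op d \<Psi> y \<in> range_set"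
    "g \<in> Hinf2 \<Longrightarrow> model_calc d \<Psi> g y \<in> range_set"
proof -
  obtain f u where f: "f \<in> A" and u: "u \<in> carrier (hardy d)" and y: "y = model_calc d \<Psi> f u"
    using assms by (auto simp: range_set_def)
  have fH: "f \<in> Hinf2" using f A_Hinf by blast
  show "shift_op d y \<in> range_set"
    unfolding y model_calc_symbol shift_commute[OF symbol_Hinf[OF fH]] unfolding model_calc_symbol[symmetric] shift_op_def
    by (rule range_setI[OF f mult_op_in[OF shift_Hinf u]])
  show "mult_op d \<Psi> y \<in> range_set"
    unfolding y model_calc_commute_\<Psi>[OF fH] by (rule range_setI[OF f mult_op_in[OF \<Psi>_Hinf u]])
  show "model_calc d \<Psi> g y \<in> range_set" if g: "g \<in> Hinf2"
    unfolding y model_calc_commute[OF g fH] by (rule range_setI[OF f model_calc_in[OF g u]])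
qed

text \<open>
  A decomposition of \<open>1\<close> that excludes \<open>(l, m)\<close> from the support becomes, after compression to \<open>K\<close>, a unit
  relation for \<open>(S\<^sub>1 - l, S\<^sub>2 - m)\<close>, because the operators \<open>f(M\<^sub>z, M\<^sub>\<Psi>)\<close> with \<open>f \<in> A\<close> have range in \<open>K\<^sup>\<bottom>\<close>.
\<close>

lemma exact_off_supp:
  assumes "(l, m) \<notin> supp A"
  shows "koszul_exact K_space S1 S2 l m"
proof -
  obtain f g e where f: "f \<in> A" and g: "g \<in> Hinf2" and e: "e \<in> Hinf2"
    and unit: "\<And>z w. z \<in> \<DD> \<Longrightarrow> w \<in> \<DD> \<Longrightarrow> 1 = f (z, w) + (z - l) * g (z, w) + (w - m) * e (z, w)"
  proof -
    have "\<exists>f\<in>A. \<exists>g\<in>Hinf2. \<exists>h\<in>Hinf2. \<forall>(z, w)\<in>\<DD> \<times> \<DD>. 1 = f (z, w) + (z - l) * g (z, w) + (w - m) * h (z, w)"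
      using assms by (simp add: supp_def)
    then obtain f g h where fgh: "f \<in> A" "g \<in> Hinf2" "h \<in> Hinf2"
        and eq: "\<forall>(z, w)\<in>\<DD> \<times> \<DD>. 1 = f (z, w) + (z - l) * g (z, w) + (w - m) * h (z, w)" by blast
    have "1 = f (z, w) + (z - l) * g (z, w) + (w - m) * h (z, w)" if "z \<in> \<DD>" "w \<in> \<DD>" for z w
    proof -
      have "(z, w) \<in> \<DD> \<times> \<DD>" using that by blast
      from bspec[OF eq this] show ?thesis by (simp only: case_prod_conv)
    qed
    then show thesis by (rule that[OF fgh])
  qed
  have fH: "f \<in> Hinf2" using f A_Hinf by blast
  note bd = bounded_shift bounded_mult_op[OF \<Psi>_Hinf] bounded_model_calc[OF g] bounded_model_calc[OF e]
  have sym: "shift_op d (model_calc d \<Psi> h x) = model_calc d \<Psi> h (shift_op d x)" if "h \<in> Hinf2" for h x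
    unfolding model_calc_symbol by (rule shift_commute[OF symbol_Hinf[OF that]])
  show ?thesis
  proof (rule koszul_exact_if_unit[OF C.hilbert_K C.compression_linear[OF bd(1)] C.compression_linear[OF bd(2)]
        C.compression_linear[OF bd(3)] C.compression_linear[OF bd(4)]])
    fix x assume "x \<in> carrier K_space"
    then have x: "x \<in> C.K" by simp
    have xH: "x \<in> carrier (hardy d)" by (rule C.K_in[OF x])
    show "S1 (S2 x) = S2 (S1 x)"
      by (rule C.compression_commute[OF bd(1) range_invariant(1) bd(2) range_invariant(2)
            shift_commute[OF \<Psi>_Hinf] x])
    show "S1 (C.P (model_calc d \<Psi> g x)) = C.P (model_calc d \<Psi> g (S1 x))"
      by (rule C.compression_commute[OF bd(1) range_invariant(1) bd(3) range_invariant(3)[OF _ g] sym[OF g] x])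
    show "S2 (C.P (model_calc d \<Psi> g x)) = C.P (model_calc d \<Psi> g (S2 x))"
      by (rule C.compression_commute[OF bd(2) range_invariant(2) bd(3) range_invariant(3)[OF _ g]
            model_calc_commute_\<Psi>[OF g] x])
    show "S1 (C.P (model_calc d \<Psi> e x)) = C.P (model_calc d \<Psi> e (S1 x))"
      by (rule C.compression_commute[OF bd(1) range_invariant(1) bd(4) range_invariant(3)[OF _ e] sym[OF e] x])
    show "S2 (C.P (model_calc d \<Psi> e x)) = C.P (model_calc d \<Psi> e (S2 x))"
      by (rule C.compression_commute[OF bd(2) range_invariant(2) bd(4) range_invariant(3)[OF _ e]
            model_calc_commute_\<Psi>[OF e] x])
    let ?f = "model_calc d \<Psi> f x" and ?g = "model_calc d \<Psi> g x" and ?e = "model_calc d \<Psi> e x"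
    have inn: "?f \<in> carrier (hardy d)" "?g \<in> carrier (hardy d)" "?e \<in> carrier (hardy d)"
      by (intro model_calc_in fH g e xH)+
    have inn2: "shift_op d ?g \<in> carrier (hardy d)" "mult_op d \<Psi> ?e \<in> carrier (hardy d)"
      unfolding shift_op_def by (intro mult_op_in shift_Hinf \<Psi>_Hinf inn)+
    note inn3 = C.scale_in[OF inn(2), of l] C.scale_in[OF inn(3), of m]
    note inn4 = C.diff_in[OF inn2(1) inn3(1)] C.diff_in[OF inn2(2) inn3(2)]
    have "x = C.P x" by (rule C.P_id[OF x, symmetric])
    also have "\<dots> = C.P (?f + ((shift_op d ?g - cscale (hardy d) l ?g) + (mult_op d \<Psi> ?e - cscale (hardy d) m ?e)))"
      by (rule arg_cong[where f = C.P], rule model_calc_unit[OF fH g e unit xH])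
    also have "\<dots> = C.P ?f + ((C.P (shift_op d ?g) - cscale (hardy d) l (C.P ?g))
        + (C.P (mult_op d \<Psi> ?e) - cscale (hardy d) m (C.P ?e)))"
      unfolding C.P_add[OF inn(1) C.add_in[OF inn4]] C.P_add[OF inn4] C.P_diff[OF inn2(1) inn3(1)]
        C.P_diff[OF inn2(2) inn3(2)] C.P_scale[OF inn(2)] C.P_scale[OF inn(3)] ..
    also have "C.P ?f = 0" by (rule C.P_R[OF range_setI[OF f xH]])
    also have "C.P (shift_op d ?g) = S1 (C.P ?g)"
      by (rule C.P_commute[OF bd(1) range_invariant(1) inn(2), symmetric])
    also have "C.P (mult_op d \<Psi> ?e) = S2 (C.P ?e)"
      by (rule C.P_commute[OF bd(2) range_invariant(2) inn(3), symmetric])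
    finally have "x = 0 + ((S1 (C.P ?g) - cscale (hardy d) l (C.P ?g)) + (S2 (C.P ?e) - cscale (hardy d) m (C.P ?e)))" .
    note eq = this
    have csc: "cscale K_space = cscale (hardy d)" by simp
    show "x = S1 (C.P ?g) - cscale K_space l (C.P ?g) + (S2 (C.P ?e) - cscale K_space m (C.P ?e))"
      unfolding csc using eq unfolding add_0_left .
  qed
qed

text \<open>
  The kernel \<open>k\<close> built from a left eigenvector \<open>u\<close> satisfies \<open>\<langle>f(M\<^sub>z, M\<^sub>\<Psi>) h, k\<rangle> = f(l, m) \<langle>h, k\<rangle>\<close>.  For \<open>f \<in> A\<close>
  this shows \<open>k \<in> K\<close>; for the coordinate functions it shows that \<open>k\<close> is orthogonal to the ranges of
  \<open>S\<^sub>1 - l\<close> and \<open>S\<^sub>2 - m\<close>, whose sum is therefore not all of \<open>K\<close>.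
\<close>

lemma not_exact_on_zero_set:
  assumes "(l, m) \<in> zero_set A"
  shows "\<not> koszul_exact K_space S1 S2 l m"
proof
  assume exact: "koszul_exact K_space S1 S2 l m"
  have l: "l \<in> \<DD>" and m: "m \<in> \<DD>" and Z: "\<And>f. f \<in> A \<Longrightarrow> f (l, m) = 0"
    using assms by (auto simp: zero_set_def)
  have "char_fun (l, m) = 0" by (rule Z[OF A_char_fun])
  then obtain u i where i: "i < d" "u i \<noteq> 0" and u: "\<And>j. j < d \<Longrightarrow> (\<Sum>i<d. u i * \<Psi> l $$ (i, j)) = m * u j"
    using left_eigenvector[OF l] by blast
  interpret matrix_in_disc d "\<Psi> l" by (rule \<Psi>_disc[OF l])
  define k where "k = szego d l (\<lambda>i. cnj (u i))"
  have kH: "k \<in> carrier (hardy d)" unfolding k_def by (rule szego_hardy(1)[OF l])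
  have ck: "cinner (hardy d) h k = (\<Sum>i<d. u i * h l i)" if "h \<in> carrier (hardy d)" for h
    unfolding k_def cinner_szego[OF l that] by simp
  have row: "(\<Sum>i<d. u i * (\<Sum>j<d. B $$ (i, j) * h j)) = c * (\<Sum>j<d. u j * h j)"
    if "\<And>j. j < d \<Longrightarrow> (\<Sum>i<d. u i * B $$ (i, j)) = c * u j" for B :: "complex mat" and h c
  proof -
    have "(\<Sum>i<d. u i * (\<Sum>j<d. B $$ (i, j) * h j)) = (\<Sum>j<d. (\<Sum>i<d. u i * B $$ (i, j)) * h j)"
      unfolding sum_distrib_left sum_distrib_right by (subst sum.swap) (simp add: mult.assoc)
    also have "\<dots> = (\<Sum>j<d. c * (u j * h j))" by (intro sum.cong refl) (simp add: that)
    finally show ?thesis by (simp add: sum_distrib_left)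
  qed
  have mk: "cinner (hardy d) (mult_op d \<Phi> h) k = c * cinner (hardy d) h k"
    if "\<Phi> \<in> Hinf_mat d" "h \<in> carrier (hardy d)" "\<And>j. j < d \<Longrightarrow> (\<Sum>i<d. u i * \<Phi> l $$ (i, j)) = c * u j" for \<Phi> h c
    unfolding ck[OF mult_op_in[OF that(1,2)]] ck[OF that(2)]
    using row[OF that(3), of "h l"] l by (simp add: mult_op_def)
  have kK: "k \<in> C.K"
    unfolding C.K_def
  proof (intro CollectI conjI kH ballI)
    fix y assume "y \<in> range_set"
    then obtain f h where f: "f \<in> A" and h: "h \<in> carrier (hardy d)" and y: "y = model_calc d \<Psi> f h"
      by (auto simp: range_set_def)
    have fH: "f \<in> Hinf2" using f A_Hinf by blast
    have "cinner (hardy d) (mult_op d (symbol f) h) k = f (l, m) * cinner (hardy d) h k"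
      by (rule mk[OF symbol_Hinf[OF fH] h], unfold symbol_def)
        (rule fun_of_mat_left_eigenvector[OF Hinf2D(2)[OF fH l] m _ u])
    then show "cinner (hardy d) y k = 0" unfolding y model_calc_symbol by (simp add: Z[OF f])
  qed
  have s1: "cinner (hardy d) (S1 h) k = l * cinner (hardy d) h k" if "h \<in> C.K" for h
  proof -
    have hH: "h \<in> carrier (hardy d)" by (rule C.K_in[OF that])
    have sH: "shift_op d h \<in> carrier (hardy d)" unfolding shift_op_def by (rule mult_op_in[OF shift_Hinf hH])
    show ?thesis
      unfolding C.cinner_P[OF sH kK] ck[OF sH] ck[OF hH] using l by (simp add: shift_apply sum_distrib_left mult_ac)
  qed
  have s2: "cinner (hardy d) (S2 h) k = m * cinner (hardy d) h k" if "h \<in> C.K" for h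
    unfolding C.cinner_P[OF mult_op_in[OF \<Psi>_Hinf C.K_in[OF that]] kK] by (rule mk[OF \<Psi>_Hinf C.K_in[OF that] u])
  have "k \<in> koszul1 K_space S1 S2 l m ` (C.K \<times> C.K)"
    using exact kK by (simp add: koszul_exact_def)
  then obtain x y where x: "x \<in> C.K" and y: "y \<in> C.K"
    and k: "k = (S1 y - cscale (hardy d) l y) - (S2 x - cscale (hardy d) m x)"
    by (auto simp: koszul1_def)
  note xH = C.K_in[OF x] and yH = C.K_in[OF y]
  have S1y: "S1 y \<in> carrier (hardy d)"
    unfolding shift_op_def by (rule C.K_in[OF C.P_in[OF mult_op_in[OF shift_Hinf yH]]])
  have S2x: "S2 x \<in> carrier (hardy d)" by (rule C.K_in[OF C.P_in[OF mult_op_in[OF \<Psi>_Hinf xH]]])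
  have "cinner (hardy d) ((S1 y - cscale (hardy d) l y) - (S2 x - cscale (hardy d) m x)) k = 0"
    by (simp only: C.cinner_diff_left C.diff_in C.scale_in S1y S2x xH yH kH C.cinner_scale_left s1[OF y] s2[OF x]
        diff_self)
  then have "cinner (hardy d) k k = 0" unfolding k[symmetric] .
  then have "k = 0" by (rule C.cinner_definite[OF kH])
  then have "k 0 i = 0" by simp
  then show False using i by (simp add: k_def szego_def)
qed

lemma not_in_supp:
  assumes "f \<in> A" "g \<in> Hinf2" "h \<in> Hinf2"
    "\<And>z w. z \<in> \<DD> \<Longrightarrow> w \<in> \<DD> \<Longrightarrow> 1 = f (z, w) + (z - l) * g (z, w) + (w - m) * h (z, w)"
  shows "(l, m) \<notin> supp A"
proof -
  have "\<forall>(z, w)\<in>\<DD> \<times> \<DD>. 1 = f (z, w) + (z - l) * g (z, w) + (w - m) * h (z, w)"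
  proof (rule ballI)
    fix p :: "complex \<times> complex" assume "p \<in> \<DD> \<times> \<DD>"
    then obtain z w where p: "p = (z, w)" "z \<in> \<DD>" "w \<in> \<DD>" by blast
    show "case p of (z, w) \<Rightarrow> 1 = f (z, w) + (z - l) * g (z, w) + (w - m) * h (z, w)"
      unfolding p(1) case_prod_conv by (rule assms(4)[OF p(2,3)])
  qed
  with assms(1-3) have "\<exists>f\<in>A. \<exists>g\<in>Hinf2. \<exists>h\<in>Hinf2.
      \<forall>(z, w)\<in>\<DD> \<times> \<DD>. 1 = f (z, w) + (z - l) * g (z, w) + (w - m) * h (z, w)" by blast
  then show ?thesis unfolding supp_def by simp
qed

text \<open>
  Off the closure of the variety \<open>1\<close> is a combination of \<open>c\<^sup>-\<^sup>1 \<chi>\<close>, \<open>z - l\<close> and \<open>w - m\<close> if \<open>l\<close> is in the closed disc.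
  For other \<open>l\<close> the function \<open>z - l\<close> alone is invertible.
\<close>

lemma supp_subset_closure: "supp A \<subseteq> closure (V_set d \<Psi>)"
proof (rule subrelI, rule ccontr)
  fix l m assume lm: "(l, m) \<in> supp A" and V: "(l, m) \<notin> closure (V_set d \<Psi>)"
  note no = not_in_supp[THEN notE, OF _ _ _ _ lm]
  show False
  proof (cases "l \<in> cball 0 1")
    case True
    obtain c where c: "c \<noteq> 0" and gl: "gleason_at l m char_fun c" using char_fun_gleason[OF True V] by blast
    obtain g h where g: "g \<in> Hinf2" and h: "h \<in> Hinf2" and
      eq: "\<And>z w. z \<in> \<DD> \<Longrightarrow> w \<in> \<DD> \<Longrightarrow> char_fun (z, w) = c + (z - l) * g (z, w) + (w - m) * h (z, w)"
      using gl by (rule gleason_atE) blast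
    have neg: "(\<lambda>p. - inverse c * v p) \<in> Hinf2" if "v \<in> Hinf2" for v
      by (rule Hinf2_mult[OF Hinf2_const that])
    show False
    proof (rule no[OF A_scale[OF A_char_fun, of "inverse c"] neg[OF g] neg[OF h]])
      fix z w :: complex assume zw: "z \<in> \<DD>" "w \<in> \<DD>"
      have "inverse c * char_fun (z, w) = 1 + inverse c * ((z - l) * g (z, w) + (w - m) * h (z, w))"
        unfolding eq[OF zw] using c by (simp add: distrib_left)
      then show "1 = inverse c * char_fun (z, w) + (z - l) * (- inverse c * g (z, w)) + (w - m) * (- inverse c * h (z, w))"
        by (simp add: algebra_simps)
    qed
  next
    case False
    then have far: "cmod l - 1 > 0" by simp
    have bd: "cmod l - 1 \<le> cmod (z - l)" if "z \<in> \<DD>" for z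
      using that norm_triangle_sub[of l z] by (simp add: norm_minus_commute)
    have "(\<lambda>p. fst p + - l) \<in> Hinf2" by (rule Hinf2_add[OF Hinf2_fst Hinf2_const])
    from Hinf2_inverse[OF this far] have inv: "(\<lambda>p. inverse (fst p + - l)) \<in> Hinf2" using bd by simp
    show False
    proof (rule no[OF A_scale[OF A_char_fun, of 0] inv Hinf2_const[of 0]])
      fix z w :: complex assume "z \<in> \<DD>"
      then have "z - l \<noteq> 0" using bd[of z] far by auto
      then show "1 = 0 * char_fun (z, w) + (z - l) * inverse (fst (z, w) + - l) + (w - m) * 0" by simp
    qed
  qed
qed

text \<open>
  By the Gleason decomposition a function in \<open>A\<close> that does not vanish at \<open>(l, m)\<close> generates \<open>1\<close> together with
  \<open>z - l\<close> and \<open>w - m\<close>; conversely, evaluating a decomposition of \<open>1\<close> at a common zero gives \<open>1 = 0\<close>.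
\<close>

lemma supp_inter_bidisc: "supp A \<inter> (\<DD> \<times> \<DD>) = zero_set A"
proof (intro equalityI subsetI)
  fix p assume p: "p \<in> supp A \<inter> (\<DD> \<times> \<DD>)"
  obtain l m where lm: "p = (l, m)" by force
  have l: "l \<in> \<DD>" and m: "m \<in> \<DD>" and s: "(l, m) \<in> supp A" using p lm by auto
  have "f (l, m) = 0" if f: "f \<in> A" for f
  proof (rule ccontr)
    assume nz: "f (l, m) \<noteq> 0"
    define c where "c = inverse (f (l, m))"
    have c: "c * f (l, m) = 1" using nz by (simp add: c_def)
    have fH: "f \<in> Hinf2" using f A_Hinf by blast
    obtain g h where g: "g \<in> Hinf2" and h: "h \<in> Hinf2" and
      eq: "\<And>z w. z \<in> \<DD> \<Longrightarrow> w \<in> \<DD> \<Longrightarrow> f (z, w) = f (l, m) + (z - l) * g (z, w) + (w - m) * h (z, w)"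
      by (rule Hinf2_Gleason[OF fH l m]) (rule that)
    have neg: "(\<lambda>p. - c * v p) \<in> Hinf2" if "v \<in> Hinf2" for v
      by (rule Hinf2_mult[OF Hinf2_const that])
    have "(l, m) \<notin> supp A"
    proof (rule not_in_supp[OF A_scale[OF f, of c] neg[OF g] neg[OF h]])
      fix z w :: complex assume zw: "z \<in> \<DD>" "w \<in> \<DD>"
      have "c * f (z, w) = c * f (l, m) + c * ((z - l) * g (z, w) + (w - m) * h (z, w))"
        unfolding eq[OF zw] by (simp add: distrib_left add.assoc)
      then show "1 = c * f (z, w) + (z - l) * (- c * g (z, w)) + (w - m) * (- c * h (z, w))"
        unfolding c by (simp add: algebra_simps)
    qed
    then show False using s by simp
  qed
  then show "p \<in> zero_set A" using l m lm by (simp add: zero_set_def)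
next
  fix p assume p: "p \<in> zero_set A"
  obtain l m where lm: "p = (l, m)" by force
  have l: "l \<in> \<DD>" and m: "m \<in> \<DD>" and Z: "\<And>f. f \<in> A \<Longrightarrow> f (l, m) = 0"
    using p lm by (auto simp: zero_set_def)
  have "(l, m) \<in> supp A"
    unfolding supp_def
  proof (clarify)
    fix f g h
    assume "f \<in> A" and eq: "\<forall>(z, w)\<in>\<DD> \<times> \<DD>. 1 = f (z, w) + (z - l) * g (z, w) + (w - m) * h (z, w)"
    from bspec[OF eq, of "(l, m)"] show False using Z[OF \<open>f \<in> A\<close>] l m by simp
  qed
  then show "p \<in> supp A \<inter> (\<DD> \<times> \<DD>)" using l m lm by simp
qed

end

lemma bounded_isometry:
  assumes "isometry_op H L J"
  shows "bounded_op H L J"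
  using assms unfolding isometry_op_def bounded_op_def by (auto intro!: exI[of _ 1])

text \<open>
  Membership of \<open>f\<close> in the annihilator is the vanishing of all \<open>\<langle>J u, f(M\<^sub>z, M\<^sub>\<Psi>) J h\<rangle>\<close>, which is homogeneous
  in \<open>f\<close> and holds for the characteristic function by the Cayley-Hamilton theorem.
\<close>

lemma annihilator_model_Ann:
  assumes hs: "complex_hilbert_space H" and J: "isometry_op H (hardy d) J" and \<Psi>: "rational_pure_inner d \<Psi>"
  shows "annihilator_model d \<Psi> (Ann H d J \<Psi>)"
proof -
  interpret rational_model d \<Psi> by unfold_locales (rule \<Psi>)
  interpret L: complex_hilbert_space "hardy d" by (rule hilbert_hardy)
  have bJ: "bounded_op H (hardy d) J" by (rule bounded_isometry[OF J])
  then have Jin: "J h \<in> carrier (hardy d)" if "h \<in> carrier H" for h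
    using that unfolding bounded_op_def linear_op_def by blast
  have AnnI: "f \<in> Ann H d J \<Psi> \<longleftrightarrow> (\<forall>h\<in>carrier H. \<forall>u\<in>carrier H.
      cinner (hardy d) (J u) (model_calc d \<Psi> f (J h)) = 0)" if f: "f \<in> Hinf2" for f
  proof -
    have "pair_calc H d J \<Psi> f h = 0 \<longleftrightarrow> (\<forall>u\<in>carrier H. cinner (hardy d) (J u) (model_calc d \<Psi> f (J h)) = 0)"
      if h: "h \<in> carrier H" for h
      unfolding pair_calc_def model_calc_symbol
      by (rule adjoint_op_eq_0_iff[OF hs hilbert_hardy bJ mult_op_in[OF symbol_Hinf[OF f] Jin[OF h]]])
    then show ?thesis using f by (simp add: Ann_def)
  qed
  show ?thesis
  proof unfold_locales
    show "Ann H d J \<Psi> \<subseteq> Hinf2" by (auto simp: Ann_def)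
    show "char_fun \<in> Ann H d J \<Psi>"
      using model_calc_char_fun[of 1] Jin by (simp add: AnnI[OF char_fun_Hinf])
    fix f c assume fA: "f \<in> Ann H d J \<Psi>"
    then have f: "f \<in> Hinf2" by (simp add: Ann_def)
    have cf: "(\<lambda>p. c * f p) \<in> Hinf2" by (rule Hinf2_mult[OF Hinf2_const f])
    have "model_calc d \<Psi> (\<lambda>p. c * f p) h = cscale (hardy d) c (model_calc d \<Psi> f h)" for h
    proof (intro ext)
      fix z i
      show "model_calc d \<Psi> (\<lambda>p. c * f p) h z i = cscale (hardy d) c (model_calc d \<Psi> f h) z i"
      proof (cases "z \<in> \<DD> \<and> i < d")
        case True
        then interpret matrix_in_disc d "\<Psi> z" by (intro \<Psi>_disc) simp
        have "fun_of_mat d (\<lambda>w. c * f (z, w)) (\<Psi> z) $$ (i, j) = c * fun_of_mat d (\<lambda>w. f (z, w)) (\<Psi> z) $$ (i, j)"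
          if "j < d" for j
          using True that by (intro fun_of_mat_cmult Hinf2D(2)[OF f]) auto
        then show ?thesis
          using True by (simp add: model_calc_def mult_op_def hardy_simps sum_distrib_left mult.assoc)
      next
        case False
        then show ?thesis unfolding model_calc_def mult_op_def hardy_simps by (simp only: if_False mult_zero_right)
      qed
    qed
    then show "(\<lambda>p. c * f p) \<in> Ann H d J \<Psi>"
      using fA Jin model_calc_symbol mult_op_in[OF symbol_Hinf[OF f]]
      by (simp add: AnnI[OF cf] AnnI[OF f] L.cinner_scale_right)
  qed
qed

theorem theorem2:
  fixes H :: "'h::ab_group_add inner_product_space"
    and T1 T2 :: "'h \<Rightarrow> 'h"
    and d :: nat
    and J :: "'h \<Rightarrow> complex \<Rightarrow> nat \<Rightarrow> complex"
    and \<Psi> :: "complex \<Rightarrow> complex mat"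
  assumes "complex_hilbert_space H"
    and "contraction_op H T1" "contraction_op H T2"
    and "\<And>h. h \<in> carrier H \<Longrightarrow> T1 (T2 h) = T2 (T1 h)"
    and "pure_op H T1" "pure_op H T2"
    and "finite_defect H T1" "finite_defect H T2"
    and "d = defect_dim H T1"
    and "isometry_op H (hardy d) J"
    and "\<And>h. h \<in> carrier H \<Longrightarrow>
           J (adjoint_op H H T1 h) = adjoint_op (hardy d) (hardy d) (shift_op d) (J h)"
    and "rational_pure_inner d \<Psi>"
    and "\<And>h. h \<in> carrier H \<Longrightarrow>
           J (adjoint_op H H T2 h) = adjoint_op (hardy d) (hardy d) (mult_op d \<Psi>) (J h)"
  shows "let \<sigma> = taylor_spectrum (coext_space H d J \<Psi>) (coext_op1 H d J \<Psi>) (coext_op2 H d J \<Psi>);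
             A = Ann H d J \<Psi>
         in \<sigma> \<subseteq> supp A \<and> supp A \<subseteq> closure (V_set d \<Psi>) \<and>
            \<sigma> \<inter> (\<DD> \<times> \<DD>) = supp A \<inter> (\<DD> \<times> \<DD>) \<and> supp A \<inter> (\<DD> \<times> \<DD>) = zero_set A"
proof -
  interpret annihilator_model d \<Psi> "Ann H d J \<Psi>"
    by (rule annihilator_model_Ann[OF assms(1,10,12)])
  let ?\<sigma> = "taylor_spectrum (coext_space H d J \<Psi>) (coext_op1 H d J \<Psi>) (coext_op2 H d J \<Psi>)"
  have space: "coext_space H d J \<Psi> = K_space"
    unfolding coext_space_def K_eq ..
  have op1: "coext_op1 H d J \<Psi> = (\<lambda>k. S1 k)" and op2: "coext_op2 H d J \<Psi> = (\<lambda>k. S2 k)"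
    unfolding coext_op1_def [abs_def] coext_op2_def [abs_def] space C.P_def by simp_all
  have in_\<sigma>: "(l, m) \<in> ?\<sigma> \<longleftrightarrow> \<not> koszul_exact K_space (\<lambda>k. S1 k) (\<lambda>k. S2 k) l m" for l m
    unfolding taylor_spectrum_def space op1 op2 by simp
  have 1: "?\<sigma> \<subseteq> supp (Ann H d J \<Psi>)"
    using in_\<sigma> exact_off_supp by auto
  have 2: "zero_set (Ann H d J \<Psi>) \<subseteq> ?\<sigma>"
    using in_\<sigma> not_exact_on_zero_set by auto
  have 3: "zero_set (Ann H d J \<Psi>) \<subseteq> \<DD> \<times> \<DD>"
    by (auto simp: zero_set_def)
  have "?\<sigma> \<inter> (\<DD> \<times> \<DD>) = supp (Ann H d J \<Psi>) \<inter> (\<DD> \<times> \<DD>)"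
    using 1 2 3 supp_inter_bidisc by blast
  with 1 supp_subset_closure supp_inter_bidisc show ?thesis
    unfolding Let_def by blast
qed

end
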